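(* For each $\alpha\in(0,1)$ there exists a constant $C_\alpha>0$ (depending only on $\alpha$) such that the following two statements hold. (Public coin) If $$\rho^2 \ge C_\alpha \frac{\sqrt d}{n}\left(\sqrt{\frac{d}{b\wedge d}}\wedge \sqrt m\right),$$ there exists $T\in\mathcal{T}_{pub}(b)$ such that $$\mathcal{R}(H_\rho,T)\le\alpha\qquad\text{for all } n,m,d,b\in\mathbb{N}.$$ (Private coin) If $$\rho^2 \ge C_\alpha \frac{\sqrt d}{n}\left(\frac{d}{b\wedge d}\wedge \sqrt m\right),$$ there exists $T\in\mathcal{T}_{priv}(b)$ such that $$\mathcal{R}(H_\rho,T)\le\alpha\qquad\text{for all } n,m,d,b\in\mathbb{N}.$$ (The protocol $T$ may depend on $n,m,d,b$ and $\alpha$; the constant $C_\alpha$ does not depend on $n,m,d,b$.)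
   Context: Here $a\wedge b=\min\{a,b\}$ and $\mathbb N=\{1,2,\dots\}$. Model. For $f\in\mathbb{R}^d$, under $\mathbb{P}_f$ there are $m$ machines, machine $j\in\{1,\dots,m\}$ observing $X^j=f+\sqrt{m/n}\,Z^j$, where $Z^1,\dots,Z^m$ are independent $d$-dimensional standard normal vectors. Write $X=(X^1,\dots,X^m)$. Each machine $j$ communicates a transcript $Y^j$ taking values in a space $\mathcal{Y}^j$ with $|\mathcal{Y}^j|\le 2^b$; $Y=(Y^1,\dots,Y^m)$ takes values in $\mathcal{Y}=\prod_{j=1}^m\mathcal{Y}^j$. A private coin distributed testing protocol with communication budget $b$ consists of a map $T:\mathcal{Y}\to\{0,1\}$ and Markov kernels $K^j$ from $\mathbb{R}^d$ to $\mathcal{Y}^j$, $j=1,\dots,m$, with $Y^j\mid X^j\sim K^j(\cdot\mid X^j)$, the $Y^j$ being conditionally independent given $X$. A public coin distributed testing protocol with communication budget $b$ consists of a map $T:\mathcal{Y}\to\{0,1\}$, a random variable $U$ with values in a probability space $(\mathcal{U},\mathscr{U},\mathbb{P}^U)$, independent of $X$ (with law not depending on $f$), and Markov kernels $K^j$ from $\mathbb{R}^d\times\mathcal{U}$ to $\mathcal{Y}^j$ with $Y^j\mid(X^j,U)\sim K^j(\cdot\mid X^j,U)$, the $Y^j$ being conditionally independent given $(X,U)$. $\mathcal{T}_{priv}(b)$ and $\mathcal{T}_{pub}(b)$ denote the classes of all private, respectively public, coin distributed testing protocols with budget $b$ per machine; a protocol is denoted simply by $T$, and $\mathbb{P}_f$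 also denotes the induced joint law of $(X,Y,U)$. Alternative and risk: $H_\rho=\{f\in\mathbb{R}^d:\|f\|_2\ge\rho\}$, with $\|\cdot\|_2$ the Euclidean norm, and $$\mathcal{R}(H_\rho,T)=\mathbb{P}_0(T(Y)=1)+\sup_{f\in H_\rho}\mathbb{P}_f(T(Y)=0).$$ *)

theory Defs
  imports "HOL-Probability.Probability"
begin

text \<open>
  The theorem quantifies over the dimension and the number of machines, so vectors of \<open>\<real>\<^sup>d\<close> are
  extensional functions on \<open>{..<d}\<close> and families over the machines are extensional functions on
  \<open>{..<m}\<close>.
\<close>

definition Rn :: "nat \<Rightarrow> (nat \<Rightarrow> real) measure" where
  "Rn d = (\<Pi>\<^sub>M i\<in>{..<d}. borel)"

definition std_normal_vector :: "nat \<Rightarrow> (nat \<Rightarrow> real) measure" where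
  "std_normal_vector d = (\<Pi>\<^sub>M i\<in>{..<d}. density lborel (\<lambda>x. ennreal (std_normal_density x)))"

text \<open>Law of \<open>X = (X\<^sup>1, \<dots>, X\<^sup>m)\<close> with \<open>X\<^sup>j = f + sqrt (m / n) Z\<^sup>j\<close>.\<close>

definition observation_law :: "nat \<Rightarrow> nat \<Rightarrow> nat \<Rightarrow> (nat \<Rightarrow> real) \<Rightarrow> (nat \<Rightarrow> nat \<Rightarrow> real) measure" where
  "observation_law n m d f =
     distr (\<Pi>\<^sub>M j\<in>{..<m}. std_normal_vector d) (\<Pi>\<^sub>M j\<in>{..<m}. Rn d)
       (\<lambda>z. \<lambda>j\<in>{..<m}. \<lambda>i\<in>{..<d}. f i + sqrt (real m / real n) * z j i)"

record 'y protocol =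
  transcripts :: "nat \<Rightarrow> 'y set"
  decision :: "(nat \<Rightarrow> 'y) \<Rightarrow> nat"

record 'y private_protocol = "'y protocol" +
  private_kernel :: "nat \<Rightarrow> (nat \<Rightarrow> real) \<Rightarrow> 'y measure"

record ('y, 'u) public_protocol = "'y protocol" +
  coin :: "'u measure"
  public_kernel :: "nat \<Rightarrow> (nat \<Rightarrow> real) \<times> 'u \<Rightarrow> 'y measure"

definition budget_protocol :: "nat \<Rightarrow> nat \<Rightarrow> ('y, 'z) protocol_scheme \<Rightarrow> bool" where
  "budget_protocol m b p \<longleftrightarrow>
     (\<forall>j<m. finite (transcripts p j) \<and> card (transcripts p j) \<le> 2 ^ b) \<and>
     decision p \<in> (\<Pi>\<^sub>E j\<in>{..<m}. transcripts p j) \<rightarrow> {0, 1}"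

text \<open>
  A Markov kernel from \<open>M\<close> to \<open>N\<close> is a measurable map from \<open>M\<close> to \<open>prob_algebra N\<close>; the finite
  transcript spaces carry the discrete sigma-algebra, so every decision rule is measurable.
\<close>

definition private_protocols :: "nat \<Rightarrow> nat \<Rightarrow> nat \<Rightarrow> 'y private_protocol set" where
  "private_protocols m d b =
     {p. budget_protocol m b p \<and>
         (\<forall>j<m. private_kernel p j \<in> Rn d \<rightarrow>\<^sub>M prob_algebra (count_space (transcripts p j)))}"

definition public_protocols :: "nat \<Rightarrow> nat \<Rightarrow> nat \<Rightarrow> ('y, 'u) public_protocol set" where
  "public_protocols m d b =
     {p. budget_protocol m b p \<and> prob_space (coin p) \<and>
         (\<forall>j<m. public_kernel p j \<in>
            Rn d \<Otimes>\<^sub>M coin p \<rightarrow>\<^sub>M prob_algebra (count_space (transcripts p j)))}"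

text \<open>
  Joint law of \<open>(X, Y)\<close>, respectively \<open>(X, Y, U)\<close>. Conditional independence of the transcripts is
  the product measure in the conditional law of \<open>Y\<close>.
\<close>

definition private_law ::
  "nat \<Rightarrow> nat \<Rightarrow> nat \<Rightarrow> 'y private_protocol \<Rightarrow> (nat \<Rightarrow> real) \<Rightarrow>
     ((nat \<Rightarrow> nat \<Rightarrow> real) \<times> (nat \<Rightarrow> 'y)) measure" where
  "private_law n m d p f =
     do {
       x \<leftarrow> observation_law n m d f;
       y \<leftarrow> (\<Pi>\<^sub>M j\<in>{..<m}. private_kernel p j (x j));
       return ((\<Pi>\<^sub>M j\<in>{..<m}. Rn d) \<Otimes>\<^sub>M (\<Pi>\<^sub>M j\<in>{..<m}. count_space (transcripts p j))) (x, y)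
     }"

definition public_law ::
  "nat \<Rightarrow> nat \<Rightarrow> nat \<Rightarrow> ('y, 'u) public_protocol \<Rightarrow> (nat \<Rightarrow> real) \<Rightarrow>
     ((nat \<Rightarrow> nat \<Rightarrow> real) \<times> (nat \<Rightarrow> 'y) \<times> 'u) measure" where
  "public_law n m d p f =
     do {
       (x, u) \<leftarrow> observation_law n m d f \<Otimes>\<^sub>M coin p;
       y \<leftarrow> (\<Pi>\<^sub>M j\<in>{..<m}. public_kernel p j (x j, u));
       return ((\<Pi>\<^sub>M j\<in>{..<m}. Rn d) \<Otimes>\<^sub>M (\<Pi>\<^sub>M j\<in>{..<m}. count_space (transcripts p j)) \<Otimes>\<^sub>M coin p)
         (x, y, u)
     }"

definition alternative :: "nat \<Rightarrow> real \<Rightarrow> (nat \<Rightarrow> real) set" where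
  "alternative d \<rho> = {f \<in> {..<d} \<rightarrow>\<^sub>E UNIV. L2_set f {..<d} \<ge> \<rho>}"

text \<open>The arguments \<open>P\<close> and \<open>\<phi>\<close> are the family of laws and the test as a random variable.\<close>

definition testing_risk ::
  "nat \<Rightarrow> ((nat \<Rightarrow> real) \<Rightarrow> 'w measure) \<Rightarrow> ('w \<Rightarrow> nat) \<Rightarrow> (nat \<Rightarrow> real) set \<Rightarrow> real" where
  "testing_risk d P \<phi> H =
     (let f0 = (\<lambda>i\<in>{..<d}. 0) in
       measure (P f0) {\<omega> \<in> space (P f0). \<phi> \<omega> = 1} +
       (SUP f\<in>H. measure (P f) {\<omega> \<in> space (P f). \<phi> \<omega> = 0}))"

definition private_risk ::
  "nat \<Rightarrow> nat \<Rightarrow> nat \<Rightarrow> (nat \<Rightarrow> real) set \<Rightarrow> 'y private_protocol \<Rightarrow> real" where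
  "private_risk n m d H p = testing_risk d (private_law n m d p) (\<lambda>(x, y). decision p y) H"

definition public_risk ::
  "nat \<Rightarrow> nat \<Rightarrow> nat \<Rightarrow> (nat \<Rightarrow> real) set \<Rightarrow> ('y, 'u) public_protocol \<Rightarrow> real" where
  "public_risk n m d H p = testing_risk d (public_law n m d p) (\<lambda>(x, y, u). decision p y) H"

text \<open>
  HOL cannot quantify existentially over types, so the theorem asks for witnesses whose transcripts
  lie in \<^typ>\<open>nat\<close> (up to relabelling, every finite set) and whose coin is a probability measure, with
  an arbitrary sigma-algebra, on \<^typ>\<open>nat \<Rightarrow> real\<close>. Fixing these types makes an existence claim
  stronger, not weaker.
\<close>

type_synonym private_test = "nat private_protocol"
type_synonym public_test = "(nat, nat \<Rightarrow> real) public_protocol"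

end

theory Submission
  imports Defs
begin

text \<open>
  After division by the noise level \<open>sqrt (m / n)\<close> every machine sees \<open>g + Z\<close> with standard Gaussian \<open>Z\<close>,
  and \<open>\<rho>\<close> bounds the energy \<open>G\<close>, the squared norm of \<open>g\<close>, from below by \<open>n * \<rho>\<^sup>2 / m\<close>. In all
  protocols each machine sends signs that are independent given its data, with prescribed conditional
  means; the centre compares a linear or quadratic statistic of the signs with a threshold, and Chebyshev's
  inequality bounds both errors. Three kinds of signs are needed.

  \<^item> Summaries of the squared norm. With boundedly many machines, one of them thresholds its squared norm,
  which detects \<open>G\<close> of order \<open>sqrt d\<close>. Otherwise the mean of the sign is \<open>arctan\<close> of the centred and
  rescaled squared norm; the signal shifts it by \<open>min 1 (G / sqrt d)\<close> up to a constant
  (\<open>arctan_shift\<close>), and summing over \<open>m\<close> machines detects \<open>G\<close> of order \<open>sqrt d / sqrt m\<close>. This gives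
  the part \<open>sqrt m\<close> of the minimum in both rates.

  \<^item> Public random directions. A group of machines shares \<open>b\<close> Gaussian directions \<open>u\<close> of length about \<open>1\<close>
  and sends signs with mean \<open>sin (u \<cdot> x)\<close>. The expected sign is a damped \<open>sin (u \<cdot> g)\<close>, of square about
  \<open>min 1 (G / d)\<close> on average, and the covariance of two signs of a machine is at most the inner product of
  their directions (\<open>sin_covariance_bound\<close>). The centre adds, over the directions, the product of the
  sign counts of two halves of the group (\<open>two_half_stat\<close>). For \<open>G\<close> up to \<open>d\<close> its mean is \<open>m\<^sup>2 * b * G / d\<close> and its null
  standard deviation \<open>m * sqrt b\<close>, up to constants, so that \<open>G\<close> of order \<open>d / (m * sqrt b)\<close> is
  detected. A bounded number of groups makes the random signal concentrate
  (\<open>direction_signal_moments\<close>).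

  \<^item> Private coins, fixed directions. Without shared randomness the machines report on the coordinates in
  turn, so that \<open>m * b / d\<close> machines see each of them, and the same statistic detects \<open>G\<close> of order
  \<open>sqrt d * d / (m * b)\<close> provided that the energy is not hidden in few large coordinates, where the sine
  carries no information on the size. To exclude this, the machines also report on the coordinates in the
  Hartley basis: by an uncertainty principle (\<open>hartley_uncertainty\<close>) a vector of energy at most
  \<open>sqrt d / 4\<close> has a fixed proportion of its energy on small coordinates in one of the two bases. Larger
  energies are detected by the squared-norm signs of the remaining machines.
\<close>

section \<open>Second moments on product spaces\<close>

text \<open>
  A function of one coordinate is a product with constant factors elsewhere, so the product formula
  for integrals computes its mean; the same trick handles two coordinates.
\<close>

lemma PiM_integral_component:
  fixes f :: "'b \<Rightarrow> 'c :: {real_normed_field, banach, second_countable_topology}"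
  assumes M: "\<And>i. prob_space (M i)" and I: "finite I" "i \<in> I" and f: "integrable (M i) f"
  shows "integrable (PiM I M) (\<lambda>x. f (x i))" "(\<integral>x. f (x i) \<partial>PiM I M) = (\<integral>y. f y \<partial>M i)"
proof -
  interpret product_prob_space M I by (rule product_prob_spaceI) (rule M)
  define F where "F = (\<lambda>k. if k = i then f else (\<lambda>_. 1))"
  have int: "integrable (M k) (F k)" for k using f by (auto simp: F_def)
  have eq: "(\<lambda>x. f (x i)) = (\<lambda>x. \<Prod>k\<in>I. F k (x k))"
    using I by (auto simp: F_def fun_eq_iff if_distrib[of "\<lambda>g. g _"] prod.delta' cong: if_cong)
  show "integrable (PiM I M) (\<lambda>x. f (x i))"
    unfolding eq by (rule product_integrable_prod) (use I int in auto)
  have "(\<integral>x. f (x i) \<partial>PiM I M) = (\<Prod>k\<in>I. integral\<^sup>L (M k) (F k))"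
    unfolding eq by (rule product_integral_prod) (use I int in auto)
  also have "\<dots> = (\<Prod>k\<in>I. if k = i then integral\<^sup>L (M i) f else 1)"
    by (intro prod.cong refl) (auto simp: F_def M.prob_space)
  finally show "(\<integral>x. f (x i) \<partial>PiM I M) = (\<integral>y. f y \<partial>M i)" using I by simp
qed

lemma PiM_integral_two_components:
  fixes f g :: "'b \<Rightarrow> real"
  assumes M: "\<And>i. prob_space (M i)" and I: "finite I" "i \<in> I" "j \<in> I" "i \<noteq> j"
    and f: "integrable (M i) f" and g: "integrable (M j) g"
  shows "integrable (PiM I M) (\<lambda>x. f (x i) * g (x j))"
    "(\<integral>x. f (x i) * g (x j) \<partial>PiM I M) = (\<integral>y. f y \<partial>M i) * (\<integral>y. g y \<partial>M j)"
proof -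
  interpret product_prob_space M I by (rule product_prob_spaceI) (rule M)
  define F where "F = (\<lambda>k. if k = i then f else if k = j then g else (\<lambda>_. 1))"
  have int: "integrable (M k) (F k)" for k using f g by (auto simp: F_def)
  have prod2: "(\<Prod>k\<in>I. if k = i then u else if k = j then v else 1) = u * v" for u v :: real
  proof -
    have "(\<Prod>k\<in>I. if k = i then u else if k = j then v else 1)
        = (\<Prod>k\<in>I. (if k = i then u else 1) * (if k = j then v else 1))"
      using I(4) by (intro prod.cong) auto
    then show ?thesis using I by (simp add: prod.distrib)
  qed
  have eq: "(\<lambda>x. f (x i) * g (x j)) = (\<lambda>x. \<Prod>k\<in>I. F k (x k))"
  proof
    fix x :: "'a \<Rightarrow> 'b"
    have "(\<Prod>k\<in>I. F k (x k)) = (\<Prod>k\<in>I. if k = i then f (x i) else if k = j then g (x j) else 1)"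
      by (intro prod.cong) (auto simp: F_def)
    then show "f (x i) * g (x j) = (\<Prod>k\<in>I. F k (x k))" by (simp add: prod2)
  qed
  show "integrable (PiM I M) (\<lambda>x. f (x i) * g (x j))"
    unfolding eq by (rule product_integrable_prod) (use I int in auto)
  have "(\<integral>x. f (x i) * g (x j) \<partial>PiM I M) = (\<Prod>k\<in>I. integral\<^sup>L (M k) (F k))"
    unfolding eq by (rule product_integral_prod) (use I int in auto)
  also have "\<dots> = (\<Prod>k\<in>I. if k = i then integral\<^sup>L (M i) f else if k = j then integral\<^sup>L (M j) g else 1)"
    by (intro prod.cong refl) (auto simp: F_def M.prob_space)
  finally show "(\<integral>x. f (x i) * g (x j) \<partial>PiM I M) = (\<integral>y. f y \<partial>M i) * (\<integral>y. g y \<partial>M j)"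
    by (simp add: prod2)
qed

text \<open>
  Distinct coordinates are uncorrelated, so only the diagonal of the expanded product survives. All
  variances below come from this identity: of the chi-square statistic, of bit counts and of the
  signal carried by random directions.
\<close>

lemma PiM_covariance_sum:
  fixes h k :: "'i \<Rightarrow> 'b \<Rightarrow> real"
  assumes M: "\<And>i. prob_space (M i)" and I: "finite I" "J \<subseteq> I"
    and int: "\<And>i. i \<in> J \<Longrightarrow> integrable (M i) (h i)" "\<And>i. i \<in> J \<Longrightarrow> integrable (M i) (k i)"
      "\<And>i. i \<in> J \<Longrightarrow> integrable (M i) (\<lambda>y. h i y * k i y)"
    and zero: "\<And>i. i \<in> J \<Longrightarrow> (\<integral>y. h i y \<partial>M i) = 0"
  shows "integrable (PiM I M) (\<lambda>x. (\<Sum>i\<in>J. h i (x i)) * (\<Sum>i\<in>J. k i (x i)))"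
    "(\<integral>x. (\<Sum>i\<in>J. h i (x i)) * (\<Sum>i\<in>J. k i (x i)) \<partial>PiM I M) = (\<Sum>i\<in>J. \<integral>y. h i y * k i y \<partial>M i)"
proof -
  have J: "finite J" "\<And>i. i \<in> J \<Longrightarrow> i \<in> I" using I finite_subset by auto
  have pair: "integrable (PiM I M) (\<lambda>x. h i (x i) * k j (x j)) \<and>
     (\<integral>x. h i (x i) * k j (x j) \<partial>PiM I M) = (if i = j then \<integral>y. h i y * k i y \<partial>M i else 0)"
    if "i \<in> J" "j \<in> J" for i j
  proof (cases "i = j")
    case True
    then show ?thesis
      using PiM_integral_component[where f="\<lambda>y. h i y * k i y" and M=M and I=I and i=i] M I(1) J(2)[OF that(1)] int(3)[OF that(1)] by auto
  next
    case False
    then show ?thesis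
      using PiM_integral_two_components[OF M I(1) J(2)[OF that(1)] J(2)[OF that(2)] False int(1)[OF that(1)] int(2)[OF that(2)]]
        zero that by auto
  qed
  have eq: "(\<Sum>i\<in>J. h i (x i)) * (\<Sum>i\<in>J. k i (x i)) = (\<Sum>i\<in>J. \<Sum>j\<in>J. h i (x i) * k j (x j))" for x
    by (rule sum_product)
  show "integrable (PiM I M) (\<lambda>x. (\<Sum>i\<in>J. h i (x i)) * (\<Sum>i\<in>J. k i (x i)))"
    unfolding eq using pair by (intro Bochner_Integration.integrable_sum) auto
  have "(\<integral>x. (\<Sum>i\<in>J. h i (x i)) * (\<Sum>i\<in>J. k i (x i)) \<partial>PiM I M)
     = (\<Sum>i\<in>J. \<Sum>j\<in>J. \<integral>x. h i (x i) * k j (x j) \<partial>PiM I M)"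
    unfolding eq using pair
    by (subst Bochner_Integration.integral_sum, (intro Bochner_Integration.integrable_sum; auto))+ 
       (auto intro!: sum.cong Bochner_Integration.integral_sum)
  also have "\<dots> = (\<Sum>i\<in>J. \<Sum>j\<in>J. if i = j then \<integral>y. h i y * k i y \<partial>M i else 0)"
    using pair by (intro sum.cong refl) auto
  also have "\<dots> = (\<Sum>i\<in>J. \<integral>y. h i y * k i y \<partial>M i)"
    using J by (intro sum.cong refl) simp
  finally show "(\<integral>x. (\<Sum>i\<in>J. h i (x i)) * (\<Sum>i\<in>J. k i (x i)) \<partial>PiM I M) = (\<Sum>i\<in>J. \<integral>y. h i y * k i y \<partial>M i)" .
qed

text \<open>
  Independence of two disjoint blocks of coordinates, by Fubini along the splitting of the product.
\<close>

lemma PiM_integral_mult_disjoint: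
  fixes F G :: "('i \<Rightarrow> 'b) \<Rightarrow> real"
  assumes M: "\<And>i. prob_space (M i)" and I: "finite I" "J \<subseteq> I"
    and dep: "\<And>x y. (\<And>i. i \<in> J \<Longrightarrow> x i = y i) \<Longrightarrow> F x = F y"
      "\<And>x y. (\<And>i. i \<in> I - J \<Longrightarrow> x i = y i) \<Longrightarrow> G x = G y"
    and int: "integrable (PiM I M) F" "integrable (PiM I M) G" "integrable (PiM I M) (\<lambda>x. F x * G x)"
  shows "(\<integral>x. F x * G x \<partial>PiM I M) = (\<integral>x. F x \<partial>PiM I M) * (\<integral>x. G x \<partial>PiM I M)"
proof -
  let ?K = "I - J"
  interpret product_prob_space M I by (rule product_prob_spaceI) (rule M)
  interpret J: prob_space "PiM J M" by (intro prob_space_PiM M)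
  interpret K: prob_space "PiM ?K M" by (intro prob_space_PiM M)
  have IJ: "I = J \<union> ?K" "J \<inter> ?K = {}" using I by auto
  have fin: "finite J" "finite ?K" using I finite_subset by auto
  have FJ: "F (merge J ?K (x, y)) = F x" for x y by (rule dep(1)) (simp add: merge_def)
  have GK: "G (merge J ?K (x, y)) = G y" for x y by (rule dep(2)) (simp add: merge_def)
  have fold: "(\<integral>x. f x \<partial>PiM I M) = (\<integral>x. (\<integral>y. f (merge J ?K (x, y)) \<partial>PiM ?K M) \<partial>PiM J M)"
    if "integrable (PiM I M) f" for f :: "('i \<Rightarrow> 'b) \<Rightarrow> real"
    using product_integral_fold[OF IJ(2) fin, of f] that unfolding IJ(1)[symmetric] by simp
  show ?thesis
    by (simp add: fold[OF int(1)] fold[OF int(2)] fold[OF int(3)] FJ GK J.prob_space K.prob_space)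
qed

text \<open>
  Chebyshev's inequality in the form in which error probabilities are bounded; a non-measurable
  event has measure \<open>0\<close>.
\<close>

lemma (in prob_space) second_moment_tail_bound:
  fixes X :: "'a \<Rightarrow> real"
  assumes int: "integrable M (\<lambda>x. (X x)\<^sup>2)" and V: "(\<integral>x. (X x)\<^sup>2 \<partial>M) \<le> V" and \<tau>: "0 < \<tau>"
    and A: "\<And>x. x \<in> A \<Longrightarrow> \<tau> \<le> \<bar>X x\<bar>"
  shows "measure M A \<le> V / \<tau>\<^sup>2"
proof (cases "A \<in> sets M")
  case True
  have "measure M A = (\<integral>x. indicator A x \<partial>M)" using True by simp
  also have "\<dots> \<le> (\<integral>x. (X x)\<^sup>2 / \<tau>\<^sup>2 \<partial>M)"
  proof (rule integral_mono)
    show "integrable M (indicator A :: 'a \<Rightarrow> real)" using True by (intro integrable_const_bound[where B=1]) auto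
    show "integrable M (\<lambda>x. (X x)\<^sup>2 / \<tau>\<^sup>2)" using int by simp
    fix x
    show "indicator A x \<le> (X x)\<^sup>2 / \<tau>\<^sup>2"
    proof (cases "x \<in> A")
      case True
      then have "\<tau>\<^sup>2 \<le> (X x)\<^sup>2" using A[of x] \<tau> by (metis abs_le_square_iff abs_of_pos)
      then show ?thesis using \<tau> True by simp
    qed simp
  qed
  also have "\<dots> \<le> V / \<tau>\<^sup>2" using V by (simp add: divide_right_mono)
  finally show ?thesis .
next
  case False
  have "0 \<le> (\<integral>x. (X x)\<^sup>2 \<partial>M)" by (rule integral_nonneg_AE) simp
  then have "0 \<le> V" using V by linarith
  then show ?thesis by (simp add: measure_notin_sets[OF False])
qed

text \<open>
  If two independent random vectors have the same mean \<open>a\<close> and the same covariance matrix \<open>C\<close>, their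
  inner product estimates the squared norm of \<open>a\<close>. Its fluctuation splits into two linear terms, whose
  variance \<open>a \<cdot> C a\<close> is at most the Frobenius norm of \<open>C\<close> times the squared norm of \<open>a\<close>, and a
  bilinear term, whose variance is exactly the squared Frobenius norm. Bounding everything by the
  Frobenius norm, rather than by the operator norm, costs nothing at the detection boundary and lets the
  bits of one machine be correlated.
\<close>

lemma (in prob_space) bilinear_second_moment:
  fixes \<alpha> \<beta> :: "'r \<Rightarrow> 'a \<Rightarrow> real"
  assumes R: "finite R"
    and int: "\<And>f :: 'a \<Rightarrow> real. integrable M f"
    and aa: "\<And>r s. r \<in> R \<Longrightarrow> s \<in> R \<Longrightarrow> (\<integral>x. \<alpha> r x * \<alpha> s x \<partial>M) = C r s"
    and bb: "\<And>r s. r \<in> R \<Longrightarrow> s \<in> R \<Longrightarrow> (\<integral>x. \<beta> r x * \<beta> s x \<partial>M) = C r s"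
    and ab: "\<And>r s. r \<in> R \<Longrightarrow> s \<in> R \<Longrightarrow> (\<integral>x. (\<alpha> r x * \<alpha> s x) * (\<beta> r x * \<beta> s x) \<partial>M) = C r s * C r s"
  shows "(\<integral>x. ((\<Sum>r\<in>R. (a r + \<alpha> r x) * (a r + \<beta> r x)) - (\<Sum>r\<in>R. (a r)\<^sup>2))\<^sup>2 \<partial>M)
    \<le> 6 * sqrt (\<Sum>r\<in>R. \<Sum>s\<in>R. (C r s)\<^sup>2) * (\<Sum>r\<in>R. (a r)\<^sup>2) + 3 * (\<Sum>r\<in>R. \<Sum>s\<in>R. (C r s)\<^sup>2)"
proof -
  define F where "F = (\<Sum>r\<in>R. \<Sum>s\<in>R. (C r s)\<^sup>2)"
  define X where "X x = (\<Sum>r\<in>R. a r * \<alpha> r x)" for x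
  define Y where "Y x = (\<Sum>r\<in>R. a r * \<beta> r x)" for x
  define Z where "Z x = (\<Sum>r\<in>R. \<alpha> r x * \<beta> r x)" for x
  have sq: "(\<integral>x. (\<Sum>r\<in>R. f r x)\<^sup>2 \<partial>M) = (\<Sum>r\<in>R. \<Sum>s\<in>R. \<integral>x. f r x * f s x \<partial>M)" for f :: "'r \<Rightarrow> 'a \<Rightarrow> real"
    unfolding power2_eq_square sum_product
    by (subst Bochner_Integration.integral_sum, rule int)
       (intro sum.cong refl Bochner_Integration.integral_sum int)
  \<comment> \<open>Cauchy--Schwarz over pairs of indices.\<close>
  have lin: "(\<Sum>r\<in>R. \<Sum>s\<in>R. a r * a s * C r s) \<le> sqrt F * (\<Sum>r\<in>R. (a r)\<^sup>2)"
  proof -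
    have "(\<Sum>r\<in>R. \<Sum>s\<in>R. a r * a s * C r s)\<^sup>2 = (\<Sum>p\<in>R\<times>R. (a (fst p) * a (snd p)) * C (fst p) (snd p))\<^sup>2"
      by (simp add: sum.cartesian_product case_prod_beta)
    also have "\<dots> \<le> (\<Sum>p\<in>R\<times>R. (a (fst p) * a (snd p))\<^sup>2) * (\<Sum>p\<in>R\<times>R. (C (fst p) (snd p))\<^sup>2)"
      by (rule Cauchy_Schwarz_ineq_sum)
    also have "(\<Sum>p\<in>R\<times>R. (a (fst p) * a (snd p))\<^sup>2) = (\<Sum>r\<in>R. (a r)\<^sup>2)\<^sup>2"
      unfolding power2_eq_square[of "sum _ _"] sum_product sum.cartesian_product
      by (simp add: case_prod_beta power_mult_distrib)
    also have "(\<Sum>p\<in>R\<times>R. (C (fst p) (snd p))\<^sup>2) = F"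
      by (simp add: F_def sum.cartesian_product case_prod_beta)
    finally have "\<bar>\<Sum>r\<in>R. \<Sum>s\<in>R. a r * a s * C r s\<bar> \<le> sqrt ((\<Sum>r\<in>R. (a r)\<^sup>2)\<^sup>2 * F)"
      by (rule real_le_rsqrt[of "\<bar>_\<bar>", simplified])
    also have "\<dots> = sqrt F * (\<Sum>r\<in>R. (a r)\<^sup>2)"
      by (simp add: real_sqrt_mult abs_of_nonneg sum_nonneg)
    finally show ?thesis by simp
  qed
  have EX: "(\<integral>x. (X x)\<^sup>2 \<partial>M) = (\<Sum>r\<in>R. \<Sum>s\<in>R. a r * a s * C r s)"
    unfolding X_def sq
  proof (intro sum.cong refl)
    fix r s assume "r \<in> R" "s \<in> R"
    have "(\<integral>x. a r * \<alpha> r x * (a s * \<alpha> s x) \<partial>M) = (\<integral>x. (a r * a s) * (\<alpha> r x * \<alpha> s x) \<partial>M)" by (simp add: ac_simps)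
    also have "\<dots> = a r * a s * C r s" using aa[OF \<open>r \<in> R\<close> \<open>s \<in> R\<close>] by simp
    finally show "(\<integral>x. a r * \<alpha> r x * (a s * \<alpha> s x) \<partial>M) = a r * a s * C r s" .
  qed
  have EY: "(\<integral>x. (Y x)\<^sup>2 \<partial>M) = (\<Sum>r\<in>R. \<Sum>s\<in>R. a r * a s * C r s)"
    unfolding Y_def sq
  proof (intro sum.cong refl)
    fix r s assume "r \<in> R" "s \<in> R"
    have "(\<integral>x. a r * \<beta> r x * (a s * \<beta> s x) \<partial>M) = (\<integral>x. (a r * a s) * (\<beta> r x * \<beta> s x) \<partial>M)" by (simp add: ac_simps)
    also have "\<dots> = a r * a s * C r s" using bb[OF \<open>r \<in> R\<close> \<open>s \<in> R\<close>] by simp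
    finally show "(\<integral>x. a r * \<beta> r x * (a s * \<beta> s x) \<partial>M) = a r * a s * C r s" .
  qed
  have EZ: "(\<integral>x. (Z x)\<^sup>2 \<partial>M) = F"
    unfolding Z_def sq F_def
  proof (intro sum.cong refl)
    fix r s assume "r \<in> R" "s \<in> R"
    have "(\<integral>x. \<alpha> r x * \<beta> r x * (\<alpha> s x * \<beta> s x) \<partial>M) = (\<integral>x. (\<alpha> r x * \<alpha> s x) * (\<beta> r x * \<beta> s x) \<partial>M)" by (simp add: ac_simps)
    then show "(\<integral>x. \<alpha> r x * \<beta> r x * (\<alpha> s x * \<beta> s x) \<partial>M) = (C r s)\<^sup>2"
      using ab[OF \<open>r \<in> R\<close> \<open>s \<in> R\<close>] by (simp add: power2_eq_square)
  qed
  have dec: "(\<Sum>r\<in>R. (a r + \<alpha> r x) * (a r + \<beta> r x)) - (\<Sum>r\<in>R. (a r)\<^sup>2) = X x + Y x + Z x" for x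
    unfolding X_def Y_def Z_def by (simp add: sum.distrib algebra_simps power2_eq_square flip: sum_subtractf)
  have "(\<integral>x. (X x + Y x + Z x)\<^sup>2 \<partial>M) \<le> (\<integral>x. 3 * (X x)\<^sup>2 + 3 * (Y x)\<^sup>2 + 3 * (Z x)\<^sup>2 \<partial>M)"
  proof (intro integral_mono int)
    fix x
    have "0 \<le> (X x - Y x)\<^sup>2 + (X x - Z x)\<^sup>2 + (Y x - Z x)\<^sup>2" by simp
    then show "(X x + Y x + Z x)\<^sup>2 \<le> 3 * (X x)\<^sup>2 + 3 * (Y x)\<^sup>2 + 3 * (Z x)\<^sup>2"
      by (simp add: power2_eq_square algebra_simps)
  qed
  also have "\<dots> = 3 * (\<integral>x. (X x)\<^sup>2 \<partial>M) + 3 * (\<integral>x. (Y x)\<^sup>2 \<partial>M) + 3 * (\<integral>x. (Z x)\<^sup>2 \<partial>M)"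
    using int by simp
  also have "\<dots> \<le> 6 * sqrt F * (\<Sum>r\<in>R. (a r)\<^sup>2) + 3 * F"
    using lin EX EY EZ by simp
  finally show ?thesis unfolding dec F_def .
qed

section \<open>Protocols sending independent random bits\<close>

definition bit_sign :: "nat \<Rightarrow> nat \<Rightarrow> real" where
  "bit_sign y r = (if bit y r then 1 else - 1)"

text \<open>
  Numbers below \<open>2 ^ b\<close> are bit strings of length \<open>b\<close>: the distributive law for \<open>b\<close> binary factors.
\<close>

lemma sum_prod_bits:
  fixes F :: "nat \<Rightarrow> bool \<Rightarrow> real"
  shows "(\<Sum>y<2 ^ b. \<Prod>r<b. F r (bit (y::nat) r)) = (\<Prod>r<b. F r False + F r True)"
proof (induction b)
  case 0
  then show ?case by simp
next
  case (Suc b)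
  have split: "{..<(2::nat) ^ Suc b} = {..<2 ^ b} \<union> (\<lambda>y. y + 2 ^ b) ` {..<2 ^ b}"
  proof (intro set_eqI iffI)
    fix x :: nat assume "x \<in> {..<2 ^ Suc b}"
    then show "x \<in> {..<2 ^ b} \<union> (\<lambda>y. y + 2 ^ b) ` {..<2 ^ b}"
      by (cases "x < 2 ^ b") (auto intro!: image_eqI[of _ _ "x - 2 ^ b"])
  qed auto
  have low: "bit (y + 2 ^ b) r \<longleftrightarrow> bit y r" if "y < 2 ^ b" "r < b" for y r :: nat
  proof -
    have "take_bit b (y + 2 ^ b) = take_bit b y" by (simp add: take_bit_eq_mod)
    then show ?thesis using that by (metis bit_take_bit_iff)
  qed
  have top0: "\<not> bit y b" if "y < 2 ^ b" for y :: nat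
    using that by (simp add: bit_iff_odd)
  have top1: "bit (y + 2 ^ b) b" if "y < 2 ^ b" for y :: nat
    using that by (simp add: bit_iff_odd)
  have "(\<Sum>y<2 ^ Suc b. \<Prod>r<Suc b. F r (bit (y::nat) r))
     = (\<Sum>y<2 ^ b. \<Prod>r<Suc b. F r (bit (y::nat) r)) + (\<Sum>y<2 ^ b. \<Prod>r<Suc b. F r (bit (y + 2 ^ b :: nat) r))"
    unfolding split by (subst sum.union_disjoint) (auto simp: sum.reindex inj_on_def)
  also have "(\<Sum>y<2 ^ b. \<Prod>r<Suc b. F r (bit (y::nat) r)) = (\<Sum>y<(2::nat) ^ b. (\<Prod>r<b. F r (bit y r)) * F b False)"
    by (intro sum.cong refl) (simp add: top0)
  also have "(\<Sum>y<2 ^ b. \<Prod>r<Suc b. F r (bit (y + 2 ^ b :: nat) r)) = (\<Sum>y<(2::nat) ^ b. (\<Prod>r<b. F r (bit y r)) * F b True)"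
    by (intro sum.cong refl) (simp add: top1 low)
  finally show ?case
    by (simp flip: sum_distrib_right add: Suc.IH distrib_left)
qed

text \<open>
  The law of \<open>b\<close> independent signs, the \<open>r\<close>-th with mean \<open>s r\<close>, written as the binary digits of a
  number below \<open>2 ^ b\<close>.
\<close>

definition bits_density :: "nat \<Rightarrow> (nat \<Rightarrow> real) \<Rightarrow> nat \<Rightarrow> real" where
  "bits_density b s y = (\<Prod>r<b. (1 + s r * bit_sign y r) / 2)"

lemma bits_density_nonneg:
  assumes "\<And>r. \<bar>s r\<bar> \<le> 1"
  shows "0 \<le> bits_density b s y"
  unfolding bits_density_def
proof (intro prod_nonneg ballI)
  fix r
  show "0 \<le> (1 + s r * bit_sign y r) / 2"
    using assms[of r] by (auto simp: bit_sign_def)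
qed

lemma sum_bits_density_prod:
  assumes "S \<subseteq> {..<b}"
  shows "(\<Sum>y<2 ^ b. bits_density b s y * (\<Prod>r\<in>S. bit_sign y r)) = (\<Prod>r\<in>S. s r)"
proof -
  have "(\<Sum>y<2 ^ b. bits_density b s y * (\<Prod>r\<in>S. bit_sign y r))
     = (\<Sum>y<(2::nat) ^ b. \<Prod>r<b. (\<lambda>r v. (1 + s r * (if v then 1 else -1)) / 2 * (if r \<in> S then (if v then 1 else -1) else 1)) r (bit y r))"
  proof (intro sum.cong refl)
    fix y :: nat
    have "(\<Prod>r\<in>S. bit_sign y r) = (\<Prod>r<b. if r \<in> S then bit_sign y r else 1)"
      using prod.inter_restrict[of "{..<b}" "bit_sign y" S] assms by (simp add: Int_absorb1)
    then show "bits_density b s y * (\<Prod>r\<in>S. bit_sign y r)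
       = (\<Prod>r<b. (\<lambda>r v. (1 + s r * (if v then 1 else -1)) / 2 * (if r \<in> S then (if v then 1 else -1) else 1)) r (bit y r))"
      unfolding bits_density_def prod.distrib[symmetric]
      by (auto simp: bit_sign_def prod.distrib[symmetric] intro!: prod.cong)
  qed
  also have "\<dots> = (\<Prod>r<b. if r \<in> S then s r else 1)"
    by (subst sum_prod_bits) (auto intro!: prod.cong simp: field_simps)
  also have "\<dots> = (\<Prod>r\<in>S. s r)"
    using assms by (simp add: prod.If_cases Int_absorb1)
  finally show ?thesis .
qed

lemma sum_bits_density: "(\<Sum>y<2 ^ b. bits_density b s y) = 1"
  using sum_bits_density_prod[of "{}" b s] by simp

definition bits_law :: "nat \<Rightarrow> (nat \<Rightarrow> real) \<Rightarrow> nat measure" where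
  "bits_law b s = point_measure {..<2 ^ b} (\<lambda>y. ennreal (bits_density b s y))"

lemma sets_bits_law[measurable_cong, simp]: "sets (bits_law b s) = sets (count_space {..<2 ^ b})"
  by (simp add: bits_law_def sets_point_measure)

lemma space_bits_law[simp]: "space (bits_law b s) = {..<2 ^ b}"
  by (simp add: bits_law_def space_point_measure)

lemma prob_space_bits_law:
  assumes "\<And>r. \<bar>s r\<bar> \<le> 1"
  shows "prob_space (bits_law b s)"
  unfolding bits_law_def
  using bits_density_nonneg[of s b] assms sum_bits_density[of b s]
  by (intro prob_space_point_measure) (auto simp: sum_ennreal)

lemma measurable_bits_law:
  assumes s: "\<And>r. (\<lambda>x. s x r) \<in> borel_measurable M" and bd: "\<And>x r. \<bar>s x r\<bar> \<le> 1"
  shows "(\<lambda>x. bits_law b (s x)) \<in> M \<rightarrow>\<^sub>M prob_algebra (count_space {..<2 ^ b})"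
proof (rule measurable_prob_algebraI)
  show "prob_space (bits_law b (s x))" for x by (rule prob_space_bits_law) (rule bd)
  show "(\<lambda>x. bits_law b (s x)) \<in> M \<rightarrow>\<^sub>M subprob_algebra (count_space {..<2 ^ b})"
  proof (rule measurable_subprob_algebra)
    fix x show "subprob_space (bits_law b (s x))"
      by (intro prob_space_imp_subprob_space prob_space_bits_law bd)
  next
    fix A :: "nat set" assume "A \<in> sets (count_space {..<2 ^ b})"
    then have "(\<lambda>x. emeasure (bits_law b (s x)) A) = (\<lambda>x. \<Sum>y\<in>A. ennreal (bits_density b (s x) y))"
      by (intro ext) (auto simp: bits_law_def intro!: emeasure_point_measure_finite)
    then show "(\<lambda>x. emeasure (bits_law b (s x)) A) \<in> borel_measurable M"
      using s by (simp add: bits_density_def)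
  qed simp
qed

lemma emeasure_PiM_singleton:
  assumes fin: "finite I"
    and K: "\<And>i. i \<in> I \<Longrightarrow> prob_space (K i)" "\<And>i. i \<in> I \<Longrightarrow> {y i} \<in> sets (K i)"
    and y: "y \<in> extensional I"
  shows "emeasure (PiM I K) {y} = (\<Prod>i\<in>I. emeasure (K i) {y i})"
proof -
  define K' where "K' i = (if i \<in> I then K i else return (count_space UNIV) undefined)" for i
  interpret product_prob_space K' I
    by (rule product_prob_spaceI) (auto simp: K'_def K intro: prob_space_return)
  have "PiM I K = PiM I K'" by (rule PiM_cong) (auto simp: K'_def)
  moreover have "{y} = (\<Pi>\<^sub>E i\<in>I. {y i})"
    using PiE_singleton[OF y] by simp
  ultimately show ?thesis
    using emeasure_PiM[where A="\<lambda>i. {y i}"] fin K(2) by (simp add: K'_def)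
qed

lemma sets_PiM_count_space:
  assumes "finite I" "finite A" "\<And>i. i \<in> I \<Longrightarrow> sets (K i) = sets (count_space A)"
  shows "sets (PiM I K) = Pow (\<Pi>\<^sub>E i\<in>I. A)"
proof -
  have "sets (PiM I K) = sets (PiM I (\<lambda>i. count_space A))"
    by (rule sets_PiM_cong) (auto simp: assms)
  also have "PiM I (\<lambda>i. count_space A) = count_space (PiE I (\<lambda>i. A))"
    using assms by (intro count_space_PiM_finite) (auto intro: countable_finite)
  finally show ?thesis by simp
qed

lemma emeasure_PiM_finite:
  assumes fin: "finite I" "finite A"
    and K: "\<And>i. i \<in> I \<Longrightarrow> prob_space (K i)" "\<And>i. i \<in> I \<Longrightarrow> sets (K i) = sets (count_space A)"
    and B: "B \<subseteq> (\<Pi>\<^sub>E i\<in>I. A)"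
  shows "emeasure (PiM I K) B = (\<Sum>y\<in>B. \<Prod>i\<in>I. emeasure (K i) {y i})"
proof -
  have "finite B" using B fin by (meson finite_PiE finite_subset)
  then have "emeasure (PiM I K) B = (\<Sum>y\<in>B. emeasure (PiM I K) {y})"
    using B by (intro emeasure_eq_sum_singleton) (auto simp: sets_PiM_count_space[OF fin K(2)])
  also have "\<dots> = (\<Sum>y\<in>B. \<Prod>i\<in>I. emeasure (K i) {y i})"
    using B fin by (intro sum.cong refl emeasure_PiM_singleton K) (auto simp: K PiE_iff)
  finally show ?thesis .
qed

text \<open>
  Finite products of Markov kernels into a finite set are Markov kernels: the product of the finite
  sets is finite, and the mass of each point is a finite product of measurable functions.
\<close>

lemma measurable_PiM_kernel:
  assumes fin: "finite I" "finite A"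
    and K: "\<And>i. i \<in> I \<Longrightarrow> K i \<in> M \<rightarrow>\<^sub>M prob_algebra (count_space A)"
  shows "(\<lambda>x. PiM I (\<lambda>i. K i x)) \<in> M \<rightarrow>\<^sub>M prob_algebra (PiM I (\<lambda>_. count_space A))"
proof (rule measurable_prob_algebra_generated[where G="Pow (\<Pi>\<^sub>E i\<in>I. A)" and \<Omega>="\<Pi>\<^sub>E i\<in>I. A"])
  have s: "sets (PiM I (\<lambda>_. count_space A)) = Pow (\<Pi>\<^sub>E i\<in>I. A)"
    by (rule sets_PiM_count_space) (use fin in auto)
  show "sets (PiM I (\<lambda>_. count_space A)) = sigma_sets (\<Pi>\<^sub>E i\<in>I. A) (Pow (\<Pi>\<^sub>E i\<in>I. A))"
    unfolding s using sets.sigma_sets_eq[of "count_space (\<Pi>\<^sub>E i\<in>I. A)"] by simp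
  show "Int_stable (Pow (\<Pi>\<^sub>E i\<in>I. A))" by (auto simp: Int_stable_def)
  fix x assume x: "x \<in> space M"
  have Kx: "prob_space (K i x)" "sets (K i x) = sets (count_space A)" if "i \<in> I" for i
    using measurable_space[OF K x] that by (auto simp: space_prob_algebra)
  show "prob_space (PiM I (\<lambda>i. K i x))"
    by (rule prob_space_PiM) (rule Kx)
  show "sets (PiM I (\<lambda>i. K i x)) = sets (PiM I (\<lambda>_. count_space A))"
    unfolding s by (rule sets_PiM_count_space[OF fin]) (rule Kx)
next
  fix B assume B: "B \<in> Pow (\<Pi>\<^sub>E i\<in>I. A)"
  have "(\<lambda>x. \<Sum>y\<in>B. \<Prod>i\<in>I. emeasure (K i x) {y i}) \<in> borel_measurable M"
  proof (intro borel_measurable_sum borel_measurable_prod_ennreal)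
    fix y i assume "y \<in> B" and i: "i \<in> I"
    then have "{y i} \<in> sets (count_space A)" using B by (auto simp: PiE_iff)
    then show "(\<lambda>x. emeasure (K i x) {y i}) \<in> borel_measurable M"
      using measurable_prob_algebraD[OF K[OF i]] by (rule measurable_emeasure_kernel[rotated])
  qed
  moreover have "emeasure (PiM I (\<lambda>i. K i x)) B = (\<Sum>y\<in>B. \<Prod>i\<in>I. emeasure (K i x) {y i})"
    if x: "x \<in> space M" for x
  proof (rule emeasure_PiM_finite[OF fin])
    show "prob_space (K i x)" "sets (K i x) = sets (count_space A)" if "i \<in> I" for i
      using measurable_space[OF K x] that by (auto simp: space_prob_algebra)
  qed (use B in auto)
  ultimately show "(\<lambda>x. emeasure (PiM I (\<lambda>i. K i x)) B) \<in> borel_measurable M"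
    by (simp cong: measurable_cong)
qed auto

text \<open>
  The probability of a decision, with everything but the transcripts integrated out. The map \<open>h\<close>
  lets the same computation serve the joint laws with and without a public coin.
\<close>

lemma measure_bind_transcripts:
  assumes M: "prob_space M" and fin: "finite I" "finite A"
    and K: "\<And>i. i \<in> I \<Longrightarrow> K i \<in> M \<rightarrow>\<^sub>M prob_algebra (count_space A)"
    and h: "(\<lambda>(x, y). h x y) \<in> M \<Otimes>\<^sub>M PiM I (\<lambda>_. count_space A) \<rightarrow>\<^sub>M N"
    and D: "D \<in> N \<rightarrow>\<^sub>M count_space UNIV" "\<And>x y. D (h x y) = dec y"
  defines "L \<equiv> M \<bind> (\<lambda>x. PiM I (\<lambda>i. K i x) \<bind> (\<lambda>y. return N (h x y)))"
  shows "measure L {\<omega> \<in> space L. D \<omega> = c}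
       = (\<integral>x. (\<Sum>y | y \<in> (\<Pi>\<^sub>E i\<in>I. A) \<and> dec y = c. \<Prod>i\<in>I. measure (K i x) {y i}) \<partial>M)"
proof -
  note h[measurable]
  let ?B = "{y. y \<in> (\<Pi>\<^sub>E i\<in>I. A) \<and> dec y = c}"
  let ?E = "D -` {c} \<inter> space N"
  have E: "?E \<in> sets N" using D(1) by (rule measurable_sets) simp
  have Kx: "prob_space (K i x)" "sets (K i x) = sets (count_space A)"
    if "i \<in> I" "x \<in> space M" for i x
    using measurable_space[OF K] that by (auto simp: space_prob_algebra)
  have r: "(\<lambda>(x, y). return N (h x y)) \<in> M \<Otimes>\<^sub>M PiM I (\<lambda>_. count_space A) \<rightarrow>\<^sub>M prob_algebra N"
    using measurable_compose[OF h measurable_return_prob_space] by (simp add: case_prod_beta)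
  have k: "(\<lambda>x. PiM I (\<lambda>i. K i x) \<bind> (\<lambda>y. return N (h x y))) \<in> M \<rightarrow>\<^sub>M prob_algebra N"
    by (rule measurable_bind_prob_space2[OF measurable_PiM_kernel[OF fin K] r])
  have M': "M \<in> space (prob_algebra M)" by (simp add: space_prob_algebra M)
  have "space L = space N" unfolding L_def by (rule sets_eq_imp_space_eq[OF sets_bind'[OF M' k]])
  then have EL: "{\<omega> \<in> space L. D \<omega> = c} = ?E" by auto
  have "emeasure L ?E = (\<integral>\<^sup>+x. emeasure (PiM I (\<lambda>i. K i x) \<bind> (\<lambda>y. return N (h x y))) ?E \<partial>M)"
    unfolding L_def by (rule emeasure_bind_prob_algebra[OF M' k E])
  also have "\<dots> = (\<integral>\<^sup>+x. ennreal (\<Sum>y\<in>?B. \<Prod>i\<in>I. measure (K i x) {y i}) \<partial>M)"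
  proof (rule nn_integral_cong)
    fix x assume x: "x \<in> space M"
    let ?P = "PiM I (\<lambda>i. K i x)"
    have sets: "sets ?P = Pow (\<Pi>\<^sub>E i\<in>I. A)"
      by (rule sets_PiM_count_space[OF fin]) (use Kx x in auto)
    have sets': "sets ?P = sets (PiM I (\<lambda>_. count_space A))"
      unfolding sets by (subst sets_PiM_count_space[OF fin]) auto
    have "space ?P = space (PiM I (\<lambda>_. count_space A))" by (rule sets_eq_imp_space_eq[OF sets'])
    also have "\<dots> = (\<Pi>\<^sub>E i\<in>I. A)" by (simp add: space_PiM)
    finally have space: "space ?P = (\<Pi>\<^sub>E i\<in>I. A)" .
    have hx: "h x \<in> ?P \<rightarrow>\<^sub>M N"
      unfolding measurable_cong_sets[OF sets' refl] using x by measurable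
    have rx: "(\<lambda>y. return N (h x y)) \<in> ?P \<rightarrow>\<^sub>M prob_algebra N"
      by (rule measurable_compose[OF hx measurable_return_prob_space])
    have "emeasure (?P \<bind> (\<lambda>y. return N (h x y))) ?E = (\<integral>\<^sup>+y. emeasure (return N (h x y)) ?E \<partial>?P)"
      by (rule emeasure_bind_prob_algebra[OF _ rx E])
         (auto simp: space_prob_algebra intro!: prob_space_PiM Kx x)
    also have "\<dots> = (\<integral>\<^sup>+y. indicator ?B y \<partial>?P)"
    proof (rule nn_integral_cong)
      fix y assume y: "y \<in> space ?P"
      then have "h x y \<in> ?E \<longleftrightarrow> y \<in> ?B" using measurable_space[OF hx y] by (simp add: D(2) space)
      then show "emeasure (return N (h x y)) ?E = indicator ?B y" by (simp add: E indicator_def)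
    qed
    also have "\<dots> = emeasure ?P ?B" by (intro nn_integral_indicator) (auto simp: sets)
    also have "\<dots> = (\<Sum>y\<in>?B. \<Prod>i\<in>I. emeasure (K i x) {y i})"
      by (rule emeasure_PiM_finite[OF fin]) (use Kx x in auto)
    also have "\<dots> = (\<Sum>y\<in>?B. \<Prod>i\<in>I. ennreal (measure (K i x) {y i}))"
      by (intro sum.cong prod.cong refl finite_measure.emeasure_eq_measure prob_space.finite_measure Kx x)
    also have "\<dots> = ennreal (\<Sum>y\<in>?B. \<Prod>i\<in>I. measure (K i x) {y i})"
      by (simp add: prod_ennreal prod_nonneg sum_ennreal)
    finally show "emeasure (?P \<bind> (\<lambda>y. return N (h x y))) ?E = ennreal (\<Sum>y\<in>?B. \<Prod>i\<in>I. measure (K i x) {y i})" .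
  qed
  finally have eq: "emeasure L ?E = (\<integral>\<^sup>+x. ennreal (\<Sum>y\<in>?B. \<Prod>i\<in>I. measure (K i x) {y i}) \<partial>M)" .
  have meas: "(\<lambda>x. \<Sum>y\<in>?B. \<Prod>i\<in>I. measure (K i x) {y i}) \<in> borel_measurable M"
  proof (intro borel_measurable_sum borel_measurable_prod)
    fix y i assume "y \<in> ?B" and i: "i \<in> I"
    then have "{y i} \<in> sets (count_space A)" by (auto simp: PiE_iff)
    then show "(\<lambda>x. measure (K i x) {y i}) \<in> borel_measurable M"
      by (rule measurable_compose[OF measurable_prob_algebraD[OF K[OF i]] measurable_measure_subprob_algebra])
  qed
  show ?thesis
    unfolding EL measure_def[of L] eq
    by (rule integral_eq_nn_integral[symmetric]) (use meas in \<open>auto intro!: sum_nonneg prod_nonneg\<close>)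
qed

text \<open>
  The unconditional law of one transcript: the sign means \<open>s z\<close> are averaged over the law of \<open>z\<close>.
\<close>

definition mixed_bits_law :: "'z measure \<Rightarrow> nat \<Rightarrow> ('z \<Rightarrow> nat \<Rightarrow> real) \<Rightarrow> nat measure" where
  "mixed_bits_law P b s = point_measure {..<2 ^ b} (\<lambda>y. ennreal (\<integral>z. bits_density b (s z) y \<partial>P))"

lemma sets_mixed_bits_law[measurable_cong, simp]:
  "sets (mixed_bits_law P b s) = sets (count_space {..<2 ^ b})"
  by (simp add: mixed_bits_law_def sets_point_measure)

lemma space_mixed_bits_law[simp]: "space (mixed_bits_law P b s) = {..<2 ^ b}"
  by (simp add: mixed_bits_law_def space_point_measure)

lemma abs_bits_density_le:
  assumes "\<And>r. \<bar>s r\<bar> \<le> 1"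
  shows "\<bar>bits_density b s y\<bar> \<le> 1"
  unfolding bits_density_def abs_prod
proof (intro prod_le_1 conjI)
  fix r
  show "\<bar>(1 + s r * bit_sign y r) / 2\<bar> \<le> 1"
    using assms[of r] by (auto simp: bit_sign_def)
qed simp

lemma integrable_bits_density:
  assumes "prob_space P" "\<And>r. (\<lambda>z. s z r) \<in> borel_measurable P" "\<And>z r. \<bar>s z r\<bar> \<le> 1"
  shows "integrable P (\<lambda>z. bits_density b (s z) y)"
proof -
  interpret prob_space P by fact
  have "(\<lambda>z. bits_density b (s z) y) \<in> borel_measurable P"
    unfolding bits_density_def using assms(2) by measurable
  then show ?thesis
    using abs_bits_density_le[OF assms(3)] by (intro integrable_const_bound[where B=1]) auto
qed

lemma integral_mixed_bits_law:
  assumes P: "prob_space P" and s: "\<And>r. (\<lambda>z. s z r) \<in> borel_measurable P" "\<And>z r. \<bar>s z r\<bar> \<le> 1"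
  shows "(\<integral>y. f y \<partial>mixed_bits_law P b s) = (\<integral>z. (\<Sum>y<2 ^ b. bits_density b (s z) y * f y) \<partial>P)"
proof -
  have nn: "0 \<le> (\<integral>z. bits_density b (s z) y \<partial>P)" for y
    by (intro integral_nonneg_AE AE_I2 bits_density_nonneg s)
  have "(\<integral>y. f y \<partial>mixed_bits_law P b s) = (\<Sum>y<2 ^ b. (\<integral>z. bits_density b (s z) y \<partial>P) * f y)"
    unfolding mixed_bits_law_def point_measure_def
    by (subst integral_density) (auto simp: nn lebesgue_integral_count_space_finite)
  also have "\<dots> = (\<integral>z. (\<Sum>y<2 ^ b. bits_density b (s z) y * f y) \<partial>P)"
    using integrable_bits_density[OF P s]
    by (subst Bochner_Integration.integral_sum) (auto simp: integral_mult_left_zero)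
  finally show ?thesis .
qed

lemma prob_space_mixed_bits_law:
  assumes P: "prob_space P" and s: "\<And>r. (\<lambda>z. s z r) \<in> borel_measurable P" "\<And>z r. \<bar>s z r\<bar> \<le> 1"
  shows "prob_space (mixed_bits_law P b s)"
proof -
  interpret prob_space P by fact
  have nn: "0 \<le> (\<integral>z. bits_density b (s z) y \<partial>P)" for y
    by (intro integral_nonneg_AE AE_I2 bits_density_nonneg s)
  have "(\<Sum>y<2 ^ b. \<integral>z. bits_density b (s z) y \<partial>P) = (\<integral>z. (\<Sum>y<2 ^ b. bits_density b (s z) y) \<partial>P)"
    using integrable_bits_density[OF P s] by (subst Bochner_Integration.integral_sum) auto
  then show ?thesis
    unfolding mixed_bits_law_def using nn
    by (intro prob_space_point_measure) (auto simp: sum_ennreal sum_bits_density prob_space)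
qed

lemma measure_mixed_bits_law:
  assumes P: "prob_space P" and s: "\<And>r. (\<lambda>z. s z r) \<in> borel_measurable P" "\<And>z r. \<bar>s z r\<bar> \<le> 1"
    and y: "y < 2 ^ b"
  shows "measure (mixed_bits_law P b s) {y} = (\<integral>z. bits_density b (s z) y \<partial>P)"
proof -
  have nn: "0 \<le> (\<integral>z. bits_density b (s z) y \<partial>P)" for y
    by (intro integral_nonneg_AE AE_I2 bits_density_nonneg s)
  show ?thesis
    unfolding mixed_bits_law_def measure_def using y nn
    by (subst emeasure_point_measure_finite) auto
qed

lemma measure_bits_law:
  assumes s: "\<And>r. \<bar>s r\<bar> \<le> 1" and y: "y < 2 ^ b"
  shows "measure (bits_law b s) {y} = bits_density b s y"
  unfolding bits_law_def measure_def using y bits_density_nonneg[OF s]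
  by (subst emeasure_point_measure_finite) auto

text \<open>
  All protocols used below have this form: each machine sends \<open>b\<close> signs which are independent given
  its data (and the coin) and whose conditional means are given functions of the data.
\<close>

definition private_bits :: "nat \<Rightarrow> (nat \<Rightarrow> (nat \<Rightarrow> real) \<Rightarrow> nat \<Rightarrow> real) \<Rightarrow> ((nat \<Rightarrow> nat) \<Rightarrow> bool) \<Rightarrow> private_test" where
  "private_bits b s rej = \<lparr>transcripts = (\<lambda>_. {..<2 ^ b}), decision = (\<lambda>y. if rej y then 1 else 0),
     private_kernel = (\<lambda>j x. bits_law b (s j x))\<rparr>"

definition public_bits ::
  "nat \<Rightarrow> (nat \<Rightarrow> (nat \<Rightarrow> real) \<times> (nat \<Rightarrow> real) \<Rightarrow> nat \<Rightarrow> real) \<Rightarrow> (nat \<Rightarrow> real) measure \<Rightarrow> ((nat \<Rightarrow> nat) \<Rightarrow> bool) \<Rightarrow> public_test" where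
  "public_bits b s U rej = \<lparr>transcripts = (\<lambda>_. {..<2 ^ b}), decision = (\<lambda>y. if rej y then 1 else 0),
     coin = U, public_kernel = (\<lambda>j x. bits_law b (s j x))\<rparr>"

lemma private_bits_in_private_protocols:
  assumes "b' \<le> b" "\<And>j r. (\<lambda>x. s j x r) \<in> borel_measurable (Rn d)" "\<And>j x r. \<bar>s j x r\<bar> \<le> 1"
  shows "private_bits b' s rej \<in> private_protocols m d b"
  using assms by (auto simp: private_bits_def private_protocols_def budget_protocol_def intro!: measurable_bits_law)

lemma public_bits_in_public_protocols:
  assumes "b' \<le> b" "prob_space U" "\<And>j r. (\<lambda>x. s j x r) \<in> borel_measurable (Rn d \<Otimes>\<^sub>M U)" "\<And>j x r. \<bar>s j x r\<bar> \<le> 1"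
  shows "public_bits b' s U rej \<in> public_protocols m d b"
  using assms by (auto simp: public_bits_def public_protocols_def budget_protocol_def intro!: measurable_bits_law)

definition shift_noise :: "nat \<Rightarrow> real \<Rightarrow> (nat \<Rightarrow> real) \<Rightarrow> (nat \<Rightarrow> real) \<Rightarrow> nat \<Rightarrow> real" where
  "shift_noise d \<sigma> f z = (\<lambda>i\<in>{..<d}. f i + \<sigma> * z i)"

lemma prob_space_std_normal_vector: "prob_space (std_normal_vector d)"
  unfolding std_normal_vector_def
  by (intro prob_space_PiM prob_space_normal_density) simp

lemma shift_noise_measurable[measurable]: "shift_noise d \<sigma> f \<in> std_normal_vector d \<rightarrow>\<^sub>M Rn d"
  unfolding shift_noise_def std_normal_vector_def Rn_def by measurable

lemma observation_law_eq:
  "observation_law n m d f = distr (\<Pi>\<^sub>M j\<in>{..<m}. std_normal_vector d) (\<Pi>\<^sub>M j\<in>{..<m}. Rn d)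
     (\<lambda>z. \<lambda>j\<in>{..<m}. shift_noise d (sqrt (real m / real n)) f (z j))"
  by (simp add: observation_law_def shift_noise_def)

lemma measurable_compose_component:
  assumes "i \<in> I" "g \<in> M \<rightarrow>\<^sub>M L"
  shows "(\<lambda>x. g (x i)) \<in> PiM I (\<lambda>_. M) \<rightarrow>\<^sub>M L"
  by (rule measurable_compose[OF _ assms(2)]) (use assms(1) in measurable)

lemma observation_map_measurable:
  "(\<lambda>z. \<lambda>j\<in>{..<m}. shift_noise d \<sigma> f (z j)) \<in> (\<Pi>\<^sub>M j\<in>{..<m}. std_normal_vector d) \<rightarrow>\<^sub>M (\<Pi>\<^sub>M j\<in>{..<m}. Rn d)"
  by measurable

lemma prob_space_observation_law: "prob_space (observation_law n m d f)"
  unfolding observation_law_eq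
  by (intro prob_space.prob_space_distr prob_space_PiM prob_space_std_normal_vector observation_map_measurable)

lemma sets_observation_law[measurable_cong, simp]: "sets (observation_law n m d f) = sets (\<Pi>\<^sub>M j\<in>{..<m}. Rn d)"
  by (simp add: observation_law_def)

lemma integral_observation_prod:
  fixes g :: "nat \<Rightarrow> (nat \<Rightarrow> real) \<Rightarrow> real"
  assumes "\<And>j. j < m \<Longrightarrow> g j \<in> borel_measurable (Rn d)" "\<And>j x. j < m \<Longrightarrow> \<bar>g j x\<bar> \<le> 1"
  shows "(\<integral>x. (\<Prod>j<m. g j (x j)) \<partial>observation_law n m d f)
     = (\<Prod>j<m. \<integral>z. g j (shift_noise d (sqrt (real m / real n)) f z) \<partial>std_normal_vector d)"
proof -
  interpret N: prob_space "std_normal_vector d" by (rule prob_space_std_normal_vector)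
  interpret product_prob_space "\<lambda>_. std_normal_vector d" "{..<m}"
    by (rule product_prob_spaceI) (rule prob_space_std_normal_vector)
  let ?s = "shift_noise d (sqrt (real m / real n)) f"
  have int: "integrable (std_normal_vector d) (\<lambda>z. g j (?s z))" if "j < m" for j
    using assms[OF that] that
    by (intro N.integrable_const_bound[where B=1] measurable_compose[OF shift_noise_measurable]) auto
  have "(\<integral>x. (\<Prod>j<m. g j (x j)) \<partial>observation_law n m d f)
      = (\<integral>z. (\<Prod>j<m. g j (?s (z j))) \<partial>(\<Pi>\<^sub>M j\<in>{..<m}. std_normal_vector d))"
    unfolding observation_law_eq using assms(1)
    by (subst integral_distr[OF observation_map_measurable])
       (auto intro!: borel_measurable_prod measurable_compose_component)
  also have "\<dots> = (\<Prod>j<m. \<integral>z. g j (?s z) \<partial>std_normal_vector d)"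
    by (rule product_integral_prod) (use int in auto)
  finally show ?thesis .
qed

definition transcript_law :: "nat \<Rightarrow> nat \<Rightarrow> nat \<Rightarrow> nat \<Rightarrow> (nat \<Rightarrow> (nat \<Rightarrow> real) \<Rightarrow> nat \<Rightarrow> real) \<Rightarrow> (nat \<Rightarrow> real) \<Rightarrow> (nat \<Rightarrow> nat) measure" where
  "transcript_law n m d b s f = (\<Pi>\<^sub>M j\<in>{..<m}. mixed_bits_law (std_normal_vector d) b
      (\<lambda>z. s j (shift_noise d (sqrt (real m / real n)) f z)))"

lemma prob_mixed_shift:
  assumes "\<And>r. (\<lambda>x. s x r) \<in> borel_measurable (Rn d)" "\<And>x r. \<bar>s x r\<bar> \<le> 1"
  shows "prob_space (mixed_bits_law (std_normal_vector d) b (\<lambda>z. s (shift_noise d \<sigma> f z)))"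
  by (rule prob_space_mixed_bits_law[OF prob_space_std_normal_vector])
     (use assms measurable_compose[OF shift_noise_measurable] in auto)

text \<open>
  The observations of different machines are independent, so averaging the conditional product law
  of the transcripts over the data gives a product law again.
\<close>

lemma sum_bits_density_observation:
  assumes s: "\<And>j r. (\<lambda>x. s j x r) \<in> borel_measurable (Rn d)" "\<And>j x r. \<bar>s j x r\<bar> \<le> 1"
    and B: "B \<subseteq> (\<Pi>\<^sub>E j\<in>{..<m}. {..<2 ^ b})"
  shows "(\<integral>x. (\<Sum>y\<in>B. \<Prod>j<m. bits_density b (s j (x j)) (y j)) \<partial>observation_law n m d f)
       = measure (transcript_law n m d b s f) B"
proof -
  let ?s = "shift_noise d (sqrt (real m / real n)) f"
  let ?Q = "\<lambda>j. mixed_bits_law (std_normal_vector d) b (\<lambda>z. s j (?s z))"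
  interpret O: prob_space "observation_law n m d f" by (rule prob_space_observation_law)
  note P = prob_space_std_normal_vector
  have sm: "(\<lambda>z. s j (?s z) r) \<in> borel_measurable (std_normal_vector d)" for j r
    by (rule measurable_compose[OF shift_noise_measurable s(1)])
  have bm: "(\<lambda>x. bits_density b (s j x) y) \<in> borel_measurable (Rn d)" for j y
    unfolding bits_density_def using s(1) by measurable
  have "(\<integral>x. (\<Sum>y\<in>B. \<Prod>j<m. bits_density b (s j (x j)) (y j)) \<partial>observation_law n m d f)
      = (\<Sum>y\<in>B. \<integral>x. (\<Prod>j<m. bits_density b (s j (x j)) (y j)) \<partial>observation_law n m d f)"
  proof (rule Bochner_Integration.integral_sum)
    fix y
    show "integrable (observation_law n m d f) (\<lambda>x. \<Prod>j<m. bits_density b (s j (x j)) (y j))"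
    proof (rule O.integrable_const_bound[where B=1])
      show "AE x in observation_law n m d f. norm (\<Prod>j<m. bits_density b (s j (x j)) (y j)) \<le> 1"
        by (auto simp: abs_prod intro!: prod_le_1 abs_bits_density_le s(2))
      show "(\<lambda>x. \<Prod>j<m. bits_density b (s j (x j)) (y j)) \<in> borel_measurable (observation_law n m d f)"
        unfolding measurable_cong_sets[OF sets_observation_law refl]
        by (intro borel_measurable_prod measurable_compose_component bm) auto
    qed
  qed
  also have "\<dots> = (\<Sum>y\<in>B. \<Prod>j<m. \<integral>z. bits_density b (s j (?s z)) (y j) \<partial>std_normal_vector d)"
    by (intro sum.cong refl integral_observation_prod bm abs_bits_density_le s(2))
  also have "\<dots> = (\<Sum>y\<in>B. \<Prod>j<m. measure (?Q j) {y j})"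
    using B by (intro sum.cong prod.cong refl measure_mixed_bits_law[symmetric] P sm s(2)) (auto simp: PiE_iff)
  also have "\<dots> = measure (transcript_law n m d b s f) B"
  proof -
    have "emeasure (transcript_law n m d b s f) B = (\<Sum>y\<in>B. \<Prod>j<m. emeasure (?Q j) {y j})"
      unfolding transcript_law_def
      by (rule emeasure_PiM_finite[OF _ _ _ _ B]) (auto intro!: prob_mixed_shift s)
    also have "\<dots> = ennreal (\<Sum>y\<in>B. \<Prod>j<m. measure (?Q j) {y j})"
      by (simp add: prod_ennreal prod_nonneg sum_ennreal
        finite_measure.emeasure_eq_measure[OF prob_space.finite_measure[OF prob_mixed_shift[OF s]]])
    finally have "emeasure (transcript_law n m d b s f) B = ennreal (\<Sum>y\<in>B. \<Prod>j<m. measure (?Q j) {y j})" .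
    then show ?thesis
      unfolding measure_def[of "transcript_law n m d b s f"]
      by (simp only:) (intro enn2real_ennreal[symmetric] sum_nonneg prod_nonneg ballI measure_nonneg)
  qed
  finally show ?thesis .
qed

lemma decision_measurable:
  fixes f :: "(nat \<Rightarrow> nat) \<Rightarrow> 'c" and m b :: nat
  shows
  "f \<in> (\<Pi>\<^sub>M j\<in>{..<m}. count_space {..<(2::nat) ^ b}) \<rightarrow>\<^sub>M count_space UNIV"
proof -
  have "sets (\<Pi>\<^sub>M j\<in>{..<m}. count_space {..<(2::nat) ^ b}) = Pow (\<Pi>\<^sub>E j\<in>{..<m}. {..<2 ^ b})"
    by (rule sets_PiM_count_space) auto
  then show ?thesis by (simp add: measurable_def space_PiM)
qed

lemma measure_private_bits:
  assumes s: "\<And>j r. (\<lambda>x. s j x r) \<in> borel_measurable (Rn d)" "\<And>j x r. \<bar>s j x r\<bar> \<le> 1"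
  shows "measure (private_law n m d (private_bits b s rej) f)
      {\<omega> \<in> space (private_law n m d (private_bits b s rej) f). (\<lambda>(x, y). decision (private_bits b s rej) y) \<omega> = c}
    = measure (transcript_law n m d b s f) {y \<in> \<Pi>\<^sub>E j\<in>{..<m}. {..<2 ^ b}. (if rej y then 1 else 0) = c}"
proof -
  let ?O = "observation_law n m d f" and ?A = "{..<(2::nat) ^ b}"
  let ?Y = "\<Pi>\<^sub>M j\<in>{..<m}. count_space ?A"
  let ?N = "(\<Pi>\<^sub>M j\<in>{..<m}. Rn d) \<Otimes>\<^sub>M ?Y"
  let ?dec = "\<lambda>y. if rej y then 1 else 0 :: nat"
  have K: "(\<lambda>x. bits_law b (s j (x j))) \<in> ?O \<rightarrow>\<^sub>M prob_algebra (count_space ?A)" if "j \<in> {..<m}" for j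
    unfolding measurable_cong_sets[OF sets_observation_law refl]
    by (rule measurable_compose[OF measurable_component_singleton[OF that] measurable_bits_law]) (use s in auto)
  have h: "(\<lambda>(x, y). (x, y)) \<in> ?O \<Otimes>\<^sub>M ?Y \<rightarrow>\<^sub>M ?N"
    by (simp add: measurable_cong_sets[OF sets_pair_measure_cong[OF sets_observation_law refl] refl])
  have D: "(\<lambda>(x, y). ?dec y) \<in> ?N \<rightarrow>\<^sub>M count_space UNIV"
    unfolding case_prod_beta by (rule measurable_compose[OF measurable_snd decision_measurable])
  have "measure (private_law n m d (private_bits b s rej) f)
      {\<omega> \<in> space (private_law n m d (private_bits b s rej) f). (\<lambda>(x, y). decision (private_bits b s rej) y) \<omega> = c}
      = (\<integral>x. (\<Sum>y | y \<in> (\<Pi>\<^sub>E j\<in>{..<m}. ?A) \<and> ?dec y = c. \<Prod>j\<in>{..<m}. measure (bits_law b (s j (x j))) {y j}) \<partial>?O)"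
    unfolding private_law_def private_bits_def
    using measure_bind_transcripts[OF prob_space_observation_law finite_lessThan finite_lessThan K h D, where dec="?dec" and c=c] by simp
  also have "\<dots> = (\<integral>x. (\<Sum>y | y \<in> (\<Pi>\<^sub>E j\<in>{..<m}. ?A) \<and> ?dec y = c. \<Prod>j<m. bits_density b (s j (x j)) (y j)) \<partial>?O)"
    by (intro Bochner_Integration.integral_cong refl sum.cong prod.cong measure_bits_law s(2)) (auto simp: PiE_iff)
  also have "\<dots> = measure (transcript_law n m d b s f) {y \<in> \<Pi>\<^sub>E j\<in>{..<m}. ?A. ?dec y = c}"
    by (rule sum_bits_density_observation[OF s]) auto
  finally show ?thesis .
qed

lemma measure_public_bits:
  assumes U: "prob_space U"
    and s: "\<And>j r. (\<lambda>x. s j x r) \<in> borel_measurable (Rn d \<Otimes>\<^sub>M U)" "\<And>j x r. \<bar>s j x r\<bar> \<le> 1"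
  shows "measure (public_law n m d (public_bits b s U rej) f)
      {\<omega> \<in> space (public_law n m d (public_bits b s U rej) f). (\<lambda>(x, y, u). decision (public_bits b s U rej) y) \<omega> = c}
    = (\<integral>u. measure (transcript_law n m d b (\<lambda>j x. s j (x, u)) f)
          {y \<in> \<Pi>\<^sub>E j\<in>{..<m}. {..<2 ^ b}. (if rej y then 1 else 0) = c} \<partial>U)"
proof -
  let ?O = "observation_law n m d f" and ?A = "{..<(2::nat) ^ b}"
  let ?Y = "\<Pi>\<^sub>M j\<in>{..<m}. count_space ?A"
  let ?R = "\<Pi>\<^sub>M j\<in>{..<m}. Rn d"
  let ?N = "?R \<Otimes>\<^sub>M ?Y \<Otimes>\<^sub>M U"
  let ?dec = "\<lambda>y. if rej y then 1 else 0 :: nat"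
  let ?B = "{y. y \<in> (\<Pi>\<^sub>E j\<in>{..<m}. ?A) \<and> ?dec y = c}"
  let ?h = "\<lambda>(w :: (nat \<Rightarrow> nat \<Rightarrow> real) \<times> (nat \<Rightarrow> real)) (y :: nat \<Rightarrow> nat). (fst w, y, snd w)"
  let ?K = "\<lambda>j w. bits_law b (s j (fst w j, snd w))"
  interpret U: prob_space U by fact
  interpret O: prob_space ?O by (rule prob_space_observation_law)
  interpret OU: pair_prob_space ?O U ..
  have setsOU: "sets (?O \<Otimes>\<^sub>M U) = sets (?R \<Otimes>\<^sub>M U)" by (intro sets_pair_measure_cong) simp_all
  have sm: "(\<lambda>w. s j (fst w j, snd w) r) \<in> borel_measurable (?O \<Otimes>\<^sub>M U)" if "j \<in> {..<m}" for j r
    unfolding measurable_cong_sets[OF setsOU refl]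
  proof (rule measurable_compose[OF _ s(1)])
    show "(\<lambda>w. (fst w j, snd w)) \<in> ?R \<Otimes>\<^sub>M U \<rightarrow>\<^sub>M Rn d \<Otimes>\<^sub>M U"
      using that by measurable
  qed
  have K: "?K j \<in> ?O \<Otimes>\<^sub>M U \<rightarrow>\<^sub>M prob_algebra (count_space ?A)" if "j \<in> {..<m}" for j
    by (rule measurable_bits_law) (use s sm[OF that] in auto)
  have h: "(\<lambda>(w, y). ?h w y) \<in> (?O \<Otimes>\<^sub>M U) \<Otimes>\<^sub>M ?Y \<rightarrow>\<^sub>M ?N"
    unfolding measurable_cong_sets[OF sets_pair_measure_cong[OF setsOU refl] refl] by measurable
  have D: "(\<lambda>(x, y, u). ?dec y) \<in> ?N \<rightarrow>\<^sub>M count_space UNIV"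
    unfolding case_prod_beta
    by (rule measurable_compose[OF measurable_compose[OF measurable_snd measurable_fst] decision_measurable])
  have "measure (public_law n m d (public_bits b s U rej) f)
      {\<omega> \<in> space (public_law n m d (public_bits b s U rej) f). (\<lambda>(x, y, u). decision (public_bits b s U rej) y) \<omega> = c}
      = (\<integral>w. (\<Sum>y\<in>?B. \<Prod>j\<in>{..<m}. measure (?K j w) {y j}) \<partial>(?O \<Otimes>\<^sub>M U))"
    unfolding public_law_def public_bits_def
    using measure_bind_transcripts[OF OU.prob_space_axioms finite_lessThan finite_lessThan K h D, where dec="?dec" and c=c]
    by (simp add: case_prod_unfold)
  also have "\<dots> = (\<integral>w. (\<Sum>y\<in>?B. \<Prod>j<m. bits_density b (s j (fst w j, snd w)) (y j)) \<partial>(?O \<Otimes>\<^sub>M U))"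
    by (intro Bochner_Integration.integral_cong refl sum.cong prod.cong measure_bits_law s(2)) (auto simp: PiE_iff)
  also have "\<dots> = (\<integral>u. \<integral>x. (\<Sum>y\<in>?B. \<Prod>j<m. bits_density b (s j (x j, u)) (y j)) \<partial>?O \<partial>U)"
  proof -
    have "integrable (?O \<Otimes>\<^sub>M U) (\<lambda>w. \<Sum>y\<in>?B. \<Prod>j<m. bits_density b (s j (fst w j, snd w)) (y j))"
    proof (intro Bochner_Integration.integrable_sum OU.integrable_const_bound[where B=1])
      fix y
      show "AE w in ?O \<Otimes>\<^sub>M U. norm (\<Prod>j<m. bits_density b (s j (fst w j, snd w)) (y j)) \<le> 1"
        by (auto simp: abs_prod intro!: prod_le_1 abs_bits_density_le s(2))
      show "(\<lambda>w. \<Prod>j<m. bits_density b (s j (fst w j, snd w)) (y j)) \<in> borel_measurable (?O \<Otimes>\<^sub>M U)"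
        unfolding bits_density_def using sm by (intro borel_measurable_prod) auto
    qed
    then show ?thesis
      using OU.integral_snd[of "\<lambda>x u. \<Sum>y\<in>?B. \<Prod>j<m. bits_density b (s j (x j, u)) (y j)"]
      by (simp add: case_prod_unfold)
  qed
  also have "\<dots> = (\<integral>u. measure (transcript_law n m d b (\<lambda>j x. s j (x, u)) f) ?B \<partial>U)"
  proof (intro Bochner_Integration.integral_cong refl sum_bits_density_observation)
    fix u j r assume u: "u \<in> space U"
    show "(\<lambda>x. s j (x, u) r) \<in> borel_measurable (Rn d)"
      by (rule measurable_compose[OF _ s(1)]) (use u in measurable)
  qed (use s(2) in auto)
  finally show ?thesis .
qed

section \<open>A statistic built from two independent halves of the machines\<close>

lemma sets_transcript_law:
  "sets (transcript_law n m d b s f) = Pow (\<Pi>\<^sub>E j\<in>{..<m}. {..<2 ^ b})"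
  unfolding transcript_law_def by (rule sets_PiM_count_space) auto

lemma space_transcript_law: "space (transcript_law n m d b s f) = (\<Pi>\<^sub>E j\<in>{..<m}. {..<2 ^ b})"
  by (simp add: transcript_law_def space_PiM)

text \<open>
  Transcripts live in a finite discrete space, which settles all integrability questions about
  statistics of the transcripts.
\<close>

lemma integrable_finite_discrete:
  fixes f :: "'a \<Rightarrow> real"
  assumes "prob_space M" "finite (space M)" "sets M = Pow (space M)"
  shows "integrable M f"
proof -
  interpret prob_space M by fact
  have "f \<in> borel_measurable M" using assms by (auto simp: measurable_def)
  moreover have "norm (f x) \<le> Max ((\<lambda>x. norm (f x)) ` space M)" if "x \<in> space M" for x
    using assms(2) that by (intro Max_ge) auto
  ultimately show ?thesis by (intro integrable_const_bound[where B="Max ((\<lambda>x. norm (f x)) ` space M)"]) auto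
qed

lemma prob_space_transcript_law:
  assumes "\<And>j r. (\<lambda>x. s j x r) \<in> borel_measurable (Rn d)" "\<And>j x r. \<bar>s j x r\<bar> \<le> 1"
  shows "prob_space (transcript_law n m d b s f)"
  unfolding transcript_law_def by (intro prob_space_PiM prob_mixed_shift assms)

lemma integrable_transcript_law:
  fixes g :: "_ \<Rightarrow> real"
  assumes "\<And>j r. (\<lambda>x. s j x r) \<in> borel_measurable (Rn d)" "\<And>j x r. \<bar>s j x r\<bar> \<le> 1"
  shows "integrable (transcript_law n m d b s f) g"
  by (rule integrable_finite_discrete)
     (auto simp: sets_transcript_law space_transcript_law prob_space_transcript_law[OF assms] intro!: finite_PiE)

lemma integral_bit_sign_prod:
  assumes P: "prob_space P" and s: "\<And>r. (\<lambda>z. s z r) \<in> borel_measurable P" "\<And>z r. \<bar>s z r\<bar> \<le> 1"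
    and S: "S \<subseteq> {..<b}"
  shows "(\<integral>y. (\<Prod>r\<in>S. bit_sign y r) \<partial>mixed_bits_law P b s) = (\<integral>z. (\<Prod>r\<in>S. s z r) \<partial>P)"
  by (simp add: integral_mixed_bits_law[OF P s] sum_bits_density_prod[OF S])

text \<open>
  The covariance of two signs of one transcript; a sign has square \<open>1\<close>, whence the case distinction.
\<close>

definition bit_cov :: "'z measure \<Rightarrow> ('z \<Rightarrow> nat \<Rightarrow> real) \<Rightarrow> nat \<Rightarrow> nat \<Rightarrow> real" where
  "bit_cov P s k l = (if k = l then 1 else \<integral>z. s z k * s z l \<partial>P) - (\<integral>z. s z k \<partial>P) * (\<integral>z. s z l \<partial>P)"

lemma integral_centred_bits:
  assumes P: "prob_space P" and s: "\<And>r. (\<lambda>z. s z r) \<in> borel_measurable P" "\<And>z r. \<bar>s z r\<bar> \<le> 1"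
    and kl: "k < b" "l < b"
  shows "(\<integral>y. bit_sign y k - (\<integral>z. s z k \<partial>P) \<partial>mixed_bits_law P b s) = 0"
    "(\<integral>y. (bit_sign y k - (\<integral>z. s z k \<partial>P)) * (bit_sign y l - (\<integral>z. s z l \<partial>P)) \<partial>mixed_bits_law P b s) = bit_cov P s k l"
proof -
  let ?Q = "mixed_bits_law P b s"
  interpret Q: prob_space ?Q by (rule prob_space_mixed_bits_law[OF P s])
  have one: "measure ?Q {..<2 ^ b} = 1" using Q.prob_space by simp
  have int: "integrable ?Q g" for g :: "nat \<Rightarrow> real"
    by (rule integrable_finite_discrete) (auto simp: Q.prob_space_axioms)
  have e1: "(\<integral>y. bit_sign y k \<partial>?Q) = (\<integral>z. s z k \<partial>P)" if "k < b" for k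
    using integral_bit_sign_prod[OF P s, of "{k}" b] that by simp
  show "(\<integral>y. bit_sign y k - (\<integral>z. s z k \<partial>P) \<partial>?Q) = 0"
    by (simp add: int e1 kl one)
  have e2: "(\<integral>y. bit_sign y k * bit_sign y l \<partial>?Q) = (if k = l then 1 else \<integral>z. s z k * s z l \<partial>P)"
  proof (cases "k = l")
    case True
    have "bit_sign y l * bit_sign y l = 1" for y by (simp add: bit_sign_def)
    then show ?thesis using True by (simp add: one)
  next
    case False
    then show ?thesis using integral_bit_sign_prod[OF P s, of "{k, l}" b] kl by simp
  qed
  show "(\<integral>y. (bit_sign y k - (\<integral>z. s z k \<partial>P)) * (bit_sign y l - (\<integral>z. s z l \<partial>P)) \<partial>?Q) = bit_cov P s k l"
    by (simp add: left_diff_distrib right_diff_distrib int e1 e2 kl one bit_cov_def)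
qed

lemma sum_residue_class:
  fixes c :: real
  assumes "t < T"
  shows "(\<Sum>j\<in>{T * p..<T * p + T * q}. if j mod T = t then c else 0) = real q * c"
proof (induction q)
  case (Suc q)
  have split: "{T * p..<T * p + T * Suc q} = {T * p..<T * p + T * q} \<union> {T * (p + q)..<T * (p + q) + T}"
    by (auto simp: algebra_simps)
  have "(\<Sum>j\<in>{T * (p + q)..<T * (p + q) + T}. if j mod T = t then c else 0)
      = (\<Sum>i\<in>{0..<T}. if (i + T * (p + q)) mod T = t then c else 0)"
    using sum.shift_bounds_nat_ivl[of "\<lambda>j. if j mod T = t then c else 0" 0 "T * (p + q)" T] by (simp add: add.commute)
  moreover have "\<dots> = (\<Sum>i\<in>{0..<T}. if i = t then c else 0)"
    by (intro sum.cong) auto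
  moreover have "\<dots> = c" using assms by simp
  ultimately show ?case
    unfolding split using Suc by (subst sum.union_disjoint) (auto simp: algebra_simps)
qed simp

definition class_count :: "nat \<Rightarrow> nat set \<Rightarrow> (nat \<Rightarrow> nat) \<Rightarrow> nat \<times> nat \<Rightarrow> real" where
  "class_count T J y = (\<lambda>(t, k). \<Sum>j\<in>J. if j mod T = t then bit_sign (y j) k else 0)"

text \<open>
  Machine \<open>j\<close> belongs to group \<open>j mod T\<close> and reports on the \<open>b\<close> directions of that group. The first
  \<open>T * q\<close> machines and the next \<open>T * q\<close> machines give two independent estimates of each direction,
  whose products are summed.
\<close>

definition two_half_stat :: "nat \<Rightarrow> nat \<Rightarrow> nat \<Rightarrow> (nat \<Rightarrow> nat) \<Rightarrow> real" where
  "two_half_stat T q b y = (\<Sum>r\<in>{..<T} \<times> {..<b}. class_count T {..<T * q} y r * class_count T {T * q..<T * q + T * q} y r)"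

text \<open>
  The two halves give independent vectors of counts with the same mean \<open>q * \<mu>\<close> and the same
  covariance, which is \<open>q\<close> times that of a single transcript within a group and zero between groups.
\<close>

lemma two_half_stat_second_moment:
  fixes n m d b T q :: nat and f :: "nat \<Rightarrow> real"
    and s \<phi> :: "nat \<Rightarrow> (nat \<Rightarrow> real) \<Rightarrow> nat \<Rightarrow> real"
  assumes s: "\<And>j r. (\<lambda>x. s j x r) \<in> borel_measurable (Rn d)" "\<And>j x r. \<bar>s j x r\<bar> \<le> 1"
    and m: "2 * (T * q) \<le> m"
    and \<phi>: "\<And>j. j < 2 * (T * q) \<Longrightarrow> s j = \<phi> (j mod T)"
  defines "\<psi> \<equiv> \<lambda>t z. \<phi> t (shift_noise d (sqrt (real m / real n)) f z)"
  defines "\<mu> \<equiv> \<lambda>(t, k). \<integral>z. \<psi> t z k \<partial>std_normal_vector d"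
  defines "F \<equiv> (\<Sum>t<T. \<Sum>k<b. \<Sum>l<b. (bit_cov (std_normal_vector d) (\<psi> t) k l)\<^sup>2)"
  defines "Mu \<equiv> (\<Sum>r\<in>{..<T} \<times> {..<b}. (\<mu> r)\<^sup>2)"
  shows "(\<integral>y. (two_half_stat T q b y - (real q)\<^sup>2 * Mu)\<^sup>2 \<partial>transcript_law n m d b s f)
     \<le> 6 * real q ^ 3 * sqrt F * Mu + 3 * (real q)\<^sup>2 * F"
proof (cases "q = 0")
  case True
  then show ?thesis
    by (simp add: two_half_stat_def class_count_def)
next
  case q: False
  let ?N = "std_normal_vector d"
  let ?Q = "\<lambda>j. mixed_bits_law ?N b (\<lambda>z. s j (shift_noise d (sqrt (real m / real n)) f z))"
  let ?L = "transcript_law n m d b s f"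
  let ?R = "{..<T} \<times> {..<b}"
  let ?JA = "{..<T * q}" and ?JB = "{T * q..<T * q + T * q}"
  note N = prob_space_std_normal_vector
  interpret L: prob_space ?L by (rule prob_space_transcript_law[OF s])
  have Qp: "prob_space (?Q j)" for j by (rule prob_mixed_shift[OF s])
  have intL: "integrable ?L g" for g :: "_ \<Rightarrow> real" by (rule integrable_transcript_law[OF s])
  have intQ: "integrable (?Q j) g" for j and g :: "_ \<Rightarrow> real"
    by (rule integrable_finite_discrete) (auto simp: Qp)
  have PL: "?L = PiM {..<m} ?Q" by (simp add: transcript_law_def)
  have J: "?JA \<subseteq> {..<m}" "?JB \<subseteq> {..<m}" "?JB \<subseteq> {..<m} - ?JA" using m by auto
  have sm: "(\<lambda>z. s j (shift_noise d (sqrt (real m / real n)) f z) r) \<in> borel_measurable ?N" for j r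
    by (rule measurable_compose[OF shift_noise_measurable s(1)])
  \<comment> \<open>The centred contribution of machine \<open>j\<close> to direction \<open>r\<close>, zero if another group reports on \<open>r\<close>.\<close>
  define h where "h = (\<lambda>(r :: nat \<times> nat) j v. if j mod T = fst r then bit_sign v (snd r) - \<mu> r else 0)"
  define \<alpha> where "\<alpha> J r y = (\<Sum>j\<in>J. h r j (y j))" for J r and y :: "nat \<Rightarrow> nat"
  define C where "C r r' = (if fst r = fst r' then real q * bit_cov ?N (\<psi> (fst r)) (snd r) (snd r') else 0)" for r r'
  have Qj: "?Q j = mixed_bits_law ?N b (\<psi> (j mod T))" if "j < 2 * (T * q)" for j
    using \<phi>[OF that] by (simp add: \<psi>_def)
  have \<psi>: "(\<lambda>z. \<psi> (j mod T) z k) \<in> borel_measurable ?N" "\<bar>\<psi> (j mod T) z k\<bar> \<le> 1" if "j < 2 * (T * q)" for j k z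
    using sm[of j k] s(2)[of j "shift_noise d (sqrt (real m / real n)) f z" k] \<phi>[OF that] by (auto simp: \<psi>_def)
  have h0: "(\<integral>v. h r j v \<partial>?Q j) = 0" if "r \<in> ?R" "j < 2 * (T * q)" for r j
  proof (cases "j mod T = fst r")
    case True
    then show ?thesis
      unfolding Qj[OF that(2)] h_def
      using that integral_centred_bits(1)[where s="\<psi> (j mod T)" and k="snd r" and l="snd r" and b=b, OF N \<psi>[OF that(2)]]
      by (cases r) (simp add: \<mu>_def)
  qed (simp add: h_def)
  have h2: "(\<integral>v. h r j v * h r' j v \<partial>?Q j) = (if j mod T = fst r then if fst r = fst r' then bit_cov ?N (\<psi> (fst r)) (snd r) (snd r') else 0 else 0)"
    if "r \<in> ?R" "r' \<in> ?R" "j < 2 * (T * q)" for r r' j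
    unfolding Qj[OF that(3)] h_def using that integral_centred_bits(2)[where s="\<psi> (j mod T)" and k="snd r" and l="snd r'" and b=b, OF N \<psi>[OF that(3)]]
    by (auto simp: \<mu>_def case_prod_beta)
  have cov: "(\<integral>y. \<alpha> J r y * \<alpha> J r' y \<partial>?L) = C r r'"
    if r: "r \<in> ?R" "r' \<in> ?R" and J: "J = {T * p..<T * p + T * q}" "J \<subseteq> {..<2 * (T * q)}" for J r r' p
  proof -
    have "(\<integral>y. \<alpha> J r y * \<alpha> J r' y \<partial>?L) = (\<Sum>j\<in>J. \<integral>v. h r j v * h r' j v \<partial>?Q j)"
      unfolding \<alpha>_def PL using J m h0[OF r(1)] by (intro PiM_covariance_sum Qp intQ) auto
    also have "\<dots> = (\<Sum>j\<in>J. if j mod T = fst r then if fst r = fst r' then bit_cov ?N (\<psi> (fst r)) (snd r) (snd r') else 0 else 0)"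
      using J by (intro sum.cong refl h2 r) auto
    also have "\<dots> = C r r'"
      unfolding J(1) C_def using r by (subst sum_residue_class) auto
    finally show ?thesis .
  qed
  have aa: "(\<integral>y. \<alpha> ?JA r y * \<alpha> ?JA r' y \<partial>?L) = C r r'" if "r \<in> ?R" "r' \<in> ?R" for r r'
    by (rule cov[OF that, of _ 0]) auto
  have bb: "(\<integral>y. \<alpha> ?JB r y * \<alpha> ?JB r' y \<partial>?L) = C r r'" if "r \<in> ?R" "r' \<in> ?R" for r r'
    by (rule cov[OF that, of _ q]) auto
  have ab: "(\<integral>y. (\<alpha> ?JA r y * \<alpha> ?JA r' y) * (\<alpha> ?JB r y * \<alpha> ?JB r' y) \<partial>?L) = C r r' * C r r'"
    if "r \<in> ?R" "r' \<in> ?R" for r r'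
  proof -
    have "(\<integral>y. (\<alpha> ?JA r y * \<alpha> ?JA r' y) * (\<alpha> ?JB r y * \<alpha> ?JB r' y) \<partial>?L)
        = (\<integral>y. \<alpha> ?JA r y * \<alpha> ?JA r' y \<partial>?L) * (\<integral>y. \<alpha> ?JB r y * \<alpha> ?JB r' y \<partial>?L)"
      unfolding PL
    proof (rule PiM_integral_mult_disjoint[where J="?JA"])
      fix x y :: "nat \<Rightarrow> nat" assume "\<And>i. i \<in> {..<m} - ?JA \<Longrightarrow> x i = y i"
      then have "\<alpha> ?JB r x = \<alpha> ?JB r y" for r
        unfolding \<alpha>_def using J(3) by (intro sum.cong refl) (metis subsetD)
      then show "\<alpha> ?JB r x * \<alpha> ?JB r' x = \<alpha> ?JB r y * \<alpha> ?JB r' y" by simp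
    qed (use J in \<open>auto simp: Qp intL[unfolded PL] \<alpha>_def\<close>)
    then show ?thesis using aa[OF that] bb[OF that] by simp
  qed
  have cc: "class_count T J y r = real q * \<mu> r + \<alpha> J r y" if "r \<in> ?R" "J = {T * p..<T * p + T * q}" for r J p y
  proof -
    have "class_count T J y r = (\<Sum>j\<in>J. (if j mod T = fst r then \<mu> r else 0) + h r j (y j))"
      unfolding class_count_def case_prod_beta h_def by (intro sum.cong) auto
    also have "\<dots> = real q * \<mu> r + \<alpha> J r y"
      unfolding sum.distrib \<alpha>_def that(2) using that(1) by (subst sum_residue_class) auto
    finally show ?thesis .
  qed
  have ccA: "class_count T ?JA y r = real q * \<mu> r + \<alpha> ?JA r y" if "r \<in> ?R" for r y
    by (rule cc[OF that, of _ 0]) auto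
  have ccB: "class_count T ?JB y r = real q * \<mu> r + \<alpha> ?JB r y" if "r \<in> ?R" for r y
    by (rule cc[OF that, of _ q]) auto
  have S: "two_half_stat T q b y = (\<Sum>r\<in>?R. (real q * \<mu> r + \<alpha> ?JA r y) * (real q * \<mu> r + \<alpha> ?JB r y))" for y
    unfolding two_half_stat_def by (intro sum.cong refl) (simp only: ccA ccB)
  have sumC: "(\<Sum>r\<in>?R. \<Sum>r'\<in>?R. (C r r')\<^sup>2) = (real q)\<^sup>2 * F"
  proof -
    have "(\<Sum>r\<in>?R. \<Sum>r'\<in>?R. (C r r')\<^sup>2)
      = (\<Sum>t<T. \<Sum>k<b. \<Sum>t'<T. \<Sum>l<b. (C (t, k) (t', l))\<^sup>2)"
      by (simp add: sum.cartesian_product')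
    also have "\<dots> = (\<Sum>t<T. \<Sum>k<b. \<Sum>t'<T. if t' = t then \<Sum>l<b. (real q * bit_cov ?N (\<psi> t) k l)\<^sup>2 else 0)"
      by (intro sum.cong refl) (auto simp: C_def)
    also have "\<dots> = (\<Sum>t<T. \<Sum>k<b. \<Sum>l<b. (real q * bit_cov ?N (\<psi> t) k l)\<^sup>2)"
      by simp
    also have "\<dots> = (real q)\<^sup>2 * F"
      by (simp add: F_def power_mult_distrib sum_distrib_left)
    finally show ?thesis .
  qed
  have sumA: "(\<Sum>r\<in>?R. (real q * \<mu> r)\<^sup>2) = (real q)\<^sup>2 * Mu"
    by (simp add: Mu_def power_mult_distrib sum_distrib_left)
  have "(\<integral>y. (two_half_stat T q b y - (real q)\<^sup>2 * Mu)\<^sup>2 \<partial>?L)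
     \<le> 6 * sqrt ((real q)\<^sup>2 * F) * ((real q)\<^sup>2 * Mu) + 3 * ((real q)\<^sup>2 * F)"
    unfolding S sumA[symmetric] sumC[symmetric]
    by (rule L.bilinear_second_moment[OF _ intL aa bb ab]) auto
  also have "\<dots> = 6 * real q ^ 3 * sqrt F * Mu + 3 * (real q)\<^sup>2 * F"
    by (simp add: real_sqrt_mult power2_eq_square power3_eq_cube)
  finally show ?thesis .
qed

section \<open>Gaussian vectors\<close>

lemma prob_space_std_normal_distribution: "prob_space std_normal_distribution"
  by (rule prob_space_normal_density) simp

text \<open>
  Completing the square: after rescaling by \<open>a\<close> the damping factor is absorbed into the Gaussian
  density, and what remains is its characteristic function.
\<close>

lemma damped_char_std_normal:
  fixes c t :: real
  assumes c: "0 \<le> c"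
  defines "a \<equiv> 1 / sqrt (1 + 2 * c)"
  shows "(\<integral>z. complex_of_real (exp (- c * z\<^sup>2)) * iexp (t * z) \<partial>std_normal_distribution)
       = complex_of_real (a * exp (- (a\<^sup>2 * t\<^sup>2) / 2))"
proof -
  have a: "0 < a" "a\<^sup>2 = 1 / (1 + 2 * c)" using c by (auto simp: a_def power_divide)
  have dens: "std_normal_density (a * w) * exp (- c * (a * w)\<^sup>2) = std_normal_density w" for w
  proof -
    have "- (a * w)\<^sup>2 / 2 + - c * (a * w)\<^sup>2 = - w\<^sup>2 / 2 * (a\<^sup>2 * (1 + 2 * c))"
      by (simp add: power_mult_distrib algebra_simps)
    also have "a\<^sup>2 * (1 + 2 * c) = 1" using c by (simp add: a)
    finally show ?thesis by (simp add: std_normal_density_def exp_add[symmetric])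
  qed
  have "(\<integral>z. complex_of_real (exp (- c * z\<^sup>2)) * iexp (t * z) \<partial>std_normal_distribution)
      = (\<integral>z. std_normal_density z *\<^sub>R (complex_of_real (exp (- c * z\<^sup>2)) * iexp (t * z)) \<partial>lborel)"
    by (subst integral_density) auto
  also have "\<dots> = \<bar>a\<bar> *\<^sub>R (\<integral>w. std_normal_density (0 + a * w) *\<^sub>R (complex_of_real (exp (- c * (0 + a * w)\<^sup>2)) * iexp (t * (0 + a * w))) \<partial>lborel)"
    by (rule lborel_integral_real_affine) (use a in auto)
  also have "\<dots> = a *\<^sub>R (\<integral>w. std_normal_density w *\<^sub>R iexp ((a * t) * w) \<partial>lborel)"
  proof -
    have "std_normal_density (0 + a * w) *\<^sub>R (complex_of_real (exp (- c * (0 + a * w)\<^sup>2)) * iexp (t * (0 + a * w)))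
        = std_normal_density w *\<^sub>R iexp ((a * t) * w)" for w
      unfolding dens[of w, symmetric] by (simp add: scaleR_conv_of_real ac_simps)
    then show ?thesis using a by simp
  qed
  also have "\<dots> = a *\<^sub>R char std_normal_distribution (a * t)"
    unfolding char_def by (subst integral_density) auto
  also have "\<dots> = complex_of_real (a * exp (- (a\<^sup>2 * t\<^sup>2) / 2))"
    by (simp add: char_std_normal_distribution scaleR_conv_of_real power_mult_distrib)
  finally show ?thesis .
qed

lemma std_normal_vector_eq: "std_normal_vector d = (\<Pi>\<^sub>M i\<in>{..<d}. std_normal_distribution)"
  by (simp add: std_normal_vector_def)

lemma component_measurable_std_normal[measurable]:
  "i < d \<Longrightarrow> (\<lambda>z. z i) \<in> borel_measurable (std_normal_vector d)"
  unfolding std_normal_vector_eq by (rule measurable_compose[OF measurable_component_singleton]) auto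

lemma damped_char_std_normal_vector:
  fixes c :: real and v :: "nat \<Rightarrow> real"
  assumes c: "0 \<le> c"
  defines "a \<equiv> 1 / sqrt (1 + 2 * c)"
  shows "(\<integral>z. complex_of_real (exp (- c * (\<Sum>i<d. (z i)\<^sup>2))) * iexp (\<Sum>i<d. v i * z i) \<partial>std_normal_vector d)
       = complex_of_real (a ^ d * exp (- (a\<^sup>2 * (\<Sum>i<d. (v i)\<^sup>2)) / 2))"
proof -
  interpret N: prob_space std_normal_distribution by (rule prob_space_std_normal_distribution)
  interpret product_prob_space "\<lambda>_. std_normal_distribution" "{..<d}"
    by (rule product_prob_spaceI) (rule prob_space_std_normal_distribution)
  let ?h = "\<lambda>i z. complex_of_real (exp (- c * z\<^sup>2)) * iexp (v i * z)"
  have int: "integrable std_normal_distribution (?h i)" for i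
  proof (rule N.integrable_const_bound[where B=1])
    have "norm (?h i z) \<le> 1" for z using c by (simp add: norm_mult)
    then show "AE z in std_normal_distribution. norm (?h i z) \<le> 1" by simp
  qed auto
  have "(\<integral>z. complex_of_real (exp (- c * (\<Sum>i<d. (z i)\<^sup>2))) * iexp (\<Sum>i<d. v i * z i) \<partial>std_normal_vector d)
      = (\<integral>z. (\<Prod>i<d. ?h i (z i)) \<partial>std_normal_vector d)"
    by (simp add: exp_sum prod.distrib sum_distrib_left flip: sum_negf of_real_prod)
  also have "\<dots> = (\<Prod>i<d. \<integral>z. ?h i z \<partial>std_normal_distribution)"
    unfolding std_normal_vector_eq by (rule product_integral_prod) (use int in auto)
  also have "\<dots> = (\<Prod>i<d. complex_of_real (a * exp (- (a\<^sup>2 * (v i)\<^sup>2) / 2)))"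
    unfolding a_def by (intro prod.cong refl damped_char_std_normal c)
  also have "\<dots> = complex_of_real (a ^ d * exp (- (a\<^sup>2 * (\<Sum>i<d. (v i)\<^sup>2)) / 2))"
    by (simp add: prod.distrib sum_distrib_left sum_divide_distrib exp_sum flip: of_real_prod sum_negf)
  finally show ?thesis .
qed

lemma damped_cos_std_normal_vector:
  fixes c \<theta> :: real and v :: "nat \<Rightarrow> real"
  assumes c: "0 \<le> c"
  defines "a \<equiv> 1 / sqrt (1 + 2 * c)"
  shows "(\<integral>z. exp (- c * (\<Sum>i<d. (z i)\<^sup>2)) * cos (\<theta> + (\<Sum>i<d. v i * z i)) \<partial>std_normal_vector d)
       = a ^ d * exp (- (a\<^sup>2 * (\<Sum>i<d. (v i)\<^sup>2)) / 2) * cos \<theta>" (is ?C)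
    "(\<integral>z. exp (- c * (\<Sum>i<d. (z i)\<^sup>2)) * sin (\<theta> + (\<Sum>i<d. v i * z i)) \<partial>std_normal_vector d)
       = a ^ d * exp (- (a\<^sup>2 * (\<Sum>i<d. (v i)\<^sup>2)) / 2) * sin \<theta>" (is ?S)
proof -
  interpret N: prob_space "std_normal_vector d" by (rule prob_space_std_normal_vector)
  let ?g = "\<lambda>z. complex_of_real (exp (- c * (\<Sum>i<d. (z i)\<^sup>2))) * iexp (\<Sum>i<d. v i * z i)"
  let ?R = "a ^ d * exp (- (a\<^sup>2 * (\<Sum>i<d. (v i)\<^sup>2)) / 2)"
  have int: "integrable (std_normal_vector d) ?g"
  proof (rule N.integrable_const_bound[where B=1])
    have "norm (?g z) \<le> 1" for z using c by (simp add: norm_mult sum_nonneg)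
    then show "AE z in std_normal_vector d. norm (?g z) \<le> 1" by simp
  qed measurable
  have int': "integrable (std_normal_vector d) (\<lambda>z. cis \<theta> * ?g z)" using int by simp
  have E: "(\<integral>z. cis \<theta> * ?g z \<partial>std_normal_vector d) = cis \<theta> * complex_of_real ?R"
    using damped_char_std_normal_vector[OF c, of d v] by (simp add: a_def)
  have eq: "cis \<theta> * ?g z = complex_of_real (exp (- c * (\<Sum>i<d. (z i)\<^sup>2))) * cis (\<theta> + (\<Sum>i<d. v i * z i))" for z
  proof -
    have "cis \<theta> * (complex_of_real R * iexp y) = complex_of_real R * cis (\<theta> + y)" for R y
      by (simp add: cis_conv_exp[symmetric] cis_mult mult.left_commute)
    then show ?thesis .
  qed
  have "?C \<longleftrightarrow> (\<integral>z. Re (cis \<theta> * ?g z) \<partial>std_normal_vector d) = Re (cis \<theta> * complex_of_real ?R)"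
    unfolding eq by (simp add: mult.commute)
  then show ?C using E integral_Re[OF int'] by simp
  have "?S \<longleftrightarrow> (\<integral>z. Im (cis \<theta> * ?g z) \<partial>std_normal_vector d) = Im (cis \<theta> * complex_of_real ?R)"
    unfolding eq by (simp add: mult.commute)
  then show ?S using E integral_Im[OF int'] by simp
qed

lemma integral_cos_std_normal_vector:
  "(\<integral>z. cos (\<theta> + (\<Sum>i<d. v i * z i)) \<partial>std_normal_vector d) = exp (- (\<Sum>i<d. (v i)\<^sup>2) / 2) * cos \<theta>"
  "(\<integral>z. sin (\<theta> + (\<Sum>i<d. v i * z i)) \<partial>std_normal_vector d) = exp (- (\<Sum>i<d. (v i)\<^sup>2) / 2) * sin \<theta>"
  using damped_cos_std_normal_vector[of 0 d \<theta> v] by simp_all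

lemma integrable_bounded_std_normal_vector:
  fixes f :: "_ \<Rightarrow> real"
  assumes "f \<in> borel_measurable (std_normal_vector d)" "\<And>z. \<bar>f z\<bar> \<le> B"
  shows "integrable (std_normal_vector d) f"
proof -
  interpret N: prob_space "std_normal_vector d" by (rule prob_space_std_normal_vector)
  show ?thesis using assms by (intro N.integrable_const_bound[where B=B]) auto
qed

lemma exp_minus_1_le:
  fixes x y :: real
  assumes "\<bar>x\<bar> \<le> y"
  shows "exp (- y) * \<bar>exp x - 1\<bar> \<le> \<bar>x\<bar>"
proof (cases "0 \<le> x")
  case True
  have "exp (- y) * \<bar>exp x - 1\<bar> \<le> exp (- x) * (exp x - 1)"
    using True assms by (intro mult_mono) auto
  also have "\<dots> = 1 - exp (- x)" by (simp add: algebra_simps exp_minus)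
  also have "\<dots> \<le> \<bar>x\<bar>" using exp_ge_add_one_self[of "-x"] True by simp
  finally show ?thesis .
next
  case False
  have "exp (- y) * \<bar>exp x - 1\<bar> \<le> 1 * (1 - exp x)"
    using False assms by (intro mult_mono) auto
  also have "\<dots> \<le> \<bar>x\<bar>" by (smt (verit) exp_ge_add_one_self)
  finally show ?thesis .
qed

text \<open>
  The product of two sines is a difference of cosines, whose Gaussian means are explicit. Writing \<open>E\<close>
  for the product of the two damping factors, the covariance is a combination of \<open>E * (exp \<rho> - 1)\<close> and
  \<open>E * (exp (- \<rho>) - 1)\<close>, where \<open>\<rho>\<close> is the inner product of the directions. The damping compensates
  the exponentials, so the bound holds for directions of any length. This is the reason for sending signs
  with sinusoidal means: nearly orthogonal directions give nearly uncorrelated signs.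
\<close>

lemma sin_covariance_bound:
  fixes v w :: "nat \<Rightarrow> real" and \<theta> \<eta> :: real and d :: nat
  defines "U \<equiv> \<lambda>z. sin (\<theta> + (\<Sum>i<d. v i * z i))"
  defines "W \<equiv> \<lambda>z. sin (\<eta> + (\<Sum>i<d. w i * z i))"
  shows "\<bar>(\<integral>z. U z * W z \<partial>std_normal_vector d) - (\<integral>z. U z \<partial>std_normal_vector d) * (\<integral>z. W z \<partial>std_normal_vector d)\<bar>
     \<le> \<bar>\<Sum>i<d. v i * w i\<bar>"
proof -
  let ?N = "std_normal_vector d"
  define V where "V = (\<Sum>i<d. (v i)\<^sup>2)"
  define V' where "V' = (\<Sum>i<d. (w i)\<^sup>2)"
  define \<rho> where "\<rho> = (\<Sum>i<d. v i * w i)"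
  have pp: "(\<Sum>i<d. (v i - w i)\<^sup>2) = V + V' - 2 * \<rho>" "(\<Sum>i<d. (v i + w i)\<^sup>2) = V + V' + 2 * \<rho>"
    by (simp_all add: V_def V'_def \<rho>_def power2_eq_square algebra_simps sum.distrib sum_subtractf sum_distrib_left)
  have "0 \<le> V + V' - 2 * \<rho>" "0 \<le> V + V' + 2 * \<rho>"
    unfolding pp[symmetric] by (auto intro: sum_nonneg)
  then have \<rho>: "\<bar>\<rho>\<bar> \<le> (V + V') / 2" by simp
  have eq: "U z * W z = (cos ((\<theta> - \<eta>) + (\<Sum>i<d. (v i - w i) * z i)) - cos ((\<theta> + \<eta>) + (\<Sum>i<d. (v i + w i) * z i))) / 2" for z
    unfolding U_def W_def sin_times_sin
    by (simp add: algebra_simps sum.distrib sum_subtractf)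
  define E where "E = exp (- ((V + V') / 2))"
  have E: "exp (- (V + V' - 2 * \<rho>) / 2) = E * exp \<rho>" "exp (- (V + V' + 2 * \<rho>) / 2) = E * exp (- \<rho>)"
    "exp (- V / 2) * exp (- V' / 2) = E"
    unfolding E_def exp_add[symmetric] by (simp_all add: field_simps)
  have "(\<integral>z. U z * W z \<partial>?N) = (exp (- (V + V' - 2 * \<rho>) / 2) * cos (\<theta> - \<eta>) - exp (- (V + V' + 2 * \<rho>) / 2) * cos (\<theta> + \<eta>)) / 2"
    unfolding eq
    by (subst integral_divide_zero, subst Bochner_Integration.integral_diff)
       (auto simp: integral_cos_std_normal_vector pp intro!: integrable_bounded_std_normal_vector[where B=1])
  then have I1: "(\<integral>z. U z * W z \<partial>?N) = (E * exp \<rho> * cos (\<theta> - \<eta>) - E * exp (- \<rho>) * cos (\<theta> + \<eta>)) / 2"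
    unfolding E .
  have "(\<integral>z. U z \<partial>?N) * (\<integral>z. W z \<partial>?N) = (exp (- V / 2) * exp (- V' / 2)) * (sin \<theta> * sin \<eta>)"
    unfolding U_def W_def by (simp add: integral_cos_std_normal_vector V_def V'_def)
  then have I2: "(\<integral>z. U z \<partial>?N) * (\<integral>z. W z \<partial>?N) = E * ((cos (\<theta> - \<eta>) - cos (\<theta> + \<eta>)) / 2)"
    unfolding E sin_times_sin .
  have "(\<integral>z. U z * W z \<partial>?N) - (\<integral>z. U z \<partial>?N) * (\<integral>z. W z \<partial>?N)
     = (E * (exp \<rho> - 1) * cos (\<theta> - \<eta>) - E * (exp (- \<rho>) - 1) * cos (\<theta> + \<eta>)) / 2"
    unfolding I1 I2 by (simp add: algebra_simps diff_divide_distrib add_divide_distrib)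
  also have "\<bar>\<dots>\<bar> \<le> (\<bar>\<rho>\<bar> + \<bar>\<rho>\<bar>) / 2"
  proof -
    have "\<bar>E * (exp \<rho> - 1) * cos (\<theta> - \<eta>)\<bar> \<le> \<bar>\<rho>\<bar> * 1"
      unfolding abs_mult using exp_minus_1_le[OF \<rho>] by (intro mult_mono) (auto simp: E_def)
    moreover have "\<bar>E * (exp (- \<rho>) - 1) * cos (\<theta> + \<eta>)\<bar> \<le> \<bar>\<rho>\<bar> * 1"
      unfolding abs_mult using exp_minus_1_le[of "-\<rho>"] \<rho> by (intro mult_mono) (auto simp: E_def)
    ultimately show ?thesis by (simp add: field_simps abs_le_iff)
  qed
  finally show ?thesis by (simp add: \<rho>_def)
qed

lemma std_normal_distribution_moments:
  shows "integrable std_normal_distribution (\<lambda>z. z ^ k)"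
    "(\<integral>z. z \<partial>std_normal_distribution) = 0" "(\<integral>z. z\<^sup>2 \<partial>std_normal_distribution) = 1"
    "(\<integral>z. z ^ 4 \<partial>std_normal_distribution) = 3"
  using integrable_std_normal_distribution_moment[of k]
    integral_std_normal_distribution_moment_odd[of 1]
    std_normal_distribution_even_moments(1)[of 1] std_normal_distribution_even_moments(1)[of 2]
  by (simp_all add: fact_numeral)

lemma centred_chi_square_moments:
  "integrable (std_normal_vector d) (\<lambda>z. ((\<Sum>i<d. (z i)\<^sup>2) - real d)\<^sup>2)"
  "(\<integral>z. ((\<Sum>i<d. (z i)\<^sup>2) - real d)\<^sup>2 \<partial>std_normal_vector d) = 2 * real d"
  "integrable (std_normal_vector d) (\<lambda>z. (\<Sum>i<d. (z i)\<^sup>2) - real d)"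
  "(\<integral>z. (\<Sum>i<d. (z i)\<^sup>2) - real d \<partial>std_normal_vector d) = 0"
proof -
  let ?G = std_normal_distribution
  interpret G: prob_space ?G by (rule prob_space_std_normal_distribution)
  have eq: "(\<Sum>i<d. (z i)\<^sup>2) - real d = (\<Sum>i<d. (z i)\<^sup>2 - 1)" for z :: "nat \<Rightarrow> real"
    by (simp add: sum_subtractf)
  have sq: "(z\<^sup>2 - 1) * (z\<^sup>2 - 1) = z ^ 4 - 2 * z\<^sup>2 + 1" for z :: real
    by (simp add: algebra_simps power2_eq_square power4_eq_xxxx)
  have int: "integrable ?G (\<lambda>z. z\<^sup>2 - 1)" "integrable ?G (\<lambda>z. (z\<^sup>2 - 1) * (z\<^sup>2 - 1))"
    unfolding sq using std_normal_distribution_moments(1)[of 2] std_normal_distribution_moments(1)[of 4] by simp_all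
  have G1: "measure ?G (space ?G) = 1" by (rule G.prob_space)
  have zero: "(\<integral>z. z\<^sup>2 - 1 \<partial>?G) = 0"
    using std_normal_distribution_moments(1)[of 2] G1 by (simp add: std_normal_distribution_moments)
  have two: "(\<integral>z. (z\<^sup>2 - 1) * (z\<^sup>2 - 1) \<partial>?G) = 2"
    unfolding sq using std_normal_distribution_moments(1)[of 2] std_normal_distribution_moments(1)[of 4] G1 by (simp add: std_normal_distribution_moments)
  note c = PiM_covariance_sum[where M="\<lambda>_. ?G" and I="{..<d}" and J="{..<d}" and h="\<lambda>_ z. z\<^sup>2 - 1" and k="\<lambda>_ z. z\<^sup>2 - 1",
      OF prob_space_std_normal_distribution finite_lessThan subset_refl int(1) int(1) int(2) zero]
  show "integrable (std_normal_vector d) (\<lambda>z. ((\<Sum>i<d. (z i)\<^sup>2) - real d)\<^sup>2)"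
    "(\<integral>z. ((\<Sum>i<d. (z i)\<^sup>2) - real d)\<^sup>2 \<partial>std_normal_vector d) = 2 * real d"
    unfolding eq power2_eq_square[of "sum _ _"] std_normal_vector_eq using c two by simp_all
  have comp: "integrable (std_normal_vector d) (\<lambda>z. (z i)\<^sup>2 - 1) \<and> (\<integral>z. (z i)\<^sup>2 - 1 \<partial>std_normal_vector d) = 0" if "i < d" for i
    unfolding std_normal_vector_eq
    using PiM_integral_component[where M="\<lambda>_. ?G" and I="{..<d}" and i=i and f="\<lambda>z. z\<^sup>2 - 1"]
      that int(1) zero prob_space_std_normal_distribution by simp
  show "integrable (std_normal_vector d) (\<lambda>z. (\<Sum>i<d. (z i)\<^sup>2) - real d)"
    "(\<integral>z. (\<Sum>i<d. (z i)\<^sup>2) - real d \<partial>std_normal_vector d) = 0"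
    unfolding eq using comp by (auto simp: Bochner_Integration.integral_sum)
qed

lemma linear_form_moments:
  "integrable (std_normal_vector d) (\<lambda>z. (\<Sum>i<d. v i * z i)\<^sup>2)"
  "(\<integral>z. (\<Sum>i<d. v i * z i)\<^sup>2 \<partial>std_normal_vector d) = (\<Sum>i<d. (v i)\<^sup>2)"
  "integrable (std_normal_vector d) (\<lambda>z. \<Sum>i<d. v i * z i)"
proof -
  let ?G = std_normal_distribution
  interpret G: prob_space ?G by (rule prob_space_std_normal_distribution)
  have sq: "v i * z * (v i * z) = (v i)\<^sup>2 * z\<^sup>2" for i and z :: real by (simp add: power2_eq_square)
  have int: "integrable ?G (\<lambda>z. v i * z)" "integrable ?G (\<lambda>z. v i * z * (v i * z))" for i
    unfolding sq using std_normal_distribution_moments(1)[of 2] std_normal_distribution_moments(1)[of 1] by auto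
  have zero: "(\<integral>z. v i * z \<partial>?G) = 0" for i by (simp add: std_normal_distribution_moments)
  have two: "(\<integral>z. v i * z * (v i * z) \<partial>?G) = (v i)\<^sup>2" for i
    unfolding sq by (simp add: std_normal_distribution_moments)
  note c = PiM_covariance_sum[where M="\<lambda>_. ?G" and I="{..<d}" and J="{..<d}" and h="\<lambda>i z. v i * z" and k="\<lambda>i z. v i * z",
      OF prob_space_std_normal_distribution finite_lessThan subset_refl int(1) int(1) int(2) zero]
  show "integrable (std_normal_vector d) (\<lambda>z. (\<Sum>i<d. v i * z i)\<^sup>2)"
    "(\<integral>z. (\<Sum>i<d. v i * z i)\<^sup>2 \<partial>std_normal_vector d) = (\<Sum>i<d. (v i)\<^sup>2)"
    unfolding power2_eq_square[of "sum _ _"] std_normal_vector_eq using c two by simp_all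
  have comp: "integrable (std_normal_vector d) (\<lambda>z. v i * z i)" if "i < d" for i
    unfolding std_normal_vector_eq
    using PiM_integral_component(1)[where M="\<lambda>_. ?G" and I="{..<d}" and i=i and f="\<lambda>z. v i * z"]
      that int(1) prob_space_std_normal_distribution by simp
  then show "integrable (std_normal_vector d) (\<lambda>z. \<Sum>i<d. v i * z i)" by auto
qed

lemma std_normal_distribution_uminus: "distr std_normal_distribution std_normal_distribution uminus = std_normal_distribution"
proof (rule measure_eqI)
  fix A assume "A \<in> sets (distr std_normal_distribution std_normal_distribution uminus)"
  then have A[measurable]: "A \<in> sets borel" by simp
  have A': "uminus -` A \<in> sets borel" using measurable_sets_borel[of uminus borel A] by simp
  have "emeasure (distr std_normal_distribution std_normal_distribution uminus) A
      = (\<integral>\<^sup>+x. ennreal (std_normal_density x) * indicator A (- x) \<partial>lborel)"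
    using A' by (subst emeasure_distr) (auto simp: emeasure_density indicator_def)
  also have "\<dots> = (\<integral>\<^sup>+x. ennreal (std_normal_density x) * indicator A x \<partial>lborel)"
    by (subst (2) nn_integral_real_affine[where c="-1" and t=0]) (auto simp: std_normal_density_def)
  also have "\<dots> = emeasure std_normal_distribution A" by (simp add: emeasure_density)
  finally show "emeasure (distr std_normal_distribution std_normal_distribution uminus) A = emeasure std_normal_distribution A" .
qed simp

lemma std_normal_vector_uminus:
  "distr (std_normal_vector d) (std_normal_vector d) (\<lambda>z. \<lambda>i\<in>{..<d}. - z i) = std_normal_vector d"
proof -
  have "distr (std_normal_vector d) (std_normal_vector d) (compose {..<d} uminus)
      = PiM {..<d} (\<lambda>_. distr std_normal_distribution std_normal_distribution uminus)"
    unfolding std_normal_vector_eq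
    by (rule distr_PiM_finite_prob_space') (auto intro: prob_space_std_normal_distribution)
  moreover have "compose {..<d} uminus = (\<lambda>z. \<lambda>i\<in>{..<d}. - z i :: real)"
    by (auto simp: compose_def fun_eq_iff)
  ultimately show ?thesis
    by (simp add: std_normal_distribution_uminus std_normal_vector_eq[symmetric])
qed

text \<open>
  The reflection \<open>z \<mapsto> - z\<close> preserves the Gaussian law and changes the sign of the integrand.
\<close>

lemma integral_linear_times_even:
  fixes H :: "(nat \<Rightarrow> real) \<Rightarrow> real"
  assumes H: "H \<in> borel_measurable (std_normal_vector d)" "\<And>z. H (\<lambda>i\<in>{..<d}. - z i) = H z"
  shows "(\<integral>z. (\<Sum>i<d. v i * z i) * H z \<partial>std_normal_vector d) = 0"
proof -
  let ?N = "std_normal_vector d" and ?n = "\<lambda>z. \<lambda>i\<in>{..<d}. - z i :: real"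
  have n: "?n \<in> ?N \<rightarrow>\<^sub>M ?N"
    using component_measurable_std_normal[of _ d] unfolding std_normal_vector_eq
    by (intro measurable_restrict) auto
  have "(\<integral>z. (\<Sum>i<d. v i * z i) * H z \<partial>?N) = (\<integral>z. (\<Sum>i<d. v i * z i) * H z \<partial>distr ?N ?N ?n)"
    by (simp add: std_normal_vector_uminus)
  also have "\<dots> = (\<integral>z. (\<Sum>i<d. v i * ?n z i) * H (?n z) \<partial>?N)"
    by (rule integral_distr[OF n]) (use H in measurable)
  also have "\<dots> = - (\<integral>z. (\<Sum>i<d. v i * z i) * H z \<partial>?N)"
    unfolding H(2) by (simp add: sum_negf)
  finally show ?thesis by simp
qed

section \<open>The smoothed chi-square statistic\<close>

lemma arctan_second_order:
  fixes w \<delta> :: real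
  shows "\<bar>arctan (w + \<delta>) - arctan w - \<delta> / (1 + w\<^sup>2)\<bar> \<le> \<delta>\<^sup>2"
proof -
  have "\<exists>\<xi>. \<bar>\<xi> - w\<bar> \<le> \<bar>\<delta>\<bar> \<and> arctan (w + \<delta>) - arctan w = \<delta> * (1 / (1 + \<xi>\<^sup>2))"
  proof (cases \<delta> "0 :: real" rule: linorder_cases)
    case less
    obtain \<xi> where "w + \<delta> < \<xi>" "\<xi> < w" "arctan w - arctan (w + \<delta>) = (w - (w + \<delta>)) * (1 / (1 + \<xi>\<^sup>2))"
      using MVT2[of "w + \<delta>" w arctan "\<lambda>x. 1 / (1 + x\<^sup>2)"] less DERIV_arctan by (auto simp: inverse_eq_divide)
    then show ?thesis by (intro exI[of _ \<xi>]) auto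
  next
    case greater
    obtain \<xi> where "w < \<xi>" "\<xi> < w + \<delta>" "arctan (w + \<delta>) - arctan w = (w + \<delta> - w) * (1 / (1 + \<xi>\<^sup>2))"
      using MVT2[of w "w + \<delta>" arctan "\<lambda>x. 1 / (1 + x\<^sup>2)"] greater DERIV_arctan by (auto simp: inverse_eq_divide)
    then show ?thesis by (intro exI[of _ \<xi>]) auto
  qed auto
  then obtain \<xi> where \<xi>: "\<bar>\<xi> - w\<bar> \<le> \<bar>\<delta>\<bar>" "arctan (w + \<delta>) - arctan w = \<delta> * (1 / (1 + \<xi>\<^sup>2))" by blast
  have pos: "0 < 1 + \<xi>\<^sup>2" "0 < 1 + w\<^sup>2" by (simp_all add: add_pos_nonneg)
  have "\<bar>1 / (1 + \<xi>\<^sup>2) - 1 / (1 + w\<^sup>2)\<bar> = \<bar>w - \<xi>\<bar> * (\<bar>w + \<xi>\<bar> / ((1 + \<xi>\<^sup>2) * (1 + w\<^sup>2)))"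
  proof -
    have "1 / (1 + \<xi>\<^sup>2) - 1 / (1 + w\<^sup>2) = (w - \<xi>) * ((w + \<xi>) / ((1 + \<xi>\<^sup>2) * (1 + w\<^sup>2)))"
      using pos by (simp add: field_simps power2_eq_square)
    then show ?thesis using pos by (simp add: abs_mult)
  qed
  also have "\<dots> \<le> \<bar>w - \<xi>\<bar> * 1"
  proof (intro mult_left_mono)
    have "\<bar>w + \<xi>\<bar> \<le> (1 + \<xi>\<^sup>2) * (1 + w\<^sup>2)"
    proof -
      have "0 \<le> (1 - \<bar>w\<bar>)\<^sup>2" "0 \<le> (1 - \<bar>\<xi>\<bar>)\<^sup>2" by simp_all
      then have "2 * \<bar>w\<bar> \<le> 1 + w\<^sup>2" "2 * \<bar>\<xi>\<bar> \<le> 1 + \<xi>\<^sup>2" by (simp_all add: power2_diff)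
      moreover have "0 \<le> \<xi>\<^sup>2 * w\<^sup>2" by simp
      moreover have "(1 + \<xi>\<^sup>2) * (1 + w\<^sup>2) = 1 + \<xi>\<^sup>2 + w\<^sup>2 + \<xi>\<^sup>2 * w\<^sup>2" by (simp add: algebra_simps)
      moreover have "\<bar>w + \<xi>\<bar> \<le> \<bar>w\<bar> + \<bar>\<xi>\<bar>" by (rule abs_triangle_ineq)
      moreover have "0 \<le> w\<^sup>2" "0 \<le> \<xi>\<^sup>2" by simp_all
      ultimately show ?thesis by linarith
    qed
    then show "\<bar>w + \<xi>\<bar> / ((1 + \<xi>\<^sup>2) * (1 + w\<^sup>2)) \<le> 1" using pos by simp
  qed simp
  finally have k: "\<bar>1 / (1 + \<xi>\<^sup>2) - 1 / (1 + w\<^sup>2)\<bar> \<le> \<bar>\<delta>\<bar>" using \<xi>(1) by simp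
  have "arctan (w + \<delta>) - arctan w - \<delta> / (1 + w\<^sup>2) = \<delta> * (1 / (1 + \<xi>\<^sup>2) - 1 / (1 + w\<^sup>2))"
    unfolding \<xi>(2) by (simp add: right_diff_distrib)
  then have "\<bar>arctan (w + \<delta>) - arctan w - \<delta> / (1 + w\<^sup>2)\<bar> = \<bar>\<delta>\<bar> * \<bar>1 / (1 + \<xi>\<^sup>2) - 1 / (1 + w\<^sup>2)\<bar>"
    by (simp add: abs_mult)
  also have "\<dots> \<le> \<bar>\<delta>\<bar> * \<bar>\<delta>\<bar>" using k by (intro mult_left_mono) auto
  finally show ?thesis by (simp add: power2_eq_square)
qed

lemma borel_measurable_arctan: "arctan \<in> borel_measurable borel"
  by (intro borel_measurable_continuous_onI continuous_on_arctan continuous_on_id)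

lemma integrable_arctan_std_normal_vector:
  assumes "f \<in> borel_measurable (std_normal_vector d)"
  shows "integrable (std_normal_vector d) (\<lambda>z. arctan (f z))"
proof (rule integrable_bounded_std_normal_vector[where B="pi"])
  show "\<bar>arctan (f z)\<bar> \<le> pi" for z using arctan_bounded[of "f z"] pi_gt_zero by (simp add: abs_le_iff)
  show "(\<lambda>z. arctan (f z)) \<in> borel_measurable (std_normal_vector d)"
    by (rule measurable_compose[OF assms borel_measurable_arctan])
qed

text \<open>
  The centred squared norm: under the null hypothesis it has mean \<open>0\<close> and standard deviation of order
  \<open>sqrt d\<close>.
\<close>

definition chi_excess :: "nat \<Rightarrow> (nat \<Rightarrow> real) \<Rightarrow> real" where
  "chi_excess d x = (\<Sum>i<d. (x i)\<^sup>2) - real d"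

lemma chi_excess_shift:
  "chi_excess d (\<lambda>i. g i + z i) = chi_excess d z + (\<Sum>i<d. (g i)\<^sup>2) + 2 * (\<Sum>i<d. g i * z i)"
  by (simp add: chi_excess_def power2_sum sum.distrib sum_distrib_left mult.assoc)

lemma chi_excess_measurable[measurable]:
  "(\<lambda>z. chi_excess d (\<lambda>i. g i + z i)) \<in> borel_measurable (std_normal_vector d)"
  "chi_excess d \<in> borel_measurable (std_normal_vector d)"
  unfolding chi_excess_def by measurable

lemma chi_excess_null_moments:
  "integrable (std_normal_vector d) (\<lambda>z. (chi_excess d z)\<^sup>2)"
  "(\<integral>z. (chi_excess d z)\<^sup>2 \<partial>std_normal_vector d) = 2 * real d"
  "integrable (std_normal_vector d) (chi_excess d)"
  "(\<integral>z. chi_excess d z \<partial>std_normal_vector d) = 0"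
  using centred_chi_square_moments[of d] by (simp_all add: chi_excess_def[abs_def])

lemma chi_excess_second_moment:
  fixes g :: "nat \<Rightarrow> real" and d :: nat
  defines "G \<equiv> (\<Sum>i<d. (g i)\<^sup>2)"
  shows "integrable (std_normal_vector d) (\<lambda>z. (chi_excess d (\<lambda>i. g i + z i) - G)\<^sup>2)"
    "(\<integral>z. (chi_excess d (\<lambda>i. g i + z i) - G)\<^sup>2 \<partial>std_normal_vector d) \<le> 4 * real d + 8 * G"
proof -
  let ?N = "std_normal_vector d"
  let ?L = "\<lambda>z. \<Sum>i<d. g i * z i"
  have eq: "chi_excess d (\<lambda>i. g i + z i) - G = chi_excess d z + 2 * ?L z" for z
    unfolding chi_excess_shift G_def by simp
  have le: "(chi_excess d z + 2 * ?L z)\<^sup>2 \<le> 2 * (chi_excess d z)\<^sup>2 + 8 * (?L z)\<^sup>2" for z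
    using sum_squares_bound[of "chi_excess d z" "2 * ?L z"] by (simp add: power2_sum power_mult_distrib)
  have int: "integrable ?N (\<lambda>z. 2 * (chi_excess d z)\<^sup>2 + 8 * (?L z)\<^sup>2)"
    using chi_excess_null_moments(1)[of d] linear_form_moments(1)[of d g] by simp
  show int': "integrable ?N (\<lambda>z. (chi_excess d (\<lambda>i. g i + z i) - G)\<^sup>2)"
  proof (rule Bochner_Integration.integrable_bound[OF int])
    show "(\<lambda>z. (chi_excess d (\<lambda>i. g i + z i) - G)\<^sup>2) \<in> borel_measurable ?N" by measurable
  qed (use le eq in \<open>auto intro!: AE_I2 order.trans[OF _ abs_ge_self]\<close>)
  have "(\<integral>z. (chi_excess d (\<lambda>i. g i + z i) - G)\<^sup>2 \<partial>?N) \<le> (\<integral>z. 2 * (chi_excess d z)\<^sup>2 + 8 * (?L z)\<^sup>2 \<partial>?N)"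
    by (rule integral_mono[OF int' int]) (use le eq in auto)
  also have "\<dots> = 4 * real d + 8 * G"
    using chi_excess_null_moments[of d] linear_form_moments[of d g] by (simp add: G_def)
  finally show "(\<integral>z. (chi_excess d (\<lambda>i. g i + z i) - G)\<^sup>2 \<partial>?N) \<le> 4 * real d + 8 * G" .
qed

text \<open>
  A single machine detects a signal of energy well above \<open>sqrt d\<close>, by Chebyshev's inequality.
\<close>

lemma chi_excess_threshold:
  fixes g :: "nat \<Rightarrow> real" and t :: real and d :: nat
  assumes d: "1 \<le> d" and t: "0 < t"
  defines "G \<equiv> (\<Sum>i<d. (g i)\<^sup>2)"
  shows "measure (std_normal_vector d) {z \<in> space (std_normal_vector d). t * sqrt d < chi_excess d z} \<le> 2 / t\<^sup>2"
    and "2 * t * sqrt d \<le> G \<Longrightarrow>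
      measure (std_normal_vector d) {z \<in> space (std_normal_vector d). \<not> t * sqrt d < chi_excess d (\<lambda>i. g i + z i)} \<le> 4 / t\<^sup>2 + 16 / t"
proof -
  let ?N = "std_normal_vector d"
  interpret N: prob_space ?N by (rule prob_space_std_normal_vector)
  have d1: "1 \<le> sqrt (real d)" using d by simp
  have "measure ?N {z \<in> space ?N. t * sqrt d < chi_excess d z} \<le> (2 * real d) / (t * sqrt d)\<^sup>2"
    by (rule N.second_moment_tail_bound[OF chi_excess_null_moments(1)]) (use d t chi_excess_null_moments(2) in auto)
  also have "\<dots> = 2 / t\<^sup>2" using d by (simp add: power_mult_distrib)
  finally show "measure ?N {z \<in> space ?N. t * sqrt d < chi_excess d z} \<le> 2 / t\<^sup>2" .
  assume G: "2 * t * sqrt d \<le> G"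
  have Gp: "0 < G" using G d1 t by (smt (verit) mult_pos_pos)
  have "measure ?N {z \<in> space ?N. \<not> t * sqrt d < chi_excess d (\<lambda>i. g i + z i)} \<le> (4 * real d + 8 * G) / (G / 2)\<^sup>2"
    by (rule N.second_moment_tail_bound[OF chi_excess_second_moment[where g=g and d=d, folded G_def]])
       (use G Gp in auto)
  also have "\<dots> = 16 * real d / G\<^sup>2 + 32 / G"
    using Gp by (simp add: field_simps power2_eq_square)
  also have "\<dots> \<le> 16 * real d / (2 * t * sqrt d)\<^sup>2 + 32 / (2 * t)"
  proof (intro add_mono divide_left_mono power_mono)
    have "2 * t * 1 \<le> 2 * t * sqrt d" using t d1 by (intro mult_left_mono) auto
    then show "2 * t \<le> G" using G by simp
  qed (use G Gp t d in auto)
  also have "\<dots> = 4 / t\<^sup>2 + 16 / t" using d t by (simp add: power_mult_distrib field_simps)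
  finally show "measure ?N {z \<in> space ?N. \<not> t * sqrt d < chi_excess d (\<lambda>i. g i + z i)} \<le> 4 / t\<^sup>2 + 16 / t" .
qed

text \<open>
  The statistic is divided by a large multiple of its null standard deviation, so that second-order
  terms of Taylor expansions are small compared with first-order ones.
\<close>

definition arctan_scale :: real where "arctan_scale = 100000"

text \<open>
  A second-order expansion of \<open>arctan\<close> around the null value of the statistic. The first-order term
  is \<open>G / s\<close> times a factor close to \<open>1\<close>, because the part linear in the noise is odd and integrates to
  zero; the second-order term is of size \<open>(G / s)\<^sup>2 + G / s\<^sup>2\<close>, which is small compared with \<open>G / s\<close>
  because \<open>s\<close> is large and \<open>G / s\<close> is at most \<open>1 / 8\<close>.
\<close>

lemma arctan_shift_small:
  fixes g :: "nat \<Rightarrow> real" and s :: real and d :: nat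
  assumes d: "1 \<le> d"
  defines "G \<equiv> (\<Sum>i<d. (g i)\<^sup>2)" and "s \<equiv> arctan_scale * sqrt (real d)"
  assumes small: "8 * G \<le> s"
  shows "G / s / 4 \<le> (\<integral>z. arctan (chi_excess d (\<lambda>i. g i + z i) / s) \<partial>std_normal_vector d)
     - (\<integral>z. arctan (chi_excess d z / s) \<partial>std_normal_vector d)"
proof -
  let ?N = "std_normal_vector d"
  let ?L = "\<lambda>z. \<Sum>i<d. g i * z i"
  interpret N: prob_space ?N by (rule prob_space_std_normal_vector)
  have d1: "1 \<le> sqrt (real d)" using d by simp
  have s: "100000 \<le> s" "s\<^sup>2 = 10000000000 * real d" unfolding s_def arctan_scale_def using d1 by (auto simp: power_mult_distrib)
  have G0: "0 \<le> G" by (simp add: G_def sum_nonneg)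
  define H where "H z = 1 / (1 + (chi_excess d z / s)\<^sup>2)" for z
  have Hpos: "0 < 1 + (chi_excess d z / s)\<^sup>2" for z by (simp add: add_pos_nonneg)
  have Hm[measurable]: "H \<in> borel_measurable ?N" unfolding H_def by measurable
  have H01: "0 \<le> H z" "H z \<le> 1" "1 - (chi_excess d z / s)\<^sup>2 \<le> H z" for z
  proof -
    show "0 \<le> H z" "H z \<le> 1" using Hpos[of z] by (simp_all add: H_def)
    have "(1 - y) * (1 + y) \<le> 1" for y :: real by (simp add: algebra_simps)
    then show "1 - (chi_excess d z / s)\<^sup>2 \<le> H z" using Hpos[of z] by (simp add: H_def le_divide_eq)
  qed
  have Hint: "integrable ?N H" by (rule integrable_bounded_std_normal_vector[where B=1]) (use H01 in \<open>auto simp: abs_le_iff intro: order.trans[of _ 0]\<close>)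
  \<comment> \<open>\<open>H\<close> is the derivative of \<open>arctan\<close> at the null statistic, an even function of the noise.\<close>
  have LH: "(\<integral>z. ?L z * H z \<partial>?N) = 0"
    by (rule integral_linear_times_even) (auto simp: H_def chi_excess_def)
  have LHint: "integrable ?N (\<lambda>z. ?L z * H z)"
  proof (rule Bochner_Integration.integrable_bound[OF linear_form_moments(3)[of d g]])
    have "\<bar>?L z * H z\<bar> \<le> \<bar>?L z\<bar> * 1" for z unfolding abs_mult using H01[of z] by (intro mult_mono) auto
    then show "AE z in ?N. norm (?L z * H z) \<le> norm (?L z)" by (auto simp: abs_mult)
  qed measurable
  have EH: "1 - 1 / 1000000 \<le> (\<integral>z. H z \<partial>?N)"
  proof -
    have i: "integrable ?N (\<lambda>z. 1 - (chi_excess d z / s)\<^sup>2)"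
      using chi_excess_null_moments(1)[of d] by (auto simp: power_divide)
    have "(\<integral>z. 1 - (chi_excess d z / s)\<^sup>2 \<partial>?N) = 1 - 2 * real d / s\<^sup>2"
      using chi_excess_null_moments[of d] N.prob_space by (simp add: power_divide)
    moreover have "2 * real d / s\<^sup>2 \<le> 1 / 1000000" using s(2) d by simp
    ultimately show ?thesis using integral_mono[OF i Hint H01(3)] by linarith
  qed
  note int_atan = integrable_arctan_std_normal_vector[of _ d]
  have pt: "arctan (chi_excess d z / s) + (G / s * H z + 2 / s * (?L z * H z)) - (2 * G\<^sup>2 / s\<^sup>2 + 8 / s\<^sup>2 * (?L z)\<^sup>2)
     \<le> arctan (chi_excess d (\<lambda>i. g i + z i) / s)" for z
  proof -
    define \<delta> where "\<delta> = (G + 2 * ?L z) / s"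
    have 1: "arctan (chi_excess d (\<lambda>i. g i + z i) / s) = arctan (chi_excess d z / s + \<delta>)"
      unfolding chi_excess_shift \<delta>_def G_def by (simp add: add_divide_distrib add.assoc)
    have 2: "\<delta> / (1 + (chi_excess d z / s)\<^sup>2) = G / s * H z + 2 / s * (?L z * H z)"
      unfolding \<delta>_def H_def by (simp add: add_divide_distrib)
    have 3: "\<delta>\<^sup>2 \<le> 2 * G\<^sup>2 / s\<^sup>2 + 8 / s\<^sup>2 * (?L z)\<^sup>2"
    proof -
      have "(G + 2 * ?L z)\<^sup>2 \<le> 2 * G\<^sup>2 + 8 * (?L z)\<^sup>2"
        using sum_squares_bound[of G "2 * ?L z"] by (simp add: power2_sum power_mult_distrib)
      then have "(G + 2 * ?L z)\<^sup>2 / s\<^sup>2 \<le> (2 * G\<^sup>2 + 8 * (?L z)\<^sup>2) / s\<^sup>2" by (rule divide_right_mono) simp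
      then show ?thesis
        unfolding \<delta>_def power_divide using add_divide_distrib[of "2 * G\<^sup>2" "8 * (?L z)\<^sup>2" "s\<^sup>2"] by simp
    qed
    have "X = Y \<Longrightarrow> D = P \<Longrightarrow> Q \<le> R \<Longrightarrow> \<bar>Y - A - D\<bar> \<le> Q \<Longrightarrow> A + P - R \<le> X" for X Y D P Q R A :: real
      by linarith
    from this[OF 1 2 3 arctan_second_order] show ?thesis .
  qed
  have "(\<integral>z. arctan (chi_excess d z / s) \<partial>?N) + (G / s * (\<integral>z. H z \<partial>?N) + 2 / s * 0) - (2 * G\<^sup>2 / s\<^sup>2 + 8 / s\<^sup>2 * G)
      = (\<integral>z. arctan (chi_excess d z / s) + (G / s * H z + 2 / s * (?L z * H z)) - (2 * G\<^sup>2 / s\<^sup>2 + 8 / s\<^sup>2 * (?L z)\<^sup>2) \<partial>?N)"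
    using int_atan[of "\<lambda>z. chi_excess d z / s"] Hint LHint linear_form_moments[of d g]
    by (simp add: LH N.prob_space G_def)
  also have "\<dots> \<le> (\<integral>z. arctan (chi_excess d (\<lambda>i. g i + z i) / s) \<partial>?N)"
  proof (intro integral_mono pt)
    show "integrable ?N (\<lambda>z. arctan (chi_excess d z / s) + (G / s * H z + 2 / s * (?L z * H z)) - (2 * G\<^sup>2 / s\<^sup>2 + 8 / s\<^sup>2 * (?L z)\<^sup>2))"
      using int_atan[of "\<lambda>z. chi_excess d z / s"] Hint LHint linear_form_moments[of d g] by simp
    show "integrable ?N (\<lambda>z. arctan (chi_excess d (\<lambda>i. g i + z i) / s))" by (rule int_atan) measurable
  qed
  finally have main: "(\<integral>z. arctan (chi_excess d z / s) \<partial>?N) + G / s * (\<integral>z. H z \<partial>?N) - (2 * G\<^sup>2 / s\<^sup>2 + 8 / s\<^sup>2 * G)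
     \<le> (\<integral>z. arctan (chi_excess d (\<lambda>i. g i + z i) / s) \<partial>?N)" by simp
  define \<gamma> where "\<gamma> = G / s"
  have \<gamma>: "0 \<le> \<gamma>" "\<gamma> \<le> 1 / 8" using G0 s small by (auto simp: \<gamma>_def field_simps)
  have "2 * G\<^sup>2 / s\<^sup>2 = 2 * \<gamma> * \<gamma>" by (simp add: \<gamma>_def power2_eq_square)
  also have "\<dots> \<le> 2 * (1 / 8) * \<gamma>" using \<gamma> by (intro mult_mono) auto
  finally have 1: "2 * G\<^sup>2 / s\<^sup>2 \<le> \<gamma> / 4" by simp
  have "8 / s\<^sup>2 * G = 8 / s * \<gamma>" by (simp add: \<gamma>_def power2_eq_square)
  also have "\<dots> \<le> 1 / 4 * \<gamma>" using \<gamma> s by (intro mult_right_mono) (auto simp: field_simps)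
  finally have 2: "8 / s\<^sup>2 * G \<le> \<gamma> / 4" by simp
  have "\<gamma> * (3 / 4) \<le> \<gamma> * (\<integral>z. H z \<partial>?N)" using \<gamma> EH by (intro mult_left_mono) auto
  then show ?thesis using main 1 2 unfolding \<gamma>_def[symmetric] by linarith
qed

text \<open>
  For large energy the statistic exceeds half its mean with high probability, while its null mean is
  of second order.
\<close>

lemma arctan_shift_large:
  fixes g :: "nat \<Rightarrow> real" and s :: real and d :: nat
  assumes d: "1 \<le> d"
  defines "G \<equiv> (\<Sum>i<d. (g i)\<^sup>2)" and "s \<equiv> arctan_scale * sqrt (real d)"
  assumes large: "s \<le> 8 * G"
  shows "1 / 40 \<le> (\<integral>z. arctan (chi_excess d (\<lambda>i. g i + z i) / s) \<partial>std_normal_vector d)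
     - (\<integral>z. arctan (chi_excess d z / s) \<partial>std_normal_vector d)"
proof -
  let ?N = "std_normal_vector d"
  interpret N: prob_space ?N by (rule prob_space_std_normal_vector)
  have d1: "1 \<le> sqrt (real d)" using d by simp
  have s: "100000 \<le> s" "s\<^sup>2 = 10000000000 * real d" unfolding s_def arctan_scale_def using d1 by (auto simp: power_mult_distrib)
  define \<gamma> where "\<gamma> = G / s"
  have \<gamma>: "1 / 8 \<le> \<gamma>" "G = \<gamma> * s" using s large by (auto simp: \<gamma>_def field_simps)
  note int_atan = integrable_arctan_std_normal_vector[of _ d]
  have null: "(\<integral>z. arctan (chi_excess d z / s) \<partial>?N) \<le> 1 / 1000"
  proof -
    have "arctan (chi_excess d z / s) \<le> chi_excess d z / s + (chi_excess d z)\<^sup>2 / s\<^sup>2" for z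
      using arctan_second_order[of 0 "chi_excess d z / s"] by (simp add: power_divide abs_le_iff)
    then have "(\<integral>z. arctan (chi_excess d z / s) \<partial>?N) \<le> (\<integral>z. chi_excess d z / s + (chi_excess d z)\<^sup>2 / s\<^sup>2 \<partial>?N)"
      using chi_excess_null_moments[of d] by (intro integral_mono int_atan) auto
    also have "\<dots> = 2 * real d / s\<^sup>2" using chi_excess_null_moments[of d] by simp
    also have "\<dots> \<le> 1 / 1000" using s(2) d by simp
    finally show ?thesis .
  qed
  let ?X = "\<lambda>z. (chi_excess d (\<lambda>i. g i + z i) - G)\<^sup>2"
  have at: "1 / 20 \<le> arctan (\<gamma> / 2)"
  proof -
    have "\<bar>arctan (1 / 16) - 1 / 16\<bar> \<le> (1 / 256 :: real)"
      using arctan_second_order[of 0 "1 / 16"] by (simp add: power2_eq_square)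
    then have "1 / 20 \<le> arctan (1 / 16 :: real)" by linarith
    also have "\<dots> \<le> arctan (\<gamma> / 2)" using \<gamma> by (intro arctan_monotone') auto
    finally show ?thesis .
  qed
  \<comment> \<open>If the statistic is below half its mean, the left-hand side drops below \<open>- pi / 2\<close>.\<close>
  have pt: "1 / 20 - 16 / G\<^sup>2 * ?X z \<le> arctan (chi_excess d (\<lambda>i. g i + z i) / s)" for z
  proof (cases "G / 2 \<le> chi_excess d (\<lambda>i. g i + z i)")
    case True
    have "(G / 2) / s \<le> chi_excess d (\<lambda>i. g i + z i) / s"
      using True s by (intro divide_right_mono) auto
    then have "arctan (\<gamma> / 2) \<le> arctan (chi_excess d (\<lambda>i. g i + z i) / s)"
      by (intro arctan_monotone') (simp add: \<gamma>_def)
    moreover have "0 \<le> 16 / G\<^sup>2 * ?X z" by simp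
    ultimately show ?thesis using at by linarith
  next
    case False
    have Gp: "0 < G" using \<gamma> s by simp
    have "(G / 2)\<^sup>2 \<le> (G - chi_excess d (\<lambda>i. g i + z i))\<^sup>2" using False Gp by (intro power_mono) auto
    then have "(G / 2)\<^sup>2 \<le> ?X z" by (simp add: power2_commute)
    then have "4 \<le> 16 / G\<^sup>2 * ?X z" using Gp by (simp add: field_simps power2_eq_square)
    then show ?thesis using arctan_bounded[of "chi_excess d (\<lambda>i. g i + z i) / s"] pi_less_4 by linarith
  qed
  have "1 / 20 - 16 / G\<^sup>2 * (4 * real d + 8 * G) \<le> 1 / 20 - 16 / G\<^sup>2 * (\<integral>z. ?X z \<partial>?N)"
    using chi_excess_second_moment(2)[of d g, folded G_def] by (intro diff_left_mono mult_left_mono) auto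
  also have "\<dots> = (\<integral>z. 1 / 20 - 16 / G\<^sup>2 * ?X z \<partial>?N)"
    using chi_excess_second_moment(1)[of d g, folded G_def] by (simp add: N.prob_space)
  also have "\<dots> \<le> (\<integral>z. arctan (chi_excess d (\<lambda>i. g i + z i) / s) \<partial>?N)"
    using chi_excess_second_moment(1)[of d g, folded G_def] by (intro integral_mono pt int_atan) auto
  finally have main: "1 / 20 - 16 / G\<^sup>2 * (4 * real d + 8 * G) \<le> (\<integral>z. arctan (chi_excess d (\<lambda>i. g i + z i) / s) \<partial>?N)" .
  have G8: "12500 * sqrt d \<le> G" using large unfolding s_def arctan_scale_def by simp
  then have G8': "12500 \<le> G" using d1 by linarith
  have "(12500 * sqrt d)\<^sup>2 \<le> G\<^sup>2" using G8 by (intro power_mono) auto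
  then have "156250000 * real d \<le> G\<^sup>2" by (simp add: power_mult_distrib)
  then have "64 * real d / G\<^sup>2 \<le> 1 / 1000" using G8' by (simp add: field_simps)
  moreover have "128 / G \<le> 11 / 1000" using G8' by (simp add: field_simps)
  moreover have "16 / G\<^sup>2 * (4 * real d + 8 * G) = 64 * real d / G\<^sup>2 + 128 / G"
    using G8' by (simp add: field_simps power2_eq_square)
  ultimately show ?thesis using main null by linarith
qed

text \<open>
  The bit sent by a machine moves by the order of \<open>G / sqrt d\<close> for weak signals and by a constant for
  strong ones. One machine cannot decide on its own, but the sum over many machines can.
\<close>

lemma arctan_shift:
  fixes g :: "nat \<Rightarrow> real" and s :: real and d :: nat
  assumes d: "1 \<le> d"
  defines "G \<equiv> (\<Sum>i<d. (g i)\<^sup>2)" and "s \<equiv> arctan_scale * sqrt (real d)"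
  shows "min 1 (G / sqrt d) / 400000 \<le> (\<integral>z. arctan (chi_excess d (\<lambda>i. g i + z i) / s) \<partial>std_normal_vector d)
     - (\<integral>z. arctan (chi_excess d z / s) \<partial>std_normal_vector d)"
proof (cases "8 * G \<le> s")
  case True
  have "min 1 (G / sqrt d) / 400000 \<le> G / sqrt d / 400000" by simp
  also have "\<dots> = G / s / 4" by (simp add: s_def arctan_scale_def)
  finally show ?thesis using arctan_shift_small[OF d True[unfolded G_def s_def]] unfolding s_def G_def by linarith
next
  case False
  then have "s \<le> 8 * G" by simp
  then have "1 / 40 \<le> (\<integral>z. arctan (chi_excess d (\<lambda>i. g i + z i) / s) \<partial>std_normal_vector d)
     - (\<integral>z. arctan (chi_excess d z / s) \<partial>std_normal_vector d)"
    unfolding s_def G_def by (intro arctan_shift_large d)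
  then show ?thesis by (simp add: min_def split: if_splits)
qed

section \<open>Tests based on the transcripts\<close>

abbreviation (input) noise_level :: "nat \<Rightarrow> nat \<Rightarrow> real" where
  "noise_level n m \<equiv> sqrt (real m / real n)"

lemma scaled_shift_noise:
  assumes "0 < \<sigma>" "i < d"
  shows "shift_noise d \<sigma> f z i / \<sigma> = f i / \<sigma> + z i"
  using assms by (simp add: shift_noise_def add_divide_distrib)

lemma scaled_component_measurable[measurable]:
  "i < d \<Longrightarrow> (\<lambda>x. x i / \<sigma>) \<in> borel_measurable (Rn d)"
  unfolding Rn_def by measurable

definition sin_bits :: "nat \<Rightarrow> real \<Rightarrow> (nat \<Rightarrow> nat \<Rightarrow> real) \<Rightarrow> (nat \<Rightarrow> real) \<Rightarrow> nat \<Rightarrow> real" where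
  "sin_bits d \<sigma> a x k = sin (\<Sum>i<d. a k i * (x i / \<sigma>))"

text \<open>
  An upper bound, free of the signal, for the sum of the squared Frobenius norms of the covariance
  matrices of the transcripts.
\<close>

definition gram_bound :: "nat \<Rightarrow> nat \<Rightarrow> nat \<Rightarrow> (nat \<Rightarrow> nat \<Rightarrow> nat \<Rightarrow> real) \<Rightarrow> real" where
  "gram_bound d T b a = (\<Sum>t<T. \<Sum>k<b. \<Sum>l<b. if k = l then 1 else (\<Sum>i<d. a t k i * a t l i)\<^sup>2)"

text \<open>
  The sum of the squared means of all reported signs.
\<close>

definition signal :: "nat \<Rightarrow> nat \<Rightarrow> nat \<Rightarrow> (nat \<Rightarrow> nat \<Rightarrow> nat \<Rightarrow> real) \<Rightarrow> (nat \<Rightarrow> real) \<Rightarrow> real" where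
  "signal d T b a g = (\<Sum>t<T. \<Sum>k<b. exp (- (\<Sum>i<d. (a t k i)\<^sup>2)) * (sin (\<Sum>i<d. a t k i * g i))\<^sup>2)"

lemma sin_bits_shift:
  assumes "0 < \<sigma>"
  shows "sin_bits d \<sigma> a (shift_noise d \<sigma> f z) k = sin ((\<Sum>i<d. a k i * (f i / \<sigma>)) + (\<Sum>i<d. a k i * z i))"
  unfolding sin_bits_def
  by (simp add: scaled_shift_noise[OF assms] distrib_left sum.distrib)

lemma gram_bound_nonneg: "0 \<le> gram_bound d T b a"
  unfolding gram_bound_def by (intro sum_nonneg) auto

lemma signal_nonneg: "0 \<le> signal d T b a g"
  unfolding signal_def by (intro sum_nonneg) auto

lemma two_half_stat_sin_second_moment:
  fixes n m d b T q :: nat and f :: "nat \<Rightarrow> real"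
  assumes nm: "1 \<le> n" "1 \<le> m"
    and s: "\<And>j r. (\<lambda>x. s j x r) \<in> borel_measurable (Rn d)" "\<And>j x r. \<bar>s j x r\<bar> \<le> 1"
    and m: "2 * (T * q) \<le> m"
    and sin: "\<And>j. j < 2 * (T * q) \<Longrightarrow> s j = sin_bits d (noise_level n m) (a (j mod T))"
  defines "F \<equiv> gram_bound d T b a"
    and "S \<equiv> signal d T b a (\<lambda>i. f i / noise_level n m)"
  shows "(\<integral>y. (two_half_stat T q b y - (real q)\<^sup>2 * S)\<^sup>2 \<partial>transcript_law n m d b s f)
     \<le> 6 * real q ^ 3 * sqrt F * S + 3 * (real q)\<^sup>2 * F"
proof -
  let ?N = "std_normal_vector d"
  let ?\<sigma> = "noise_level n m"
  let ?g = "\<lambda>i. f i / ?\<sigma>"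
  have \<sigma>: "0 < ?\<sigma>" using nm by simp
  define \<psi> where "\<psi> = (\<lambda>t z. sin_bits d ?\<sigma> (a t) (shift_noise d ?\<sigma> f z))"
  have \<psi>: "\<psi> t z k = sin ((\<Sum>i<d. a t k i * ?g i) + (\<Sum>i<d. a t k i * z i))" for t z k
    unfolding \<psi>_def by (rule sin_bits_shift[OF \<sigma>])
  have mean: "(\<integral>z. \<psi> t z k \<partial>?N) = exp (- (\<Sum>i<d. (a t k i)\<^sup>2) / 2) * sin (\<Sum>i<d. a t k i * ?g i)" for t k
    unfolding \<psi> by (rule integral_cos_std_normal_vector)
  have cov: "(bit_cov ?N (\<psi> t) k l)\<^sup>2 \<le> (if k = l then 1 else (\<Sum>i<d. a t k i * a t l i)\<^sup>2)" for t k l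
  proof (cases "k = l")
    case True
    have "\<bar>\<integral>z. \<psi> t z k \<partial>?N\<bar> \<le> 1"
      unfolding mean abs_mult by (intro mult_le_one) (auto simp: sum_nonneg)
    then have "0 \<le> bit_cov ?N (\<psi> t) k l" "bit_cov ?N (\<psi> t) k l \<le> 1"
      using True by (auto simp: bit_cov_def abs_square_le_1 power2_eq_square[symmetric])
    then show ?thesis using True by (simp add: power_le_one)
  next
    case False
    have "\<bar>bit_cov ?N (\<psi> t) k l\<bar> \<le> \<bar>\<Sum>i<d. a t k i * a t l i\<bar>"
      using False sin_covariance_bound[of d "\<Sum>i<d. a t k i * ?g i" "a t k" "\<Sum>i<d. a t l i * ?g i" "a t l"]
      by (simp add: bit_cov_def \<psi>)
    then show ?thesis using False by (simp add: abs_le_square_iff)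
  qed
  have FF: "(\<Sum>t<T. \<Sum>k<b. \<Sum>l<b. (bit_cov ?N (\<psi> t) k l)\<^sup>2) \<le> F"
    unfolding F_def gram_bound_def by (intro sum_mono cov)
  have SS: "(\<Sum>r\<in>{..<T} \<times> {..<b}. ((\<lambda>(t, k). \<integral>z. \<psi> t z k \<partial>?N) r)\<^sup>2) = S"
  proof -
    have "(exp (- A / 2) * sin B)\<^sup>2 = exp (- A) * (sin B)\<^sup>2" for A B :: real
      by (simp add: power_mult_distrib exp_double[symmetric])
    then show ?thesis by (simp add: sum.cartesian_product' mean S_def signal_def)
  qed
  have "(\<integral>y. (two_half_stat T q b y - (real q)\<^sup>2 * S)\<^sup>2 \<partial>transcript_law n m d b s f)
     \<le> 6 * real q ^ 3 * sqrt (\<Sum>t<T. \<Sum>k<b. \<Sum>l<b. (bit_cov ?N (\<psi> t) k l)\<^sup>2) * S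
       + 3 * (real q)\<^sup>2 * (\<Sum>t<T. \<Sum>k<b. \<Sum>l<b. (bit_cov ?N (\<psi> t) k l)\<^sup>2)"
    using two_half_stat_second_moment[where s=s and \<phi>="\<lambda>t. sin_bits d ?\<sigma> (a t)" and n=n and f=f and b=b, OF s m sin]
    unfolding SS[symmetric] \<psi>_def by simp
  also have "\<dots> \<le> 6 * real q ^ 3 * sqrt F * S + 3 * (real q)\<^sup>2 * F"
    using FF by (intro add_mono mult_left_mono mult_right_mono) (auto simp: S_def signal_nonneg)
  finally show ?thesis .
qed

text \<open>
  The threshold is \<open>L\<close> null standard deviations of the statistic, up to a factor depending on \<open>K\<close>. The signal is detected once its mean
  is twice the threshold. The number \<open>15\<close> collects the numerical factors of the two terms of the variance
  bound.
\<close>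

lemma sin_test:
  fixes n m d b T q :: nat and K L :: real and f :: "nat \<Rightarrow> real"
  assumes nm: "1 \<le> n" "1 \<le> m"
    and s: "\<And>j r. (\<lambda>x. s j x r) \<in> borel_measurable (Rn d)" "\<And>j x r. \<bar>s j x r\<bar> \<le> 1"
    and m: "2 * (T * q) \<le> m"
    and sin: "\<And>j. j < 2 * (T * q) \<Longrightarrow> s j = sin_bits d (noise_level n m) (a (j mod T))"
    and pos: "1 \<le> q" "1 \<le> T" "1 \<le> b" "1 \<le> K" "1 \<le> L"
    and F: "gram_bound d T b a \<le> K * real (T * b)"
  defines "\<tau> \<equiv> L * real q * sqrt (real (T * b))"
  shows "measure (transcript_law n m d b s (\<lambda>i\<in>{..<d}. 0)) {y \<in> \<Pi>\<^sub>E j\<in>{..<m}. {..<2 ^ b}. \<tau> < two_half_stat T q b y} \<le> 15 * K / L"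
    and "2 * L * sqrt (real (T * b)) \<le> real q * signal d T b a (\<lambda>i. f i / noise_level n m) \<Longrightarrow>
      measure (transcript_law n m d b s f) {y \<in> \<Pi>\<^sub>E j\<in>{..<m}. {..<2 ^ b}. \<not> \<tau> < two_half_stat T q b y} \<le> 15 * K / L"
proof -
  let ?F = "gram_bound d T b a"
  let ?D = "real (T * b)"
  have D: "1 \<le> ?D" using pos by (metis mult_le_mono nat_mult_1 of_nat_1 of_nat_mono)
  then have sD: "0 < sqrt ?D" by simp
  have \<tau>: "0 < \<tau>" using pos D unfolding \<tau>_def by (intro mult_pos_pos) auto
  have K1: "K / L\<^sup>2 \<le> K / L"
    using pos by (intro divide_left_mono) (auto simp: power2_eq_square)
  note moment = two_half_stat_sin_second_moment[where a=a and s=s and b=b and T=T and q=q, OF nm s m sin]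
  note int = integrable_transcript_law[where s=s, OF s]
  have nullS: "signal d T b a (\<lambda>i. (\<lambda>i\<in>{..<d}. 0) i / noise_level n m) = 0"
  proof -
    have "(\<Sum>i<d. a t k i * ((\<lambda>i\<in>{..<d}. 0 :: real) i / noise_level n m)) = 0" for t k
      by (intro sum.neutral) simp
    then show ?thesis by (simp add: signal_def)
  qed
  show "measure (transcript_law n m d b s (\<lambda>i\<in>{..<d}. 0)) {y \<in> \<Pi>\<^sub>E j\<in>{..<m}. {..<2 ^ b}. \<tau> < two_half_stat T q b y} \<le> 15 * K / L"
  proof -
    let ?P = "transcript_law n m d b s (\<lambda>i\<in>{..<d}. 0)"
    interpret P: prob_space ?P by (rule prob_space_transcript_law[OF s])
    have "measure ?P {y \<in> \<Pi>\<^sub>E j\<in>{..<m}. {..<2 ^ b}. \<tau> < two_half_stat T q b y} \<le> (3 * (real q)\<^sup>2 * ?F) / \<tau>\<^sup>2"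
      by (rule P.second_moment_tail_bound[OF int, of "two_half_stat T q b"])
         (use moment[of "\<lambda>i\<in>{..<d}. 0"] nullS \<tau> in auto)
    also have "\<dots> \<le> (3 * (real q)\<^sup>2 * (K * ?D)) / \<tau>\<^sup>2"
      using F by (intro divide_right_mono mult_left_mono) auto
    also have "\<dots> = 3 * (K / L\<^sup>2)"
      using pos D unfolding \<tau>_def by (simp add: power_mult_distrib)
    also have "\<dots> \<le> 15 * K / L" using K1 pos by (simp add: field_simps)
    finally show ?thesis .
  qed
  let ?S = "signal d T b a (\<lambda>i. f i / noise_level n m)"
  assume S: "2 * L * sqrt ?D \<le> real q * ?S"
  show "measure (transcript_law n m d b s f) {y \<in> \<Pi>\<^sub>E j\<in>{..<m}. {..<2 ^ b}. \<not> \<tau> < two_half_stat T q b y} \<le> 15 * K / L"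
  proof -
    let ?P = "transcript_law n m d b s f"
    interpret P: prob_space ?P by (rule prob_space_transcript_law[OF s])
    have LD: "0 < 2 * L * sqrt ?D" using pos sD by simp
    have Sp: "0 < ?S" using S LD by (smt (verit) mult_nonneg_nonpos of_nat_0_le_iff)
    have q0: "0 < real q" using pos by simp
    have \<tau>S: "2 * \<tau> \<le> (real q)\<^sup>2 * ?S"
    proof -
      have "real q * (2 * L * sqrt ?D) \<le> real q * (real q * ?S)" using S by (intro mult_left_mono) auto
      then show ?thesis by (simp add: \<tau>_def power2_eq_square algebra_simps)
    qed
    have "measure ?P {y \<in> \<Pi>\<^sub>E j\<in>{..<m}. {..<2 ^ b}. \<not> \<tau> < two_half_stat T q b y}
        \<le> (6 * real q ^ 3 * sqrt ?F * ?S + 3 * (real q)\<^sup>2 * ?F) / ((real q)\<^sup>2 * ?S / 2)\<^sup>2"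
    proof (rule P.second_moment_tail_bound[OF int moment])
      show "0 < (real q)\<^sup>2 * ?S / 2" using Sp q0 by simp
      fix y assume "y \<in> {y \<in> \<Pi>\<^sub>E j\<in>{..<m}. {..<2 ^ b}. \<not> \<tau> < two_half_stat T q b y}"
      then have "two_half_stat T q b y \<le> \<tau>" by simp
      moreover have "a \<le> u \<Longrightarrow> 2 * u \<le> v \<Longrightarrow> v / 2 \<le> \<bar>a - v\<bar>" for a u v :: real by linarith
      ultimately show "(real q)\<^sup>2 * ?S / 2 \<le> \<bar>two_half_stat T q b y - (real q)\<^sup>2 * ?S\<bar>" using \<tau>S by metis
    qed
    also have "\<dots> = 24 * (sqrt ?F / (real q * ?S)) + 12 * (?F / (real q * ?S)\<^sup>2)"
      using Sp q0 by (simp add: field_simps power2_eq_square power3_eq_cube)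
    also have "\<dots> \<le> 24 * ((K * sqrt ?D) / (2 * L * sqrt ?D)) + 12 * ((K * ?D) / (2 * L * sqrt ?D)\<^sup>2)"
    proof (intro add_mono mult_left_mono frac_le)
      have "sqrt ?F \<le> sqrt (K * ?D)" using F by simp
      also have "\<dots> = sqrt K * sqrt ?D" by (simp add: real_sqrt_mult)
      also have "\<dots> \<le> K * sqrt ?D"
      proof (intro mult_right_mono)
        have "K * 1 \<le> K * K" using pos by (intro mult_left_mono) auto
        then show "sqrt K \<le> K" using pos by (intro real_le_lsqrt) (auto simp: power2_eq_square)
      qed (use sD in simp)
      finally show "sqrt ?F \<le> K * sqrt ?D" .
      show "(2 * L * sqrt ?D)\<^sup>2 \<le> (real q * ?S)\<^sup>2" using S LD by (intro power_mono) auto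
      show "0 < 2 * L * sqrt ?D" by (rule LD)
      then show "0 < (2 * L * sqrt ?D)\<^sup>2" by (rule zero_less_power)
    qed (use S LD F pos D in auto)
    also have "\<dots> = 12 * (K / L) + 3 * (K / L\<^sup>2)"
      using pos sD D by (simp add: power_mult_distrib field_simps)
    also have "\<dots> \<le> 15 * K / L" using K1 by simp
    finally show ?thesis .
  qed
qed

definition arctan_bit :: "nat \<Rightarrow> real \<Rightarrow> (nat \<Rightarrow> real) \<Rightarrow> nat \<Rightarrow> real" where
  "arctan_bit d \<sigma> x k = (if k = 0 then 2 / pi * arctan (chi_excess d (\<lambda>i. x i / \<sigma>) / (arctan_scale * sqrt (real d))) else 0)"

definition threshold_bit :: "nat \<Rightarrow> real \<Rightarrow> real \<Rightarrow> (nat \<Rightarrow> real) \<Rightarrow> nat \<Rightarrow> real" where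
  "threshold_bit d \<sigma> t x k = (if k = 0 then (if t * sqrt (real d) < chi_excess d (\<lambda>i. x i / \<sigma>) then 1 else - 1) else 0)"

lemma chi_excess_scaled_measurable[measurable]:
  "(\<lambda>x. chi_excess d (\<lambda>i. x i / \<sigma>)) \<in> borel_measurable (Rn d)"
  unfolding chi_excess_def by measurable

lemma sin_bits_measurable: "(\<lambda>x. sin_bits d \<sigma> a x k) \<in> borel_measurable (Rn d)"
  unfolding sin_bits_def by measurable

lemma arctan_bit_measurable: "(\<lambda>x. arctan_bit d \<sigma> x k) \<in> borel_measurable (Rn d)"
  unfolding arctan_bit_def using borel_measurable_arctan by measurable

lemma threshold_bit_measurable: "(\<lambda>x. threshold_bit d \<sigma> t x k) \<in> borel_measurable (Rn d)"
  unfolding threshold_bit_def by measurable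

lemma abs_sin_bits_le: "\<bar>sin_bits d \<sigma> a x k\<bar> \<le> 1"
  by (simp add: sin_bits_def)

lemma abs_arctan_bit_le: "\<bar>arctan_bit d \<sigma> x k\<bar> \<le> 1"
proof -
  have "\<bar>arctan y\<bar> \<le> pi / 2" for y using arctan_bounded[of y] by linarith
  then have "2 / pi * \<bar>arctan y\<bar> \<le> 2 / pi * (pi / 2)" for y by (intro mult_left_mono) auto
  then show ?thesis by (simp add: arctan_bit_def abs_mult)
qed

lemma abs_threshold_bit_le: "\<bar>threshold_bit d \<sigma> t x k\<bar> \<le> 1"
  by (simp add: threshold_bit_def)

lemma chi_excess_shift_noise:
  assumes "0 < \<sigma>"
  shows "chi_excess d (\<lambda>i. shift_noise d \<sigma> f z i / \<sigma>) = chi_excess d (\<lambda>i. f i / \<sigma> + z i)"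
  unfolding chi_excess_def by (simp add: scaled_shift_noise[OF assms])

definition arctan_null_mean :: "nat \<Rightarrow> real" where
  "arctan_null_mean d = (\<integral>z. 2 / pi * arctan (chi_excess d z / (arctan_scale * sqrt (real d))) \<partial>std_normal_vector d)"

text \<open>
  The sum of \<open>M\<close> signs has variance at most \<open>M\<close>, and its mean moves by \<open>M\<close> times the shift of a single
  sign. The factor \<open>2000000\<close> is twice the reciprocal of a lower bound \<open>1 / 1000000\<close> for that shift
  relative to \<open>min 1 (G / sqrt d)\<close>.
\<close>

lemma arctan_test:
  fixes n m d b j0 :: nat and L :: real and f :: "nat \<Rightarrow> real"
  assumes nm: "1 \<le> n" "1 \<le> m" "1 \<le> d" "1 \<le> b" "j0 < m"
    and s: "\<And>j r. (\<lambda>x. s j x r) \<in> borel_measurable (Rn d)" "\<And>j x r. \<bar>s j x r\<bar> \<le> 1"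
    and atan: "\<And>j. j0 \<le> j \<Longrightarrow> j < m \<Longrightarrow> s j = arctan_bit d (noise_level n m)"
    and L: "0 < L"
  defines "rej \<equiv> \<lambda>y. real (m - j0) * arctan_null_mean d + L * sqrt (real (m - j0)) < (\<Sum>j\<in>{j0..<m}. bit_sign (y j) 0)"
    and "G \<equiv> (\<Sum>i<d. (f i / noise_level n m)\<^sup>2)"
  shows "measure (transcript_law n m d b s (\<lambda>i\<in>{..<d}. 0)) {y \<in> \<Pi>\<^sub>E j\<in>{..<m}. {..<2 ^ b}. rej y} \<le> 1 / L\<^sup>2"
    and "2000000 * L \<le> sqrt (real (m - j0)) * min 1 (G / sqrt d) \<Longrightarrow>
      measure (transcript_law n m d b s f) {y \<in> \<Pi>\<^sub>E j\<in>{..<m}. {..<2 ^ b}. \<not> rej y} \<le> 1 / L\<^sup>2"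
proof -
  let ?N = "std_normal_vector d" and ?\<sigma> = "noise_level n m"
  let ?M = "real (m - j0)"
  let ?J = "{j0..<m}"
  have \<sigma>: "0 < ?\<sigma>" using nm by simp
  have M: "1 \<le> ?M" using nm by simp
  note N = prob_space_std_normal_vector
  define p where "p f = (\<integral>z. 2 / pi * arctan (chi_excess d (\<lambda>i. f i / ?\<sigma> + z i) / (arctan_scale * sqrt (real d))) \<partial>?N)" for f
  have moment: "(\<integral>y. ((\<Sum>j\<in>?J. bit_sign (y j) 0) - ?M * p f)\<^sup>2 \<partial>transcript_law n m d b s f) \<le> ?M" for f
  proof -
    let ?Q = "\<lambda>j. mixed_bits_law ?N b (\<lambda>z. s j (shift_noise d ?\<sigma> f z))"
    have Qp: "prob_space (?Q j)" for j by (rule prob_mixed_shift[OF s])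
    have intQ: "integrable (?Q j) g" for j and g :: "_ \<Rightarrow> real"
      by (rule integrable_finite_discrete) (auto simp: Qp)
    have sm: "(\<lambda>z. s j (shift_noise d ?\<sigma> f z) r) \<in> borel_measurable ?N" for j r
      by (rule measurable_compose[OF shift_noise_measurable s(1)])
    have mean: "(\<integral>z. s j (shift_noise d ?\<sigma> f z) 0 \<partial>?N) = p f" if "j \<in> ?J" for j
      using that by (simp add: atan arctan_bit_def p_def chi_excess_shift_noise[OF \<sigma>])
    have c: "(\<integral>v. bit_sign v 0 - p f \<partial>?Q j) = 0"
      "(\<integral>v. (bit_sign v 0 - p f) * (bit_sign v 0 - p f) \<partial>?Q j) = bit_cov ?N (\<lambda>z. s j (shift_noise d ?\<sigma> f z)) 0 0"
      if "j \<in> ?J" for j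
      using integral_centred_bits[where s="\<lambda>z. s j (shift_noise d ?\<sigma> f z)" and k=0 and l=0 and b=b, OF N sm s(2)] nm mean[OF that] by auto
    have eq: "(\<Sum>j\<in>?J. bit_sign (y j) 0) - ?M * p f = (\<Sum>j\<in>?J. bit_sign (y j) 0 - p f)" for y
      by (simp add: sum_subtractf)
    have "(\<integral>y. ((\<Sum>j\<in>?J. bit_sign (y j) 0) - ?M * p f)\<^sup>2 \<partial>transcript_law n m d b s f)
        = (\<Sum>j\<in>?J. bit_cov ?N (\<lambda>z. s j (shift_noise d ?\<sigma> f z)) 0 0)"
    proof -
      have "(\<integral>y. (\<Sum>j\<in>?J. bit_sign (y j) 0 - p f) * (\<Sum>j\<in>?J. bit_sign (y j) 0 - p f) \<partial>PiM {..<m} ?Q)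
        = (\<Sum>j\<in>?J. \<integral>v. (bit_sign v 0 - p f) * (bit_sign v 0 - p f) \<partial>?Q j)"
        using c(1) by (intro PiM_covariance_sum Qp intQ) auto
      then show ?thesis unfolding eq transcript_law_def power2_eq_square[of "sum _ _"] using c(2) by simp
    qed
    also have "\<dots> \<le> (\<Sum>j\<in>?J. 1)" by (intro sum_mono) (simp add: bit_cov_def)
    also have "\<dots> = ?M" by simp
    finally show ?thesis .
  qed
  have p0: "p (\<lambda>i\<in>{..<d}. 0) = arctan_null_mean d"
  proof -
    have "chi_excess d (\<lambda>i. (\<lambda>i\<in>{..<d}. 0) i / ?\<sigma> + z i) = chi_excess d z" for z
      by (simp add: chi_excess_def)
    then show ?thesis by (simp add: p_def arctan_null_mean_def)
  qed
  note int = integrable_transcript_law[where s=s, OF s]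
  have \<tau>: "0 < L * sqrt ?M" using L M by simp
  have V: "?M / (L * sqrt ?M)\<^sup>2 = 1 / L\<^sup>2" using M L by (simp add: power_mult_distrib)
  interpret P0: prob_space "transcript_law n m d b s (\<lambda>i\<in>{..<d}. 0)" by (rule prob_space_transcript_law[OF s])
  show "measure (transcript_law n m d b s (\<lambda>i\<in>{..<d}. 0)) {y \<in> \<Pi>\<^sub>E j\<in>{..<m}. {..<2 ^ b}. rej y} \<le> 1 / L\<^sup>2"
    unfolding V[symmetric]
  proof (rule P0.second_moment_tail_bound[OF int moment \<tau>])
    fix y assume "y \<in> {y \<in> \<Pi>\<^sub>E j\<in>{..<m}. {..<2 ^ b}. rej y}"
    then have "?M * arctan_null_mean d + L * sqrt ?M < (\<Sum>j\<in>?J. bit_sign (y j) 0)"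
      unfolding rej_def by (elim CollectE conjE)
    then show "L * sqrt ?M \<le> \<bar>(\<Sum>j\<in>?J. bit_sign (y j) 0) - ?M * p (\<lambda>i\<in>{..<d}. 0)\<bar>"
      unfolding p0 by argo
  qed
  assume sep: "2000000 * L \<le> sqrt ?M * min 1 (G / sqrt d)"
  interpret P: prob_space "transcript_law n m d b s f" by (rule prob_space_transcript_law[OF s])
  have "min 1 (G / sqrt d) / 1000000 \<le> p f - p (\<lambda>i\<in>{..<d}. 0)"
  proof -
    have G0: "0 \<le> min 1 (G / sqrt d)" by (auto simp: G_def intro!: divide_nonneg_nonneg sum_nonneg)
    have "2 / 4 \<le> 2 / pi" using pi_less_4 pi_gt_zero by (intro divide_left_mono) auto
    then have pi: "1 / 1000000 \<le> 2 / pi / 400000" by simp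
    have "min 1 (G / sqrt d) / 1000000 \<le> 2 / pi * (min 1 (G / sqrt d) / 400000)"
      using mult_left_mono[OF pi G0] by simp
    also have "\<dots> \<le> 2 / pi * ((\<integral>z. arctan (chi_excess d (\<lambda>i. f i / ?\<sigma> + z i) / (arctan_scale * sqrt (real d))) \<partial>?N)
       - (\<integral>z. arctan (chi_excess d z / (arctan_scale * sqrt (real d))) \<partial>?N))"
      using arctan_shift[OF nm(3), of "\<lambda>i. f i / ?\<sigma>"] by (intro mult_left_mono) (auto simp: G_def)
    also have "\<dots> = p f - p (\<lambda>i\<in>{..<d}. 0)"
      unfolding p0 unfolding p_def arctan_null_mean_def by (simp add: right_diff_distrib)
    finally show ?thesis .
  qed
  then have "?M * (min 1 (G / sqrt d) / 1000000) \<le> ?M * (p f - arctan_null_mean d)"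
    using M unfolding p0 by (intro mult_left_mono) auto
  moreover have "2 * (L * sqrt ?M) \<le> ?M * (min 1 (G / sqrt d) / 1000000)"
  proof -
    have "2 * (L * sqrt ?M) = sqrt ?M * (2000000 * L) / 1000000" by simp
    also have "\<dots> \<le> sqrt ?M * (sqrt ?M * min 1 (G / sqrt d)) / 1000000"
      using sep by (intro divide_right_mono mult_left_mono) auto
    also have "\<dots> = ?M * (min 1 (G / sqrt d) / 1000000)" using M by simp
    finally show ?thesis .
  qed
  ultimately have gap: "2 * (L * sqrt ?M) \<le> ?M * p f - ?M * arctan_null_mean d"
    unfolding right_diff_distrib by (rule order.trans[rotated])
  show "measure (transcript_law n m d b s f) {y \<in> \<Pi>\<^sub>E j\<in>{..<m}. {..<2 ^ b}. \<not> rej y} \<le> 1 / L\<^sup>2"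
    unfolding V[symmetric]
  proof (rule P.second_moment_tail_bound[OF int moment \<tau>])
    fix y assume "y \<in> {y \<in> \<Pi>\<^sub>E j\<in>{..<m}. {..<2 ^ b}. \<not> rej y}"
    then have "\<not> (?M * arctan_null_mean d + L * sqrt ?M < (\<Sum>j\<in>?J. bit_sign (y j) 0))"
      unfolding rej_def by (elim CollectE conjE)
    then show "L * sqrt ?M \<le> \<bar>(\<Sum>j\<in>?J. bit_sign (y j) 0) - ?M * p f\<bar>"
      using gap by argo
  qed
qed

lemma threshold_test:
  fixes n m d b :: nat and t :: real and f :: "nat \<Rightarrow> real"
  assumes nm: "1 \<le> n" "1 \<le> m" "1 \<le> d" "1 \<le> b"
    and s: "\<And>j r. (\<lambda>x. s j x r) \<in> borel_measurable (Rn d)" "\<And>j x r. \<bar>s j x r\<bar> \<le> 1"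
    and s0: "s 0 = threshold_bit d (noise_level n m) t"
    and t: "0 < t"
  defines "G \<equiv> (\<Sum>i<d. (f i / noise_level n m)\<^sup>2)"
  shows "measure (transcript_law n m d b s (\<lambda>i\<in>{..<d}. 0)) {y \<in> \<Pi>\<^sub>E j\<in>{..<m}. {..<2 ^ b}. bit (y 0) 0} \<le> 2 / t\<^sup>2"
    and "2 * t * sqrt d \<le> G \<Longrightarrow>
      measure (transcript_law n m d b s f) {y \<in> \<Pi>\<^sub>E j\<in>{..<m}. {..<2 ^ b}. \<not> bit (y 0) 0} \<le> 4 / t\<^sup>2 + 16 / t"
proof -
  let ?N = "std_normal_vector d" and ?\<sigma> = "noise_level n m"
  have \<sigma>: "0 < ?\<sigma>" using nm by simp
  interpret N: prob_space ?N by (rule prob_space_std_normal_vector)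
  have *: "measure (transcript_law n m d b s f) {y \<in> \<Pi>\<^sub>E j\<in>{..<m}. {..<2 ^ b}. bit (y 0) 0 = v}
      = measure ?N {z \<in> space ?N. (t * sqrt d < chi_excess d (\<lambda>i. f i / ?\<sigma> + z i)) = v}" for f v
  proof -
    let ?Q = "\<lambda>j. mixed_bits_law ?N b (\<lambda>z. s j (shift_noise d ?\<sigma> f z))"
    let ?L = "transcript_law n m d b s f"
    let ?A = "{z \<in> space ?N. (t * sqrt d < chi_excess d (\<lambda>i. f i / ?\<sigma> + z i)) = v}"
    let ?w = "if v then 1 else - 1 :: real"
    interpret L: prob_space ?L by (rule prob_space_transcript_law[OF s])
    have Qp: "prob_space (?Q j)" for j by (rule prob_mixed_shift[OF s])
    interpret Q: prob_space "?Q 0" by (rule Qp)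
    have Q1: "measure (?Q 0) {..<2 ^ b} = 1" using Q.prob_space by simp
    have intQ: "integrable (?Q j) g" for j and g :: "_ \<Rightarrow> real"
      by (rule integrable_finite_discrete) (auto simp: Qp)
    have sm: "(\<lambda>z. s j (shift_noise d ?\<sigma> f z) r) \<in> borel_measurable ?N" for j r
      by (rule measurable_compose[OF shift_noise_measurable s(1)])
    have A: "?A \<in> sets ?N" by measurable
    have "measure ?L {y \<in> \<Pi>\<^sub>E j\<in>{..<m}. {..<2 ^ b}. bit (y 0) 0 = v} = (\<integral>y. indicator {y \<in> \<Pi>\<^sub>E j\<in>{..<m}. {..<2 ^ b}. bit (y 0) 0 = v} y \<partial>?L)"
      by (simp add: space_transcript_law Int_absorb2 Collect_restrict)
    also have "\<dots> = (\<integral>y. (1 + ?w * bit_sign (y 0) 0) / 2 \<partial>?L)"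
      by (intro Bochner_Integration.integral_cong) (auto simp: space_transcript_law bit_sign_def indicator_def)
    also have "\<dots> = (\<integral>y. (1 + ?w * bit_sign y 0) / 2 \<partial>?Q 0)"
      unfolding transcript_law_def using nm by (intro PiM_integral_component(2) Qp intQ) auto
    also have "\<dots> = (1 + ?w * (\<integral>y. bit_sign y 0 \<partial>?Q 0)) / 2"
      by (simp add: intQ Q1)
    also have "(\<integral>y. bit_sign y 0 \<partial>?Q 0) = (\<integral>z. s 0 (shift_noise d ?\<sigma> f z) 0 \<partial>?N)"
      using integral_bit_sign_prod[where s="\<lambda>z. s 0 (shift_noise d ?\<sigma> f z)" and S="{0}" and b=b, OF prob_space_std_normal_vector sm s(2)] nm by simp
    also have "\<dots> = (\<integral>z. ?w * (2 * indicator ?A z - 1) \<partial>?N)"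
      unfolding s0 threshold_bit_def chi_excess_shift_noise[OF \<sigma>]
      by (intro Bochner_Integration.integral_cong) (auto simp: indicator_def)
    also have "\<dots> = ?w * (2 * measure ?N ?A - 1)"
    proof -
      have "integrable ?N (indicator ?A :: _ \<Rightarrow> real)" using A by (intro N.integrable_const_bound[where B=1]) auto
      then show ?thesis using A by (simp add: N.prob_space)
    qed
    finally show ?thesis by (simp split: if_splits)
  qed
  have z: "chi_excess d (\<lambda>i. (\<lambda>i\<in>{..<d}. 0) i / ?\<sigma> + z i) = chi_excess d z" for z
    by (simp add: chi_excess_def)
  show "measure (transcript_law n m d b s (\<lambda>i\<in>{..<d}. 0)) {y \<in> \<Pi>\<^sub>E j\<in>{..<m}. {..<2 ^ b}. bit (y 0) 0} \<le> 2 / t\<^sup>2"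
    using *[of "\<lambda>i\<in>{..<d}. 0" True] chi_excess_threshold(1)[OF nm(3) t] unfolding z by simp
  assume "2 * t * sqrt d \<le> G"
  then show "measure (transcript_law n m d b s f) {y \<in> \<Pi>\<^sub>E j\<in>{..<m}. {..<2 ^ b}. \<not> bit (y 0) 0} \<le> 4 / t\<^sup>2 + 16 / t"
    using *[of f False] chi_excess_threshold(2)[OF nm(3) t, of "\<lambda>i. f i / ?\<sigma>"] by (simp add: G_def)
qed

section \<open>The Hartley basis and an uncertainty principle\<close>

lemma sin_sq_lower_bound:
  fixes x :: real
  assumes "\<bar>x\<bar> \<le> 1"
  shows "x\<^sup>2 / 2 \<le> (sin x)\<^sup>2"
proof -
  have "\<bar>sin x - x\<bar> \<le> inverse (fact 3) * \<bar>x\<bar> ^ 3"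
    using Maclaurin_sin_bound[of x 3] by (simp add: numeral_eq_Suc sin_coeff_def)
  moreover have "\<bar>x\<bar> ^ 3 \<le> \<bar>x\<bar>" using assms power_decreasing[of 1 3 "\<bar>x\<bar>"] by simp
  ultimately have "\<bar>sin x - x\<bar> \<le> \<bar>x\<bar> / 6" by (simp add: fact_numeral)
  then have "5 / 6 * \<bar>x\<bar> \<le> \<bar>sin x\<bar>" by (simp add: abs_if split: if_splits)
  then have "(5 / 6 * \<bar>x\<bar>)\<^sup>2 \<le> \<bar>sin x\<bar>\<^sup>2" by (rule power_mono) simp
  moreover have "x\<^sup>2 / 2 \<le> (5 / 6 * \<bar>x\<bar>)\<^sup>2" by (simp add: power_mult_distrib power_divide)
  ultimately show ?thesis by simp
qed

text \<open>
  The real Fourier matrix with entries \<open>cos + sin\<close>. It is symmetric and orthogonal in every dimension,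
  and its entries are of the smallest possible order \<open>1 / sqrt d\<close>.
\<close>

definition hartley :: "nat \<Rightarrow> nat \<Rightarrow> nat \<Rightarrow> real" where
  "hartley d k i = (cos (2 * pi * real (k * i) / real d) + sin (2 * pi * real (k * i) / real d)) / sqrt (real d)"

lemma hartley_commute: "hartley d k i = hartley d i k"
  by (simp add: hartley_def mult.commute)

lemma hartley_sq_le: "(hartley d k i)\<^sup>2 \<le> 2 / real d"
proof -
  let ?t = "2 * pi * real (k * i) / real d"
  have "(cos ?t + sin ?t)\<^sup>2 \<le> 2 * ((cos ?t)\<^sup>2 + (sin ?t)\<^sup>2)"
    using sum_squares_bound[of "cos ?t" "sin ?t"] by (simp add: power2_sum)
  then have "(cos ?t + sin ?t)\<^sup>2 \<le> 2" by simp
  then show ?thesis by (simp add: hartley_def power_divide divide_right_mono)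
qed

lemma sum_powers_root_of_unity:
  fixes z :: complex
  assumes "z ^ d = 1"
  shows "(\<Sum>i<d. z ^ i) = (if z = 1 then of_nat d else 0)"
  using assms by (simp add: sum_gp_strict)

text \<open>
  The product of two entries is a cosine of the difference plus a sine of the sum of the angles; both
  are parts of geometric sums of \<open>d\<close>-th roots of unity.
\<close>

lemma hartley_orthonormal:
  assumes d: "k < d" "l < d"
  shows "(\<Sum>i<d. hartley d k i * hartley d l i) = (if k = l then 1 else 0)"
proof -
  define w where "w k = cis (2 * pi * real k / real d)" for k
  have d0: "0 < d" using d by simp
  have wd: "w k ^ d = 1" for k
  proof -
    have "real d * (2 * pi * real k / real d) = 2 * pi * real k" using d0 by simp
    then have "w k ^ d = cis (2 * pi * real k)" unfolding w_def Complex.DeMoivre by (rule arg_cong)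
    then show ?thesis using cis_multiple_2pi[of "real k"] by simp
  qed
  have w_inj: "w k / w l = 1 \<longleftrightarrow> k = l"
  proof -
    have "w k = w l \<longleftrightarrow> k = l"
      using complex_root_unity_eq[of d k l] d0 d
      by (simp add: w_def cis_conv_exp cong_def mult_ac)
    moreover have "w l \<noteq> 0" by (simp add: w_def)
    ultimately show ?thesis by simp
  qed
  have "(\<Sum>i<d. cos (2 * pi * (real k - real l) * real i / real d)) = Re (\<Sum>i<d. (w k / w l) ^ i)"
    unfolding Re_sum by (intro sum.cong refl) (simp add: w_def cis_divide Complex.DeMoivre algebra_simps diff_divide_distrib)
  also have "(\<Sum>i<d. (w k / w l) ^ i) = (if k = l then of_nat d else 0)"
    using sum_powers_root_of_unity[of "w k / w l" d] w_inj by (simp add: power_divide wd)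
  finally have c: "(\<Sum>i<d. cos (2 * pi * (real k - real l) * real i / real d)) = (if k = l then real d else 0)" by simp
  have "(\<Sum>i<d. sin (2 * pi * (real k + real l) * real i / real d)) = Im (\<Sum>i<d. (w k * w l) ^ i)"
    unfolding Im_sum by (intro sum.cong refl) (simp add: w_def cis_mult Complex.DeMoivre algebra_simps add_divide_distrib)
  also have "(\<Sum>i<d. (w k * w l) ^ i) = (if w k * w l = 1 then of_nat d else 0)"
    using sum_powers_root_of_unity[of "w k * w l" d] by (simp add: power_mult_distrib wd)
  finally have s: "(\<Sum>i<d. sin (2 * pi * (real k + real l) * real i / real d)) = 0" by (simp split: if_splits)
  have "hartley d k i * hartley d l i =
      (cos (2 * pi * (real k - real l) * real i / real d) + sin (2 * pi * (real k + real l) * real i / real d)) / real d" for i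
  proof -
    define x where "x = 2 * pi * real (k * i) / real d"
    define y where "y = 2 * pi * real (l * i) / real d"
    have "2 * pi * (real k - real l) * real i / real d = x - y" "2 * pi * (real k + real l) * real i / real d = x + y"
      by (simp_all add: x_def y_def algebra_simps diff_divide_distrib add_divide_distrib)
    moreover have "(cos x + sin x) * (cos y + sin y) = cos (x - y) + sin (x + y)"
      by (simp add: cos_diff sin_add algebra_simps)
    ultimately show ?thesis
      unfolding hartley_def x_def[symmetric] y_def[symmetric] by simp
  qed
  then have "(\<Sum>i<d. hartley d k i * hartley d l i) = ((\<Sum>i<d. cos (2 * pi * (real k - real l) * real i / real d)) + (\<Sum>i<d. sin (2 * pi * (real k + real l) * real i / real d))) / real d"
    by (simp add: sum.distrib flip: sum_divide_distrib)
  then show ?thesis using c s d0 by simp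
qed

lemma hartley_parseval:
  "(\<Sum>k<d. (\<Sum>i<d. hartley d k i * x i)\<^sup>2) = (\<Sum>i<d. (x i)\<^sup>2)"
proof -
  have "(\<Sum>k<d. (\<Sum>i<d. hartley d k i * x i)\<^sup>2) = (\<Sum>k<d. \<Sum>i<d. \<Sum>j<d. x i * x j * (hartley d i k * hartley d j k))"
    unfolding power2_eq_square sum_product
    by (intro sum.cong refl) (simp add: hartley_commute[of d _ "_ :: nat"] hartley_def mult_ac)
  also have "\<dots> = (\<Sum>i<d. \<Sum>k<d. \<Sum>j<d. x i * x j * (hartley d i k * hartley d j k))"
    by (rule sum.swap)
  also have "\<dots> = (\<Sum>i<d. \<Sum>j<d. \<Sum>k<d. x i * x j * (hartley d i k * hartley d j k))"
    by (intro sum.cong refl sum.swap)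
  also have "\<dots> = (\<Sum>i<d. \<Sum>j<d. x i * x j * (if i = j then 1 else 0))"
    by (intro sum.cong refl) (simp add: hartley_orthonormal flip: sum_distrib_left)
  also have "\<dots> = (\<Sum>i<d. (x i)\<^sup>2)"
    by (intro sum.cong refl) (simp add: power2_eq_square if_distrib[of "\<lambda>c. _ * c"] cong: if_cong)
  finally show ?thesis .
qed

text \<open>
  A signal of moderate energy cannot be concentrated on large coordinates both in the standard basis
  and in the Hartley basis. The large coordinates \<open>u\<close> of \<open>g\<close> have absolute sum at most \<open>G\<close>, hence contribute
  only \<open>O (G / sqrt d)\<close> to each Hartley coordinate, and at most \<open>G\<close> Hartley coordinates can be large. So
  most of the energy sitting on large Hartley coordinates must come from the small coordinates \<open>x\<close> of \<open>g\<close>.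
\<close>

lemma hartley_uncertainty:
  fixes g :: "nat \<Rightarrow> real" and d :: nat
  defines "G \<equiv> (\<Sum>i<d. (g i)\<^sup>2)" and "h \<equiv> \<lambda>k. \<Sum>i<d. hartley d k i * g i"
  assumes small: "4 * G \<le> sqrt (real d)"
  shows "3 / 8 * G \<le> (\<Sum>i | i < d \<and> \<bar>g i\<bar> \<le> 1. (g i)\<^sup>2) + (\<Sum>k | k < d \<and> \<bar>h k\<bar> \<le> 1. (h k)\<^sup>2)"
proof (cases "d = 0")
  case True
  then show ?thesis by (simp add: G_def)
next
  case False
  define x where "x i = (if \<bar>g i\<bar> \<le> 1 then g i else 0)" for i
  define u where "u i = (if \<bar>g i\<bar> \<le> 1 then 0 else g i)" for i
  define A where "A = (\<Sum>i | i < d \<and> \<bar>g i\<bar> \<le> 1. (g i)\<^sup>2)"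
  define B where "B = (\<Sum>k | k < d \<and> \<bar>h k\<bar> \<le> 1. (h k)\<^sup>2)"
  define P where "P = {k. k < d \<and> \<not> \<bar>h k\<bar> \<le> 1}"
  have G0: "0 \<le> G" by (simp add: G_def sum_nonneg)
  have split: "(\<Sum>k<d. f k) = (\<Sum>k | k < d \<and> Q k. f k) + (\<Sum>k | k < d \<and> \<not> Q k. f k)" for f :: "nat \<Rightarrow> real" and Q
  proof -
    have "{..<d} = {k. k < d \<and> Q k} \<union> {k. k < d \<and> \<not> Q k}" by auto
    then show ?thesis by (simp add: sum.union_disjoint[symmetric] disjoint_iff)
  qed
  have xA: "(\<Sum>i<d. (x i)\<^sup>2) = A"
    unfolding split[of _ "\<lambda>i. \<bar>g i\<bar> \<le> 1"] A_def by (simp add: x_def)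
  have hG: "(\<Sum>k<d. (h k)\<^sup>2) = G" unfolding h_def G_def by (rule hartley_parseval)
  have PB: "(\<Sum>k\<in>P. (h k)\<^sup>2) = G - B"
    using hG unfolding split[of _ "\<lambda>k. \<bar>h k\<bar> \<le> 1"] B_def P_def by simp
  have sq1: "1 \<le> y\<^sup>2" "\<bar>y\<bar> \<le> y\<^sup>2" if "\<not> \<bar>y\<bar> \<le> 1" for y :: real
  proof -
    have "1 * \<bar>y\<bar> \<le> \<bar>y\<bar> * \<bar>y\<bar>" using that by (intro mult_right_mono) auto
    then show "\<bar>y\<bar> \<le> y\<^sup>2" by (simp add: power2_eq_square abs_mult[symmetric])
    then show "1 \<le> y\<^sup>2" using that by linarith
  qed
  have B0: "0 \<le> B" by (simp add: B_def sum_nonneg)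
  have cardP: "real (card P) \<le> G"
  proof -
    have "real (card P) = (\<Sum>k\<in>P. 1)" by simp
    also have "\<dots> \<le> (\<Sum>k\<in>P. (h k)\<^sup>2)" by (intro sum_mono) (auto simp: P_def intro!: sq1)
    finally show ?thesis using PB B0 by simp
  qed
  have uG: "(\<Sum>i<d. \<bar>u i\<bar>) \<le> G"
    unfolding G_def by (intro sum_mono) (auto simp: u_def intro!: sq1)
  have Hu: "(\<Sum>i<d. hartley d k i * u i)\<^sup>2 \<le> 2 / real d * G\<^sup>2" for k
  proof -
    have "\<bar>\<Sum>i<d. hartley d k i * u i\<bar> \<le> (\<Sum>i<d. sqrt (2 / real d) * \<bar>u i\<bar>)"
    proof (intro order.trans[OF sum_abs] sum_mono)
      fix i
      have "\<bar>hartley d k i\<bar> \<le> sqrt (2 / real d)" using hartley_sq_le[of d k i] by (intro real_le_rsqrt) simp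
      then show "\<bar>hartley d k i * u i\<bar> \<le> sqrt (2 / real d) * \<bar>u i\<bar>" by (simp add: abs_mult mult_right_mono)
    qed
    also have "\<dots> \<le> sqrt (2 / real d) * G" using uG by (simp add: mult_left_mono flip: sum_distrib_left)
    finally have "\<bar>\<Sum>i<d. hartley d k i * u i\<bar>\<^sup>2 \<le> (sqrt (2 / real d) * G)\<^sup>2" by (rule power_mono) simp
    then show ?thesis by (simp add: power_mult_distrib)
  qed
  \<comment> \<open>On the large Hartley coordinates, split \<open>g = x + u\<close>.\<close>
  have "G - B \<le> (\<Sum>k\<in>P. 2 * (\<Sum>i<d. hartley d k i * x i)\<^sup>2 + 2 * (2 / real d * G\<^sup>2))"
    unfolding PB[symmetric]
  proof (intro sum_mono)
    fix k
    have "h k = (\<Sum>i<d. hartley d k i * x i) + (\<Sum>i<d. hartley d k i * u i)"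
      unfolding h_def sum.distrib[symmetric] by (intro sum.cong refl) (simp add: x_def u_def)
    then have "(h k)\<^sup>2 \<le> 2 * (\<Sum>i<d. hartley d k i * x i)\<^sup>2 + 2 * (\<Sum>i<d. hartley d k i * u i)\<^sup>2"
      using sum_squares_bound[of "\<Sum>i<d. hartley d k i * x i" "\<Sum>i<d. hartley d k i * u i"] by (simp add: power2_sum)
    then show "(h k)\<^sup>2 \<le> 2 * (\<Sum>i<d. hartley d k i * x i)\<^sup>2 + 2 * (2 / real d * G\<^sup>2)" using Hu[of k] by linarith
  qed
  also have "\<dots> = 2 * (\<Sum>k\<in>P. (\<Sum>i<d. hartley d k i * x i)\<^sup>2) + real (card P) * (4 / real d * G\<^sup>2)"
    by (simp add: sum.distrib sum_distrib_left)
  also have "(\<Sum>k\<in>P. (\<Sum>i<d. hartley d k i * x i)\<^sup>2) \<le> (\<Sum>k<d. (\<Sum>i<d. hartley d k i * x i)\<^sup>2)"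
    by (intro sum_mono2) (auto simp: P_def)
  also have "\<dots> = A" unfolding hartley_parseval xA ..
  also have "real (card P) * (4 / real d * G\<^sup>2) \<le> G * (1 / 4)"
  proof (intro mult_mono cardP G0)
    have "(4 * G)\<^sup>2 \<le> (sqrt (real d))\<^sup>2" using small G0 by (intro power_mono) auto
    then show "4 / real d * G\<^sup>2 \<le> 1 / 4" using False by (simp add: power_mult_distrib field_simps)
  qed simp
  finally have "G - B \<le> 2 * A + G / 4" by simp
  moreover have "0 \<le> A" by (simp add: A_def sum_nonneg)
  ultimately show ?thesis unfolding A_def[symmetric] B_def[symmetric] using B0 by linarith
qed

section \<open>Random directions from a shared coin\<close>

text \<open>
  The squared conditional mean of the sign reported for the random direction \<open>w / sqrt d\<close>.
\<close>

definition direction_signal :: "nat \<Rightarrow> (nat \<Rightarrow> real) \<Rightarrow> (nat \<Rightarrow> real) \<Rightarrow> real" where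
  "direction_signal d g w = exp (- (1 / real d) * (\<Sum>i<d. (w i)\<^sup>2)) * (sin (\<Sum>i<d. (g i / sqrt (real d)) * w i))\<^sup>2"

lemma direction_signal_bounds: "0 \<le> direction_signal d g w" "direction_signal d g w \<le> 1"
proof -
  show "0 \<le> direction_signal d g w" by (simp add: direction_signal_def)
  have "exp (- (1 / real d) * (\<Sum>i<d. (w i)\<^sup>2)) \<le> 1" by (simp add: sum_nonneg divide_nonneg_nonneg)
  then show "direction_signal d g w \<le> 1"
    unfolding direction_signal_def by (intro mult_le_one) (auto simp: abs_square_le_1)
qed

lemma direction_signal_measurable: "direction_signal d g \<in> borel_measurable (std_normal_vector d)"
  unfolding direction_signal_def by measurable

lemma one_minus_exp_ge:
  fixes y :: real
  assumes "0 \<le> y"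
  shows "min 1 y / 2 \<le> 1 - exp (- y)"
proof -
  have "exp (- y) \<le> 1 / (1 + y)"
    using exp_ge_add_one_self[of y] assms by (simp add: exp_minus field_simps)
  then have "y / (1 + y) \<le> 1 - exp (- y)" using assms by (simp add: field_simps)
  moreover have "min 1 y / 2 \<le> y / (1 + y)"
  proof (cases "1 \<le> y")
    case True
    then show ?thesis by (simp add: field_simps)
  next
    case False
    then have "y * y \<le> y * 1" using assms by (intro mult_left_mono) auto
    then show ?thesis using assms False by (simp add: field_simps min_def)
  qed
  ultimately show ?thesis by linarith
qed

text \<open>
  With \<open>x\<close> the damped mean of \<open>cos\<close> of twice the angle, the first moment is \<open>A * (1 - x) / 2\<close> and the
  second is at most \<open>A * (3 - 4 * x + x ^ 4) / 8 = O ((1 - x)\<^sup>2)\<close>. Hence the signal of one direction has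
  bounded relative variance, whatever the size and shape of \<open>g\<close>, so that averaging over a bounded number of
  directions makes it concentrate.
\<close>

lemma direction_signal_moments:
  fixes d :: nat and g :: "nat \<Rightarrow> real"
  assumes d: "1 \<le> d"
  defines "G \<equiv> (\<Sum>i<d. (g i)\<^sup>2)"
    and "p \<equiv> (\<integral>w. direction_signal d g w \<partial>std_normal_vector d)"
  shows "min 1 (G / real d) / 18 \<le> p"
    and "(\<integral>w. (direction_signal d g w)\<^sup>2 \<partial>std_normal_vector d) \<le> 9 * p\<^sup>2"
proof -
  let ?N = "std_normal_vector d"
  let ?E = "\<lambda>w :: nat \<Rightarrow> real. exp (- (1 / real d) * (\<Sum>i<d. (w i)\<^sup>2))"
  let ?L = "\<lambda>w. \<Sum>i<d. (g i / sqrt (real d)) * w i"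
  define a where "a = 1 / sqrt (1 + 2 * (1 / real d))"
  define A where "A = a ^ d"
  define x where "x = exp (- (2 * a\<^sup>2 * (G / real d)))"
  have G0: "0 \<le> G" by (simp add: G_def sum_nonneg)
  have a2: "a\<^sup>2 = 1 / (1 + 2 / real d)" "0 < a" using d by (auto simp: a_def power_divide add_pos_nonneg)
  have a3: "1 / 3 \<le> a\<^sup>2" using d by (simp add: a2 field_simps)
  have A: "1 / 3 \<le> A"
  proof -
    have "exp (- (1 / real d)) \<le> a"
    proof (rule power2_le_imp_le)
      have "(exp (- (1 / real d)))\<^sup>2 = 1 / exp (2 / real d)"
        by (simp add: exp_double[symmetric] exp_minus field_simps)
      also have "\<dots> \<le> 1 / (1 + 2 / real d)"
        using exp_ge_add_one_self[of "2 / real d"] by (intro divide_left_mono mult_pos_pos add_pos_nonneg) auto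
      finally show "(exp (- (1 / real d)))\<^sup>2 \<le> a\<^sup>2" by (simp add: a2)
    qed (use a2 in simp)
    then have "exp (- (1 / real d)) ^ d \<le> a ^ d" by (intro power_mono) auto
    moreover have "exp (- (1 / real d)) ^ d = exp (- 1)" using d by (simp flip: exp_of_nat_mult)
    moreover have "1 / 3 \<le> exp (- 1 :: real)" using exp_le by (simp add: exp_minus field_simps)
    ultimately show ?thesis by (simp add: A_def)
  qed
  have x01: "0 < x" "x \<le> 1" using G0 by (auto simp: x_def)
  have E: "(\<integral>w. ?E w * cos (c * ?L w) \<partial>?N) = A * exp (- (a\<^sup>2 * c\<^sup>2 * (G / real d)) / 2)" for c
  proof -
    have "c * ?L w = 0 + (\<Sum>i<d. (c * (g i / sqrt (real d))) * w i)" for w by (simp add: sum_distrib_left mult.assoc)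
    moreover have "(\<Sum>i<d. (c * (g i / sqrt (real d)))\<^sup>2) = c\<^sup>2 * (G / real d)"
      by (simp add: power_mult_distrib power_divide G_def sum_distrib_left sum_divide_distrib)
    ultimately show ?thesis
      using damped_cos_std_normal_vector(1)[of "1 / real d" d 0 "\<lambda>i. c * (g i / sqrt (real d))"]
      by (simp add: A_def a_def mult.assoc)
  qed
  have int: "integrable ?N (\<lambda>w. ?E w * cos (c * ?L w))" for c
  proof (rule integrable_bounded_std_normal_vector[where B=1])
    show "\<bar>?E w * cos (c * ?L w)\<bar> \<le> 1" for w
      unfolding abs_mult by (intro mult_le_one) (auto simp: sum_nonneg divide_nonneg_nonneg)
  qed measurable
  have E0: "(\<integral>w. ?E w \<partial>?N) = A" "integrable ?N ?E" using E[of 0] int[of 0] by simp_all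
  have E2: "(\<integral>w. ?E w * cos (2 * ?L w) \<partial>?N) = A * x"
    unfolding E x_def by (simp add: field_simps)
  have E4: "(\<integral>w. ?E w * cos (4 * ?L w) \<partial>?N) = A * x ^ 4"
    unfolding E x_def exp_of_nat_mult[symmetric] by (simp add: field_simps)
  have s2: "direction_signal d g w = (?E w - ?E w * cos (2 * ?L w)) / 2" for w
    unfolding direction_signal_def by (simp add: cos_double_sin algebra_simps)
  have p: "p = A * (1 - x) / 2"
    unfolding p_def s2 using E0 E2 int[of 2] by (simp add: right_diff_distrib)
  have s4: "?E w * (sin (?L w)) ^ 4 = (3 * ?E w - 4 * (?E w * cos (2 * ?L w)) + ?E w * cos (4 * ?L w)) / 8" for w
  proof -
    have "sin y ^ 4 = (3 - 4 * cos (2 * y) + cos (4 * y)) / 8" for y :: real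
    proof -
      have "cos (4 * y) = 1 - 2 * (sin (2 * y))\<^sup>2" using cos_double_sin[of "2 * y"] by simp
      moreover have "(sin (2 * y))\<^sup>2 = 4 * (sin y)\<^sup>2 * (1 - (sin y)\<^sup>2)"
        by (simp add: sin_double power_mult_distrib cos_squared_eq)
      moreover have "cos (2 * y) = 1 - 2 * (sin y)\<^sup>2" by (rule cos_double_sin)
      ultimately show ?thesis by (simp add: algebra_simps power2_eq_square power4_eq_xxxx)
    qed
    from this[of "?L w"]
    have "?E w * (sin (?L w)) ^ 4 = ?E w * ((3 - 4 * cos (2 * ?L w) + cos (4 * ?L w)) / 8)" by (rule arg_cong)
    moreover have "e * ((3 - 4 * x + y) / 8) = (3 * e - 4 * (e * x) + e * y) / 8" for e x y :: real
      by (simp add: field_simps)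
    ultimately show ?thesis by (rule trans)
  qed
  have "(\<integral>w. (direction_signal d g w)\<^sup>2 \<partial>?N) \<le> (\<integral>w. ?E w * (sin (?L w)) ^ 4 \<partial>?N)"
  proof (rule integral_mono)
    show "integrable ?N (\<lambda>w. (direction_signal d g w)\<^sup>2)"
    proof (rule integrable_bounded_std_normal_vector[where B=1])
      show "\<bar>(direction_signal d g w)\<^sup>2\<bar> \<le> 1" for w
        using direction_signal_bounds[of d g w] by (simp add: power_le_one)
    qed (use direction_signal_measurable[of d g] in measurable)
    show "integrable ?N (\<lambda>w. ?E w * (sin (?L w)) ^ 4)"
      unfolding s4 using E0 int[of 2] int[of 4] by simp
    fix w
    have "?E w \<le> 1" by (simp add: sum_nonneg divide_nonneg_nonneg)
    then have "?E w * ?E w * (sin (?L w)) ^ 4 \<le> 1 * ?E w * (sin (?L w)) ^ 4" by (intro mult_right_mono) auto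
    then show "(direction_signal d g w)\<^sup>2 \<le> ?E w * (sin (?L w)) ^ 4"
      by (simp add: direction_signal_def power_mult_distrib power2_eq_square power4_eq_xxxx mult_ac)
  qed
  also have "\<dots> = (3 * A - 4 * (A * x) + A * x ^ 4) / 8"
    unfolding s4 using E0 E2 E4 int[of 2] int[of 4] by simp
  also have "\<dots> = A / 8 * (3 - 4 * x + x ^ 4)" by (simp add: field_simps)
  also have "3 - 4 * x + x ^ 4 = (1 - x)\<^sup>2 * (3 + 2 * x + x\<^sup>2)"
    by (simp add: power2_eq_square power4_eq_xxxx algebra_simps)
  also have "A / 8 * \<dots> \<le> A / 8 * ((1 - x)\<^sup>2 * 6)"
  proof (intro mult_left_mono)
    have "x\<^sup>2 \<le> 1" using x01 by (intro power_le_one) auto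
    then show "3 + 2 * x + x\<^sup>2 \<le> 6" using x01 by linarith
  qed (use A in auto)
  also have "\<dots> = (3 / A) * p\<^sup>2"
    using A by (simp add: p power2_eq_square field_simps)
  also have "\<dots> \<le> 9 * p\<^sup>2"
    using A by (intro mult_right_mono) (auto simp: field_simps)
  finally show "(\<integral>w. (direction_signal d g w)\<^sup>2 \<partial>?N) \<le> 9 * p\<^sup>2" .
  define \<gamma> where "\<gamma> = G / real d"
  have \<gamma>0: "0 \<le> \<gamma>" using G0 by (simp add: \<gamma>_def)
  have a\<gamma>: "0 \<le> 2 * a\<^sup>2 * \<gamma>" using \<gamma>0 by simp
  have "2 / 3 * \<gamma> \<le> 2 * a\<^sup>2 * \<gamma>" using a3 \<gamma>0 by (intro mult_right_mono) auto
  then have "2 / 3 * min 1 \<gamma> \<le> min 1 (2 * a\<^sup>2 * \<gamma>)" using \<gamma>0 by (auto simp: min_def)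
  also have "\<dots> / 2 \<le> 1 - x"
    using one_minus_exp_ge[OF a\<gamma>] by (simp add: x_def \<gamma>_def)
  finally have "1 / 3 * min 1 \<gamma> \<le> 1 - x" by simp
  then have "1 / 3 * (1 / 3 * min 1 \<gamma>) \<le> A * (1 - x)" using A \<gamma>0 by (intro mult_mono) auto
  then show "min 1 (G / real d) / 18 \<le> p" by (simp add: p \<gamma>_def)
qed

text \<open>
  Independent random directions are nearly orthogonal: their inner product, of vectors of squared
  length about \<open>d\<close>, has second moment \<open>d\<close>.
\<close>

lemma inner_product_second_moment:
  fixes d D r s :: nat
  assumes rs: "r < D" "s < D" "r \<noteq> s"
  defines "P \<equiv> \<Pi>\<^sub>M r\<in>{..<D}. std_normal_vector d"
  shows "integrable P (\<lambda>w. (\<Sum>i<d. w r i * w s i)\<^sup>2)"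
    "(\<integral>w. (\<Sum>i<d. w r i * w s i)\<^sup>2 \<partial>P) = real d"
proof -
  let ?N = "std_normal_vector d" and ?G = std_normal_distribution
  have pair: "integrable ?N (\<lambda>z. z i * z j) \<and> (\<integral>z. z i * z j \<partial>?N) = (if i = j then 1 else 0)" if "i < d" "j < d" for i j
  proof (cases "i = j")
    case True
    then show ?thesis
      using PiM_integral_component[where M="\<lambda>_. ?G" and I="{..<d}" and i=i and f="\<lambda>z. z * z"] that
        std_normal_distribution_moments(1)[of 2] std_normal_distribution_moments(3) prob_space_std_normal_distribution
      unfolding std_normal_vector_eq by (simp add: power2_eq_square)
  next
    case False
    then show ?thesis
      using PiM_integral_two_components[where M="\<lambda>_. ?G" and I="{..<d}" and i=i and j=j and f="\<lambda>z. z" and g="\<lambda>z. z"] that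
        std_normal_distribution_moments(1)[of 1] std_normal_distribution_moments(2) prob_space_std_normal_distribution
      unfolding std_normal_vector_eq by simp
  qed
  have four: "integrable P (\<lambda>w. (w r i * w r j) * (w s i * w s j)) \<and>
      (\<integral>w. (w r i * w r j) * (w s i * w s j) \<partial>P) = (if i = j then 1 else 0)" if "i < d" "j < d" for i j
    unfolding P_def
    using PiM_integral_two_components[where M="\<lambda>_. ?N" and I="{..<D}" and i=r and j=s and f="\<lambda>z. z i * z j" and g="\<lambda>z. z i * z j"]
      pair[OF that] rs prob_space_std_normal_vector by auto
  have eq: "(\<Sum>i<d. w r i * w s i)\<^sup>2 = (\<Sum>i<d. \<Sum>j<d. (w r i * w r j) * (w s i * w s j))" for w :: "nat \<Rightarrow> nat \<Rightarrow> real"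
    unfolding power2_eq_square sum_product by (intro sum.cong refl) (simp add: mult_ac)
  show "integrable P (\<lambda>w. (\<Sum>i<d. w r i * w s i)\<^sup>2)"
    unfolding eq using four by (intro Bochner_Integration.integrable_sum) auto
  have "(\<integral>w. (\<Sum>i<d. w r i * w s i)\<^sup>2 \<partial>P) = (\<Sum>i<d. \<Sum>j<d. \<integral>w. (w r i * w r j) * (w s i * w s j) \<partial>P)"
    unfolding eq using four
    by (subst Bochner_Integration.integral_sum, (intro Bochner_Integration.integrable_sum; auto))+
       (auto intro!: sum.cong Bochner_Integration.integral_sum)
  also have "\<dots> = (\<Sum>i<d. \<Sum>j<d. if i = j then 1 else 0)" using four by (intro sum.cong refl) auto
  also have "\<dots> = real d" by simp
  finally show "(\<integral>w. (\<Sum>i<d. w r i * w s i)\<^sup>2 \<partial>P) = real d" .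
qed

definition flatten :: "nat \<Rightarrow> nat \<Rightarrow> (nat \<Rightarrow> nat \<Rightarrow> real) \<Rightarrow> nat \<Rightarrow> real" where
  "flatten D d w = (\<lambda>i\<in>{..<D * d}. w (i div d) (i mod d))"

text \<open>
  Flattening gives the coin the shape of a single vector, while moments are computed on the unflattened
  product, where the directions are independent coordinates.
\<close>

definition gaussian_coin :: "nat \<Rightarrow> nat \<Rightarrow> (nat \<Rightarrow> real) measure" where
  "gaussian_coin D d = distr (\<Pi>\<^sub>M r\<in>{..<D}. std_normal_vector d) (Rn (D * d)) (flatten D d)"

definition coin_direction :: "nat \<Rightarrow> nat \<Rightarrow> nat \<Rightarrow> (nat \<Rightarrow> real) \<Rightarrow> nat \<Rightarrow> nat \<Rightarrow> nat \<Rightarrow> real" where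
  "coin_direction d T b u t k i = (if t < T \<and> k < b \<and> i < d then u ((t * b + k) * d + i) / sqrt (real d) else 0)"

lemma block_index_less:
  fixes t k T b :: nat
  assumes "t < T" "k < b"
  shows "t * b + k < T * b"
proof -
  have "t * b + k < (t + 1) * b" using assms by simp
  also have "\<dots> \<le> T * b" using assms by (intro mult_right_mono) auto
  finally show ?thesis .
qed

lemma flatten_measurable: "flatten D d \<in> (\<Pi>\<^sub>M r\<in>{..<D}. std_normal_vector d) \<rightarrow>\<^sub>M Rn (D * d)"
  unfolding flatten_def Rn_def
proof (rule measurable_restrict)
  fix i assume "i \<in> {..<D * d}"
  then have "i div d < D" "i mod d < d"
    by (auto simp: less_mult_imp_div_less) (metis less_nat_zero_code mod_less_divisor mult_is_0 neq0_conv)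
  then show "(\<lambda>w. w (i div d) (i mod d)) \<in> borel_measurable (\<Pi>\<^sub>M r\<in>{..<D}. std_normal_vector d)"
    by (intro measurable_compose_component component_measurable_std_normal) auto
qed

lemma prob_space_gaussian_coin: "prob_space (gaussian_coin D d)"
  unfolding gaussian_coin_def
  by (intro prob_space.prob_space_distr prob_space_PiM prob_space_std_normal_vector flatten_measurable)

lemma sets_gaussian_coin[measurable_cong]: "sets (gaussian_coin D d) = sets (Rn (D * d))"
  by (simp add: gaussian_coin_def)

lemma coin_direction_flatten:
  "coin_direction d T b (flatten (T * b) d w) t k i = (if t < T \<and> k < b \<and> i < d then w (t * b + k) i / sqrt (real d) else 0)"
proof (cases "t < T \<and> k < b \<and> i < d")
  case True
  then have "(t * b + k) * d + i < T * b * d" using block_index_less[of t T k b] by (intro block_index_less) auto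
  then show ?thesis using True by (simp add: coin_direction_def flatten_def)
qed (auto simp: coin_direction_def)

lemma coin_direction_measurable: "(\<lambda>u. coin_direction d T b u t k i) \<in> borel_measurable (Rn (T * b * d))"
proof (cases "t < T \<and> k < b \<and> i < d")
  case True
  then have "(t * b + k) * d + i < T * b * d" using block_index_less[of t T k b] by (intro block_index_less) auto
  then have "(\<lambda>u. u ((t * b + k) * d + i)) \<in> borel_measurable (Rn (T * b * d))"
    unfolding Rn_def by (intro measurable_component_singleton) auto
  then show ?thesis using True by (simp add: coin_direction_def)
next
  case False
  then have "(\<lambda>u. coin_direction d T b u t k i) = (\<lambda>_. 0)" by (auto simp: coin_direction_def)
  then show ?thesis by simp
qed

text \<open>
  Each diagonal term contributes \<open>1\<close>, and the at most \<open>d\<close> off-diagonal terms of a row contribute \<open>1 / d\<close>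
  each on average.
\<close>

lemma gram_bound_coin:
  assumes d: "1 \<le> d" "b \<le> d"
  shows "integrable (gaussian_coin (T * b) d) (\<lambda>u. gram_bound d T b (coin_direction d T b u))"
    "(\<integral>u. gram_bound d T b (coin_direction d T b u) \<partial>gaussian_coin (T * b) d) \<le> 2 * real (T * b)"
proof -
  let ?P = "\<Pi>\<^sub>M r\<in>{..<T * b}. std_normal_vector d"
  let ?F = "\<lambda>u. gram_bound d T b (coin_direction d T b u)"
  interpret P: prob_space ?P by (intro prob_space_PiM prob_space_std_normal_vector)
  have Fm: "?F \<in> borel_measurable (Rn (T * b * d))"
    unfolding gram_bound_def using coin_direction_measurable by measurable
  have pt: "?F (flatten (T * b) d w) = (\<Sum>t<T. \<Sum>k<b. \<Sum>l<b. if k = l then 1 else (\<Sum>i<d. w (t * b + k) i * w (t * b + l) i)\<^sup>2 / (real d)\<^sup>2)" for w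
    unfolding gram_bound_def coin_direction_flatten
  proof (intro sum.cong refl if_cong)
    fix t k l assume "t \<in> {..<T}" "k \<in> {..<b}" "l \<in> {..<b}"
    then have "(\<Sum>i<d. (if t < T \<and> k < b \<and> i < d then w (t * b + k) i / sqrt (real d) else 0) * (if t < T \<and> l < b \<and> i < d then w (t * b + l) i / sqrt (real d) else 0))
       = (\<Sum>i<d. w (t * b + k) i * w (t * b + l) i) / real d"
      unfolding sum_divide_distrib by (intro sum.cong refl) simp
    then show "(\<Sum>i<d. (if t < T \<and> k < b \<and> i < d then w (t * b + k) i / sqrt (real d) else 0) * (if t < T \<and> l < b \<and> i < d then w (t * b + l) i / sqrt (real d) else 0))\<^sup>2
       = (\<Sum>i<d. w (t * b + k) i * w (t * b + l) i)\<^sup>2 / (real d)\<^sup>2"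
      by (simp add: power_divide)
  qed
  have one: "integrable ?P (\<lambda>w. if k = l then 1 else (\<Sum>i<d. w (t * b + k) i * w (t * b + l) i)\<^sup>2 / (real d)\<^sup>2) \<and>
     (\<integral>w. (if k = l then 1 else (\<Sum>i<d. w (t * b + k) i * w (t * b + l) i)\<^sup>2 / (real d)\<^sup>2) \<partial>?P) = (if k = l then 1 else 1 / real d)"
    if "t < T" "k < b" "l < b" for t k l
  proof (cases "k = l")
    case True
    then show ?thesis by (simp add: P.prob_space)
  next
    case False
    then show ?thesis
      using inner_product_second_moment[of "t * b + k" "T * b" "t * b + l" d] block_index_less that d
      by (simp add: power2_eq_square)
  qed
  have int: "integrable ?P (\<lambda>w. ?F (flatten (T * b) d w))"
    unfolding pt using one by (intro Bochner_Integration.integrable_sum) auto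
  then show "integrable (gaussian_coin (T * b) d) ?F"
    unfolding gaussian_coin_def by (subst integrable_distr_eq[OF flatten_measurable Fm])
  have "(\<integral>u. ?F u \<partial>gaussian_coin (T * b) d) = (\<integral>w. ?F (flatten (T * b) d w) \<partial>?P)"
    unfolding gaussian_coin_def by (rule integral_distr[OF flatten_measurable Fm])
  also have "\<dots> = (\<Sum>t<T. \<Sum>k<b. \<Sum>l<b. \<integral>w. (if k = l then 1 else (\<Sum>i<d. w (t * b + k) i * w (t * b + l) i)\<^sup>2 / (real d)\<^sup>2) \<partial>?P)"
    unfolding pt using one
    by (subst Bochner_Integration.integral_sum; (intro Bochner_Integration.integrable_sum sum.cong refl; auto)?)+
  also have "\<dots> = (\<Sum>t<T. \<Sum>k<b. \<Sum>l<b. if k = l then 1 else 1 / real d)"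
    using one by (intro sum.cong refl) auto
  also have "\<dots> \<le> (\<Sum>t<T. \<Sum>k<b. 2)"
  proof (intro sum_mono)
    fix t k assume "k \<in> {..<b}"
    have "(\<Sum>l<b. if k = l then 1 else 1 / real d) \<le> (\<Sum>l<b. (if k = l then 1 else 0) + 1 / real d)"
      by (intro sum_mono) auto
    also have "\<dots> = 1 + real b / real d" using \<open>k \<in> {..<b}\<close> by (simp add: sum.distrib)
    also have "\<dots> \<le> 2" using d by simp
    finally show "(\<Sum>l<b. if k = l then 1 else 1 / real d) \<le> 2" .
  qed
  also have "\<dots> = 2 * real (T * b)" by simp
  finally show "(\<integral>u. ?F u \<partial>gaussian_coin (T * b) d) \<le> 2 * real (T * b)" .
qed

lemma sum_blocks:
  fixes f :: "nat \<Rightarrow> real"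
  shows "(\<Sum>t<T. \<Sum>k<b. f (t * b + k)) = (\<Sum>r<T * b. f r)"
proof -
  have "(\<Sum>k<b. f (t * b + k)) = sum f {t * b..<t * b + b}" for t
    using sum.shift_bounds_nat_ivl[of f 0 "t * b" b] by (simp add: lessThan_atLeast0 add.commute)
  then show ?thesis using sum.nat_group[of f b T] by simp
qed

lemma signal_coin:
  fixes d T b :: nat and g :: "nat \<Rightarrow> real"
  assumes d: "1 \<le> d"
  defines "p \<equiv> (\<integral>w. direction_signal d g w \<partial>std_normal_vector d)"
  shows "integrable (gaussian_coin (T * b) d) (\<lambda>u. (signal d T b (coin_direction d T b u) g - real (T * b) * p)\<^sup>2)"
    "(\<integral>u. (signal d T b (coin_direction d T b u) g - real (T * b) * p)\<^sup>2 \<partial>gaussian_coin (T * b) d) \<le> real (T * b) * (9 * p\<^sup>2)"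
proof -
  let ?N = "std_normal_vector d"
  let ?P = "\<Pi>\<^sub>M r\<in>{..<T * b}. ?N"
  let ?S = "\<lambda>u. signal d T b (coin_direction d T b u) g"
  interpret N: prob_space ?N by (rule prob_space_std_normal_vector)
  have Sm: "?S \<in> borel_measurable (Rn (T * b * d))"
    unfolding signal_def using coin_direction_measurable by measurable
  then have Sm2: "(\<lambda>u. (?S u - real (T * b) * p)\<^sup>2) \<in> borel_measurable (Rn (T * b * d))" by measurable
  have "?S (flatten (T * b) d w) = (\<Sum>t<T. \<Sum>k<b. direction_signal d g (w (t * b + k)))" for w
    unfolding signal_def coin_direction_flatten
  proof (intro sum.cong refl)
    fix t k assume "t \<in> {..<T}" "k \<in> {..<b}"
    then have "(\<Sum>i<d. (if t < T \<and> k < b \<and> i < d then w (t * b + k) i / sqrt (real d) else 0)\<^sup>2) = 1 / real d * (\<Sum>i<d. (w (t * b + k) i)\<^sup>2)"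
      "(\<Sum>i<d. (if t < T \<and> k < b \<and> i < d then w (t * b + k) i / sqrt (real d) else 0) * g i) = (\<Sum>i<d. (g i / sqrt (real d)) * w (t * b + k) i)"
      unfolding sum_distrib_left by (auto intro!: sum.cong simp: power_divide)
    then show "exp (- (\<Sum>i<d. (if t < T \<and> k < b \<and> i < d then w (t * b + k) i / sqrt (real d) else 0)\<^sup>2)) *
       (sin (\<Sum>i<d. (if t < T \<and> k < b \<and> i < d then w (t * b + k) i / sqrt (real d) else 0) * g i))\<^sup>2 = direction_signal d g (w (t * b + k))"
      by (simp add: direction_signal_def)
  qed
  then have pt: "?S (flatten (T * b) d w) = (\<Sum>r<T * b. direction_signal d g (w r))" for w
    using sum_blocks[of "\<lambda>r. direction_signal d g (w r)" b T] by simp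
  have eq: "(?S (flatten (T * b) d w) - real (T * b) * p)\<^sup>2 = (\<Sum>r<T * b. direction_signal d g (w r) - p) * (\<Sum>r<T * b. direction_signal d g (w r) - p)" for w
    unfolding pt power2_eq_square by (simp add: sum_subtractf)
  have int1: "integrable ?N (direction_signal d g)"
    by (rule integrable_bounded_std_normal_vector[OF direction_signal_measurable, where B=1])
       (use direction_signal_bounds[of d g] in \<open>simp add: abs_le_iff order.trans[of _ 0]\<close>)
  have int2: "integrable ?N (\<lambda>w. (direction_signal d g w)\<^sup>2)"
  proof (rule integrable_bounded_std_normal_vector[where B=1])
    show "\<bar>(direction_signal d g w)\<^sup>2\<bar> \<le> 1" for w
      using direction_signal_bounds[of d g w] by (simp add: power_le_one)
  qed (use direction_signal_measurable[of d g] in measurable)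
  have sq: "(direction_signal d g w - p) * (direction_signal d g w - p) = (direction_signal d g w)\<^sup>2 - 2 * p * direction_signal d g w + p\<^sup>2" for w
    by (simp add: power2_eq_square algebra_simps)
  have int: "integrable ?N (\<lambda>w. direction_signal d g w - p)" "integrable ?N (\<lambda>w. (direction_signal d g w - p) * (direction_signal d g w - p))"
    unfolding sq using int1 int2 by simp_all
  have zero: "(\<integral>w. direction_signal d g w - p \<partial>?N) = 0"
    using int1 by (simp add: p_def N.prob_space)
  have var: "(\<integral>w. (direction_signal d g w - p) * (direction_signal d g w - p) \<partial>?N) \<le> 9 * p\<^sup>2"
  proof -
    have "(\<integral>w. (direction_signal d g w - p) * (direction_signal d g w - p) \<partial>?N) = (\<integral>w. (direction_signal d g w)\<^sup>2 \<partial>?N) - 2 * p * p + p\<^sup>2"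
      unfolding sq using int1 int2 by (simp add: N.prob_space p_def)
    also have "\<dots> \<le> (\<integral>w. (direction_signal d g w)\<^sup>2 \<partial>?N)" by (simp add: power2_eq_square)
    finally show ?thesis using direction_signal_moments(2)[OF d, of g] by (simp add: p_def)
  qed
  note c = PiM_covariance_sum[where M="\<lambda>_. ?N" and I="{..<T * b}" and J="{..<T * b}" and h="\<lambda>_ w. direction_signal d g w - p" and k="\<lambda>_ w. direction_signal d g w - p",
      OF prob_space_std_normal_vector finite_lessThan subset_refl int(1) int(1) int(2) zero]
  show "integrable (gaussian_coin (T * b) d) (\<lambda>u. (?S u - real (T * b) * p)\<^sup>2)"
    unfolding gaussian_coin_def by (subst integrable_distr_eq[OF flatten_measurable Sm2]) (simp only: eq c)
  have "(\<integral>u. (?S u - real (T * b) * p)\<^sup>2 \<partial>gaussian_coin (T * b) d) = (\<integral>w. (?S (flatten (T * b) d w) - real (T * b) * p)\<^sup>2 \<partial>?P)"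
    unfolding gaussian_coin_def by (rule integral_distr[OF flatten_measurable Sm2])
  also have "\<dots> = (\<Sum>r<T * b. \<integral>w. (direction_signal d g w - p) * (direction_signal d g w - p) \<partial>?N)"
    unfolding eq by (rule c)
  also have "\<dots> \<le> real (T * b) * (9 * p\<^sup>2)" using var by (simp add: mult_left_mono)
  finally show "(\<integral>u. (?S u - real (T * b) * p)\<^sup>2 \<partial>gaussian_coin (T * b) d) \<le> real (T * b) * (9 * p\<^sup>2)" .
qed

section \<open>Private-coin protocols\<close>

lemma decision_code_iff:
  "((if P then 1 else 0) = (1 :: nat)) = P" "((if P then 1 else 0) = (0 :: nat)) = (\<not> P)"
  by auto

text \<open>
  After division by the noise level each machine observes a unit-variance Gaussian vector whose mean has
  this squared norm.
\<close>

definition energy :: "nat \<Rightarrow> nat \<Rightarrow> nat \<Rightarrow> (nat \<Rightarrow> real) \<Rightarrow> real" where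
  "energy n m d f = (\<Sum>i<d. (f i / noise_level n m)\<^sup>2)"

text \<open>
  The form in which the existence of a test passes from the separate regimes to the two kinds of
  protocols; the null and the alternative each get half of the risk.
\<close>

definition private_separates :: "nat \<Rightarrow> nat \<Rightarrow> nat \<Rightarrow> nat \<Rightarrow> real \<Rightarrow> ((nat \<Rightarrow> real) \<Rightarrow> bool) \<Rightarrow> bool" where
  "private_separates n m d b \<epsilon> A \<longleftrightarrow> (\<exists>b' s rej. b' \<le> b \<and>
     (\<forall>j r. (\<lambda>x. s j x r) \<in> borel_measurable (Rn d)) \<and> (\<forall>j x r. \<bar>s j x r\<bar> \<le> 1) \<and>
     measure (transcript_law n m d b' s (\<lambda>i\<in>{..<d}. 0)) {y \<in> \<Pi>\<^sub>E j\<in>{..<m}. {..<2 ^ b'}. rej y} \<le> \<epsilon> \<and>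
     (\<forall>f. A f \<longrightarrow> measure (transcript_law n m d b' s f) {y \<in> \<Pi>\<^sub>E j\<in>{..<m}. {..<2 ^ b'}. \<not> rej y} \<le> \<epsilon>))"

definition public_separates :: "nat \<Rightarrow> nat \<Rightarrow> nat \<Rightarrow> nat \<Rightarrow> real \<Rightarrow> ((nat \<Rightarrow> real) \<Rightarrow> bool) \<Rightarrow> bool" where
  "public_separates n m d b \<epsilon> A \<longleftrightarrow> (\<exists>b' s rej (U :: (nat \<Rightarrow> real) measure). b' \<le> b \<and> prob_space U \<and>
     (\<forall>j r. (\<lambda>x. s j x r) \<in> borel_measurable (Rn d \<Otimes>\<^sub>M U)) \<and> (\<forall>j x r. \<bar>s j x r\<bar> \<le> 1) \<and>
     (\<integral>u. measure (transcript_law n m d b' (\<lambda>j x. s j (x, u)) (\<lambda>i\<in>{..<d}. 0)) {y \<in> \<Pi>\<^sub>E j\<in>{..<m}. {..<2 ^ b'}. rej y} \<partial>U) \<le> \<epsilon> \<and>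
     (\<forall>f. A f \<longrightarrow> (\<integral>u. measure (transcript_law n m d b' (\<lambda>j x. s j (x, u)) f) {y \<in> \<Pi>\<^sub>E j\<in>{..<m}. {..<2 ^ b'}. \<not> rej y} \<partial>U) \<le> \<epsilon>))"

lemma private_separates_imp_public_separates:
  assumes "private_separates n m d b \<epsilon> A"
  shows "public_separates n m d b \<epsilon> A"
proof -
  obtain b' s rej where *: "b' \<le> b" "\<And>j r. (\<lambda>x. s j x r) \<in> borel_measurable (Rn d)" "\<And>j x r. \<bar>s j x r\<bar> \<le> 1"
    "measure (transcript_law n m d b' s (\<lambda>i\<in>{..<d}. 0)) {y \<in> \<Pi>\<^sub>E j\<in>{..<m}. {..<2 ^ b'}. rej y} \<le> \<epsilon>"
    "\<And>f. A f \<Longrightarrow> measure (transcript_law n m d b' s f) {y \<in> \<Pi>\<^sub>E j\<in>{..<m}. {..<2 ^ b'}. \<not> rej y} \<le> \<epsilon>"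
    using assms unfolding private_separates_def by blast
  let ?U = "std_normal_vector 0"
  let ?s = "\<lambda>j (x :: (nat \<Rightarrow> real) \<times> (nat \<Rightarrow> real)). s j (fst x)"
  \<comment> \<open>In dimension zero the Gaussian law lives on a single point: the trivial coin.\<close>
  interpret U: prob_space ?U by (rule prob_space_std_normal_vector)
  have "(\<lambda>x. ?s j x r) \<in> borel_measurable (Rn d \<Otimes>\<^sub>M ?U)" for j r
    by (rule measurable_compose[OF measurable_fst *(2)])
  then show ?thesis
    unfolding public_separates_def
    by (intro exI[of _ b'] exI[of _ ?s] exI[of _ rej] exI[of _ ?U]) (use * in \<open>simp add: U.prob_space U.prob_space_axioms\<close>)
qed

lemma testing_risk_le:
  assumes d: "1 \<le> d" and \<rho>: "0 < \<rho>"
    and null: "measure (P (\<lambda>i\<in>{..<d}. 0)) {\<omega> \<in> space (P (\<lambda>i\<in>{..<d}. 0)). \<phi> \<omega> = 1} \<le> \<epsilon>"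
    and alt: "\<And>f. f \<in> alternative d \<rho> \<Longrightarrow> measure (P f) {\<omega> \<in> space (P f). \<phi> \<omega> = 0} \<le> \<epsilon>"
  shows "testing_risk d P \<phi> (alternative d \<rho>) \<le> 2 * \<epsilon>"
proof -
  let ?f = "\<lambda>i\<in>{..<d}. if i = 0 then \<rho> else 0"
  have "?f 0 \<le> L2_set ?f {..<d}" using d by (intro member_le_L2_set) auto
  then have "?f \<in> alternative d \<rho>" using d by (simp add: alternative_def)
  then have "(SUP f\<in>alternative d \<rho>. measure (P f) {\<omega> \<in> space (P f). \<phi> \<omega> = 0}) \<le> \<epsilon>"
    by (intro cSUP_least alt) auto
  then show ?thesis using null unfolding testing_risk_def Let_def by linarith
qed

lemma private_protocol_exists:
  assumes d: "1 \<le> d" and sep: "private_separates n m d b \<epsilon> A"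
  shows "\<exists>T \<in> (private_protocols m d b :: private_test set). \<forall>\<rho>::real. \<rho> > 0 \<longrightarrow> (\<forall>f\<in>alternative d \<rho>. A f) \<longrightarrow>
     private_risk n m d (alternative d \<rho>) T \<le> 2 * \<epsilon>"
proof -
  obtain b' s rej where *: "b' \<le> b" "\<And>j r. (\<lambda>x. s j x r) \<in> borel_measurable (Rn d)" "\<And>j x r. \<bar>s j x r\<bar> \<le> 1"
    "measure (transcript_law n m d b' s (\<lambda>i\<in>{..<d}. 0)) {y \<in> \<Pi>\<^sub>E j\<in>{..<m}. {..<2 ^ b'}. rej y} \<le> \<epsilon>"
    "\<And>f. A f \<Longrightarrow> measure (transcript_law n m d b' s f) {y \<in> \<Pi>\<^sub>E j\<in>{..<m}. {..<2 ^ b'}. \<not> rej y} \<le> \<epsilon>"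
    using sep unfolding private_separates_def by blast
  note law = measure_private_bits[where s=s and b=b' and n=n and m=m and rej=rej, OF *(2,3)]
  show ?thesis
  proof (intro bexI[of _ "private_bits b' s rej"] allI impI)
    show "private_bits b' s rej \<in> private_protocols m d b" by (rule private_bits_in_private_protocols[OF *(1-3)])
    fix \<rho> :: real assume \<rho>: "0 < \<rho>" and A: "\<forall>f\<in>alternative d \<rho>. A f"
    show "private_risk n m d (alternative d \<rho>) (private_bits b' s rej) \<le> 2 * \<epsilon>"
      unfolding private_risk_def
    proof (rule testing_risk_le[OF d \<rho>])
      show "measure (private_law n m d (private_bits b' s rej) (\<lambda>i\<in>{..<d}. 0))
        {\<omega> \<in> space (private_law n m d (private_bits b' s rej) (\<lambda>i\<in>{..<d}. 0)). (\<lambda>(x, y). decision (private_bits b' s rej) y) \<omega> = 1} \<le> \<epsilon>"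
        unfolding law decision_code_iff by (rule *(4))
      fix f assume "f \<in> alternative d \<rho>"
      then have "A f" using A by blast
      then show "measure (private_law n m d (private_bits b' s rej) f)
        {\<omega> \<in> space (private_law n m d (private_bits b' s rej) f). (\<lambda>(x, y). decision (private_bits b' s rej) y) \<omega> = 0} \<le> \<epsilon>"
        unfolding law decision_code_iff by (rule *(5))
    qed
  qed
qed

lemma public_protocol_exists:
  assumes d: "1 \<le> d" and sep: "public_separates n m d b \<epsilon> A"
  shows "\<exists>T \<in> (public_protocols m d b :: public_test set). \<forall>\<rho>::real. \<rho> > 0 \<longrightarrow> (\<forall>f\<in>alternative d \<rho>. A f) \<longrightarrow>
     public_risk n m d (alternative d \<rho>) T \<le> 2 * \<epsilon>"
proof -
  obtain b' s rej and U :: "(nat \<Rightarrow> real) measure" where *: "b' \<le> b" "prob_space U"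
    "\<And>j r. (\<lambda>x. s j x r) \<in> borel_measurable (Rn d \<Otimes>\<^sub>M U)" "\<And>j x r. \<bar>s j x r\<bar> \<le> 1"
    "(\<integral>u. measure (transcript_law n m d b' (\<lambda>j x. s j (x, u)) (\<lambda>i\<in>{..<d}. 0)) {y \<in> \<Pi>\<^sub>E j\<in>{..<m}. {..<2 ^ b'}. rej y} \<partial>U) \<le> \<epsilon>"
    "\<And>f. A f \<Longrightarrow> (\<integral>u. measure (transcript_law n m d b' (\<lambda>j x. s j (x, u)) f) {y \<in> \<Pi>\<^sub>E j\<in>{..<m}. {..<2 ^ b'}. \<not> rej y} \<partial>U) \<le> \<epsilon>"
    using sep unfolding public_separates_def by blast
  note law = measure_public_bits[where s=s and b=b' and n=n and m=m and rej=rej, OF *(2-4)]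
  show ?thesis
  proof (intro bexI[of _ "public_bits b' s U rej"] allI impI)
    show "public_bits b' s U rej \<in> public_protocols m d b" by (rule public_bits_in_public_protocols[OF *(1-4)])
    fix \<rho> :: real assume \<rho>: "0 < \<rho>" and A: "\<forall>f\<in>alternative d \<rho>. A f"
    show "public_risk n m d (alternative d \<rho>) (public_bits b' s U rej) \<le> 2 * \<epsilon>"
      unfolding public_risk_def
    proof (rule testing_risk_le[OF d \<rho>])
      show "measure (public_law n m d (public_bits b' s U rej) (\<lambda>i\<in>{..<d}. 0))
        {\<omega> \<in> space (public_law n m d (public_bits b' s U rej) (\<lambda>i\<in>{..<d}. 0)). (\<lambda>(x, y, u). decision (public_bits b' s U rej) y) \<omega> = 1} \<le> \<epsilon>"
        unfolding law decision_code_iff by (rule *(5))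
      fix f assume "f \<in> alternative d \<rho>"
      then have "A f" using A by blast
      then show "measure (public_law n m d (public_bits b' s U rej) f)
        {\<omega> \<in> space (public_law n m d (public_bits b' s U rej) f). (\<lambda>(x, y, u). decision (public_bits b' s U rej) y) \<omega> = 0} \<le> \<epsilon>"
        unfolding law decision_code_iff by (rule *(6))
    qed
  qed
qed

lemma energy_alternative:
  assumes nm: "1 \<le> n" "1 \<le> m" and \<rho>: "0 < \<rho>" and f: "f \<in> alternative d \<rho>"
  shows "\<rho>\<^sup>2 * real n / real m \<le> energy n m d f"
proof -
  have "\<rho> \<le> sqrt (\<Sum>i<d. (f i)\<^sup>2)" using f by (simp add: alternative_def L2_set_def)
  then have "\<rho>\<^sup>2 \<le> (sqrt (\<Sum>i<d. (f i)\<^sup>2))\<^sup>2" using \<rho> by (intro power_mono) auto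
  then have "\<rho>\<^sup>2 \<le> (\<Sum>i<d. (f i)\<^sup>2)" by (simp add: sum_nonneg)
  then have "\<rho>\<^sup>2 * (real n / real m) \<le> (\<Sum>i<d. (f i)\<^sup>2) * (real n / real m)" by (intro mult_right_mono) auto
  also have "\<dots> = energy n m d f"
    using nm by (simp add: energy_def power_divide sum_distrib_right sum_divide_distrib)
  finally show ?thesis by simp
qed

lemma threshold_separates:
  assumes nm: "1 \<le> n" "1 \<le> m" "1 \<le> d" "1 \<le> b" and \<epsilon>: "0 < \<epsilon>" "\<epsilon> \<le> 1"
  shows "private_separates n m d b \<epsilon> (\<lambda>f. 40 / \<epsilon> * sqrt (real d) \<le> energy n m d f)"
proof -
  define t where "t = 20 / \<epsilon>"
  have t: "20 \<le> t" "0 < t" "20 / t = \<epsilon>" using \<epsilon> by (auto simp: t_def field_simps)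
  let ?s = "\<lambda>j. threshold_bit d (noise_level n m) t"
  have s: "\<And>j r. (\<lambda>x. ?s j x r) \<in> borel_measurable (Rn d)" "\<And>j x r. \<bar>?s j x r\<bar> \<le> 1"
    by (rule threshold_bit_measurable, rule abs_threshold_bit_le)
  note test = threshold_test[where s="?s" and b=1, OF nm(1-3) order.refl s refl t(2)]
  have "2 / t\<^sup>2 \<le> 20 / t" using t(1) by (simp add: divide_simps power2_eq_square)
  then have 1: "2 / t\<^sup>2 \<le> \<epsilon>" by (simp only: t(3))
  have "4 / t\<^sup>2 \<le> 4 / t" using t(1) by (simp add: divide_simps power2_eq_square)
  moreover have "4 / t + 16 / t = 20 / t" by (simp add: add_divide_distrib[symmetric])
  ultimately have 2: "4 / t\<^sup>2 + 16 / t \<le> \<epsilon>" unfolding t(3)[symmetric] by linarith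
  show ?thesis
    unfolding private_separates_def
  proof (intro exI[of _ 1] exI[of _ ?s] exI[of _ "\<lambda>y. bit (y 0) 0"] conjI allI impI)
    show "(1::nat) \<le> b" by fact
    show "measure (transcript_law n m d 1 ?s (\<lambda>i\<in>{..<d}. 0)) {y \<in> \<Pi>\<^sub>E j\<in>{..<m}. {..<2 ^ 1}. bit (y 0) 0} \<le> \<epsilon>"
      using test(1) 1 by linarith
    fix f assume "40 / \<epsilon> * sqrt (real d) \<le> energy n m d f"
    then have "2 * t * sqrt (real d) \<le> (\<Sum>i<d. (f i / noise_level n m)\<^sup>2)" by (simp add: t_def energy_def)
    from test(2)[OF this] 2
    show "measure (transcript_law n m d 1 ?s f) {y \<in> \<Pi>\<^sub>E j\<in>{..<m}. {..<2 ^ 1}. \<not> bit (y 0) 0} \<le> \<epsilon>" by linarith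
  qed (rule s)+
qed

lemma arctan_separates:
  assumes nm: "1 \<le> n" "1 \<le> m" "1 \<le> d" "1 \<le> b" and \<epsilon>: "0 < \<epsilon>" "\<epsilon> \<le> 1"
  shows "private_separates n m d b \<epsilon> (\<lambda>f. 4000000 / \<epsilon> \<le> sqrt (real m) * min 1 (energy n m d f / sqrt (real d)))"
proof -
  define L where "L = 2 / \<epsilon>"
  have L: "0 < L" "1 / L\<^sup>2 \<le> \<epsilon>" using \<epsilon> by (auto simp: L_def power_divide power2_eq_square field_simps)
  let ?s = "\<lambda>j. arctan_bit d (noise_level n m)"
  have s: "\<And>j r. (\<lambda>x. ?s j x r) \<in> borel_measurable (Rn d)" "\<And>j x r. \<bar>?s j x r\<bar> \<le> 1"
    by (rule arctan_bit_measurable, rule abs_arctan_bit_le)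
  let ?rej = "\<lambda>y. real (m - 0) * arctan_null_mean d + L * sqrt (real (m - 0)) < (\<Sum>j\<in>{0..<m}. bit_sign (y j) 0)"
  have m0: "0 < m" using nm by simp
  note test = arctan_test[where s="?s" and b=1 and ?j0.0=0, OF nm(1-3) order.refl m0 s refl L(1)]
  show ?thesis
    unfolding private_separates_def
  proof (intro exI[of _ 1] exI[of _ ?s] exI[of _ ?rej] conjI allI impI)
    show "(1::nat) \<le> b" by fact
    show "measure (transcript_law n m d 1 ?s (\<lambda>i\<in>{..<d}. 0)) {y \<in> \<Pi>\<^sub>E j\<in>{..<m}. {..<2 ^ 1}. ?rej y} \<le> \<epsilon>"
      using test(1) L(2) by (rule order.trans)
    fix f assume "4000000 / \<epsilon> \<le> sqrt (real m) * min 1 (energy n m d f / sqrt (real d))"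
    then have "2000000 * L \<le> sqrt (real (m - 0)) * min 1 ((\<Sum>i<d. (f i / noise_level n m)\<^sup>2) / sqrt (real d))"
      by (simp add: L_def energy_def)
    from test(2)[OF this] L(2)
    show "measure (transcript_law n m d 1 ?s f) {y \<in> \<Pi>\<^sub>E j\<in>{..<m}. {..<2 ^ 1}. \<not> ?rej y} \<le> \<epsilon>" by (rule order.trans)
  qed (rule s)+
qed

text \<open>
  The standard basis followed by the Hartley basis; the zero vectors afterwards fill up the last group.
\<close>

definition two_bases :: "nat \<Rightarrow> nat \<Rightarrow> nat \<Rightarrow> real" where
  "two_bases d r i = (if r < d then if i = r then 1 else 0 else if r < 2 * d then hartley d (r - d) i else 0)"

lemma two_bases_norm: "(\<Sum>i<d. (two_bases d r i)\<^sup>2) \<le> 1"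
proof -
  consider "r < d" | "\<not> r < d" "r < 2 * d" | "\<not> r < 2 * d" by linarith
  then show ?thesis
  proof cases
    case 2
    then have "(\<Sum>i<d. (two_bases d r i)\<^sup>2) = (\<Sum>i<d. hartley d (r - d) i * hartley d (r - d) i)"
      by (simp add: two_bases_def power2_eq_square)
    then show ?thesis using 2 hartley_orthonormal[of "r - d" d "r - d"] by simp
  qed (simp_all add: two_bases_def if_distrib[of "\<lambda>x. x\<^sup>2"] cong: if_cong)
qed

text \<open>
  Only inner products across the two bases are nonzero, and these are single Hartley entries.
\<close>

lemma two_bases_coherence:
  assumes "r \<noteq> r'"
  shows "(\<Sum>i<d. two_bases d r i * two_bases d r' i)\<^sup>2 \<le> 2 / real d"
proof -
  have mixed: "(\<Sum>i<d. two_bases d r i * two_bases d r' i)\<^sup>2 \<le> 2 / real d" if "r < d" "\<not> r' < d" for r r'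
  proof -
    have "(\<Sum>i<d. two_bases d r i * two_bases d r' i) = two_bases d r' r"
      using that by (simp add: two_bases_def if_distrib[of "\<lambda>x. x * _"] cong: if_cong)
    moreover have "(two_bases d r' r)\<^sup>2 \<le> 2 / real d"
      using that hartley_sq_le[of d "r' - d" r] by (simp add: two_bases_def)
    ultimately show ?thesis by simp
  qed
  consider "r < d" "r' < d" | "r < d" "\<not> r' < d" | "\<not> r < d" "r' < d" | "\<not> r < d" "\<not> r' < d" by blast
  then show ?thesis
  proof cases
    case 1
    then have "(\<Sum>i<d. two_bases d r i * two_bases d r' i) = 0"
      using assms by (intro sum.neutral) (auto simp: two_bases_def)
    then show ?thesis by simp
  next
    case 2
    then show ?thesis by (rule mixed)
  next
    case 3
    then show ?thesis using mixed[of r' r] by (simp add: mult.commute)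
  next
    case 4
    have "(\<Sum>i<d. two_bases d r i * two_bases d r' i) = 0"
    proof (cases "r < 2 * d \<and> r' < 2 * d")
      case True
      then have "(\<Sum>i<d. two_bases d r i * two_bases d r' i) = (\<Sum>i<d. hartley d (r - d) i * hartley d (r' - d) i)"
        using 4 by (simp add: two_bases_def)
      also have "\<dots> = 0" using True 4 assms hartley_orthonormal[of "r - d" d "r' - d"] by auto
      finally show ?thesis .
    qed (auto simp: two_bases_def intro!: sum.neutral)
    then show ?thesis by simp
  qed
qed

lemma gram_bound_two_bases:
  assumes d: "1 \<le> d" "b \<le> d"
  shows "gram_bound d T b (\<lambda>t k. two_bases d (t * b + k)) \<le> 3 * real (T * b)"
proof -
  have "gram_bound d T b (\<lambda>t k. two_bases d (t * b + k)) \<le> (\<Sum>t<T. \<Sum>k<b. 3)"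
    unfolding gram_bound_def
  proof (intro sum_mono)
    fix t k assume k: "k \<in> {..<b}"
    have "(\<Sum>l<b. if k = l then 1 else (\<Sum>i<d. two_bases d (t * b + k) i * two_bases d (t * b + l) i)\<^sup>2)
        \<le> (\<Sum>l<b. (if k = l then 1 else 0) + 2 / real d)"
      by (intro sum_mono) (auto intro!: two_bases_coherence)
    also have "\<dots> = 1 + 2 * (real b / real d)" using k by (simp add: sum.distrib)
    also have "\<dots> \<le> 3"
    proof -
      have "real b / real d \<le> 1" using d by simp
      then show ?thesis by linarith
    qed
    finally show "(\<Sum>l<b. if k = l then 1 else (\<Sum>i<d. two_bases d (t * b + k) i * two_bases d (t * b + l) i)\<^sup>2) \<le> 3" .
  qed
  then show ?thesis by simp
qed

lemma signal_two_bases: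
  fixes g :: "nat \<Rightarrow> real" and d T b :: nat
  defines "G \<equiv> (\<Sum>i<d. (g i)\<^sup>2)"
  assumes T: "2 * d \<le> T * b" and small: "4 * G \<le> sqrt (real d)"
  shows "G / 16 \<le> signal d T b (\<lambda>t k. two_bases d (t * b + k)) g"
proof -
  define S where "S r = exp (- (\<Sum>i<d. (two_bases d r i)\<^sup>2)) * (sin (\<Sum>i<d. two_bases d r i * g i))\<^sup>2" for r
  let ?h = "\<lambda>k. \<Sum>i<d. hartley d k i * g i"
  have S0: "0 \<le> S r" for r by (simp add: S_def)
  have S1: "(sin (\<Sum>i<d. two_bases d r i * g i))\<^sup>2 / 3 \<le> S r" for r
  proof -
    have "1 / 3 \<le> exp (- 1 :: real)" using exp_le by (simp add: exp_minus field_simps)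
    also have "\<dots> \<le> exp (- (\<Sum>i<d. (two_bases d r i)\<^sup>2))" using two_bases_norm[of d r] by simp
    finally have "1 / 3 * (sin (\<Sum>i<d. two_bases d r i * g i))\<^sup>2 \<le> S r" unfolding S_def by (intro mult_right_mono) auto
    then show ?thesis by simp
  qed
  have half: "(\<Sum>i | i < d \<and> \<bar>x i\<bar> \<le> 1. (x i)\<^sup>2) / 2 \<le> (\<Sum>i<d. (sin (x i))\<^sup>2)" for x :: "nat \<Rightarrow> real"
  proof -
    have "(\<Sum>i | i < d \<and> \<bar>x i\<bar> \<le> 1. (x i)\<^sup>2) / 2 \<le> (\<Sum>i | i < d \<and> \<bar>x i\<bar> \<le> 1. (sin (x i))\<^sup>2)"
      unfolding sum_divide_distrib by (intro sum_mono sin_sq_lower_bound) auto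
    also have "\<dots> \<le> (\<Sum>i<d. (sin (x i))\<^sup>2)" by (intro sum_mono2) auto
    finally show ?thesis .
  qed
  have "3 / 8 * G \<le> (\<Sum>i | i < d \<and> \<bar>g i\<bar> \<le> 1. (g i)\<^sup>2) + (\<Sum>k | k < d \<and> \<bar>?h k\<bar> \<le> 1. (?h k)\<^sup>2)"
    unfolding G_def by (rule hartley_uncertainty) (use small in \<open>simp add: G_def\<close>)
  then have "3 / 16 * G \<le> (\<Sum>i<d. (sin (g i))\<^sup>2) + (\<Sum>k<d. (sin (?h k))\<^sup>2)"
    using half[of g] half[of ?h] by linarith
  moreover have "(\<Sum>i<d. (sin (g i))\<^sup>2) / 3 \<le> (\<Sum>r<d. S r)"
    unfolding sum_divide_distrib
  proof (intro sum_mono)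
    fix r assume "r \<in> {..<d}"
    then have "(\<Sum>i<d. two_bases d r i * g i) = g r"
      by (simp add: two_bases_def if_distrib[of "\<lambda>x. x * _"] cong: if_cong)
    then show "(sin (g r))\<^sup>2 / 3 \<le> S r" using S1[of r] by simp
  qed
  moreover have "(\<Sum>k<d. (sin (?h k))\<^sup>2) / 3 \<le> (\<Sum>k<d. S (d + k))"
    unfolding sum_divide_distrib
  proof (intro sum_mono)
    fix k assume "k \<in> {..<d}"
    then have "(\<Sum>i<d. two_bases d (d + k) i * g i) = ?h k"
      by (simp add: two_bases_def)
    then show "(sin (?h k))\<^sup>2 / 3 \<le> S (d + k)" using S1[of "d + k"] by simp
  qed
  moreover have "(\<Sum>r<d. S r) + (\<Sum>k<d. S (d + k)) = (\<Sum>r<2 * d. S r)"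
  proof -
    have u: "{..<2 * d} = {..<d} \<union> {d..<d + d}" by auto
    have "(\<Sum>r<2 * d. S r) = (\<Sum>r<d. S r) + (\<Sum>r\<in>{d..<d + d}. S r)"
      unfolding u by (rule sum.union_disjoint) auto
    also have "(\<Sum>r\<in>{d..<d + d}. S r) = (\<Sum>k<d. S (d + k))"
      using sum.shift_bounds_nat_ivl[of S 0 d d] by (simp add: lessThan_atLeast0 add.commute)
    finally show ?thesis by simp
  qed
  moreover have "(\<Sum>r<2 * d. S r) \<le> (\<Sum>r<T * b. S r)" using T S0 by (intro sum_mono2) auto
  moreover have "(\<Sum>r<T * b. S r) = signal d T b (\<lambda>t k. two_bases d (t * b + k)) g"
    unfolding signal_def S_def[symmetric] by (rule sum_blocks[symmetric])
  ultimately show ?thesis by linarith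
qed

lemma block_count:
  fixes d b :: nat
  assumes "1 \<le> b" "b \<le> d"
  defines "T \<equiv> (2 * d + b - 1) div b"
  shows "2 * d \<le> T * b" "T * b \<le> 3 * d" "1 \<le> T"
proof -
  have "T * b + (2 * d + b - 1) mod b = 2 * d + b - 1" by (simp add: T_def)
  moreover have "(2 * d + b - 1) mod b < b" using assms by simp
  ultimately show 1: "2 * d \<le> T * b" "T * b \<le> 3 * d" using assms by linarith+
  show "1 \<le> T" using 1(1) assms(1,2) by (cases "T = 0") auto
qed

text \<open>
  Rounding down a quotient that is at least \<open>1\<close> loses at most a factor of two.
\<close>

lemma quotient_lower_bound:
  fixes m N :: nat
  assumes "1 \<le> N" "N \<le> m"
  shows "1 \<le> m div N" "real m / (2 * real N) \<le> real (m div N)" "N * (m div N) \<le> m"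
proof -
  show 1: "1 \<le> m div N" using assms by (simp add: Suc_le_eq div_greater_zero_iff)
  have "m = N * (m div N) + m mod N" "m mod N < N" using assms by auto
  then have "m \<le> N * (m div N) + N * 1" by linarith
  also have "\<dots> \<le> 2 * N * (m div N)" using mult_le_mono2[OF 1, of N] by simp
  finally have "real m \<le> real (2 * N * (m div N))" by (simp only: of_nat_le_iff)
  then show "real m / (2 * real N) \<le> real (m div N)" using assms by (simp add: field_simps)
qed simp

text \<open>
  Each machine reports on \<open>b\<close> of the \<open>2 * d\<close> directions of two orthonormal bases, using at most half of
  the machines; the others send the smoothed chi-square bit. For energy up to \<open>sqrt d / 4\<close> the uncertainty
  principle guarantees the signal of the first part; above, the second part detects it. With
  \<open>q \<ge> m * b / (24 * d)\<close> machines per direction and half, signal at least \<open>G / 16\<close> and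
  \<open>L = 90 / \<epsilon>\<close>, the requirement \<open>4 * L * sqrt d \<le> q * G / 16\<close> leads to the constant
  \<open>138240 = 4 * 90 * 24 * 16\<close>.
\<close>

lemma fixed_directions_separate:
  assumes nm: "1 \<le> n" "1 \<le> d" "1 \<le> b" "b \<le> d" and \<epsilon>: "0 < \<epsilon>" "\<epsilon> \<le> 1"
    and m: "100000000 / \<epsilon> \<le> sqrt (real m)" and db: "real d / real b \<le> sqrt (real m)"
  shows "private_separates n m d b \<epsilon> (\<lambda>f. 138240 / \<epsilon> * (sqrt (real d) * real d / (real m * real b)) \<le> energy n m d f)"
proof -
  define T where "T = (2 * d + b - 1) div b"
  define q where "q = m div (4 * T)"
  define j0 where "j0 = 2 * (T * q)"
  define L where "L = 90 / \<epsilon>"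
  define LA where "LA = 2 / \<epsilon>"
  define \<sigma> where "\<sigma> = noise_level n m"
  have L: "1 \<le> L" "15 * 3 / L = \<epsilon> / 2" using \<epsilon> by (auto simp: L_def field_simps)
  have LA: "0 < LA" "1 / LA\<^sup>2 \<le> \<epsilon> / 2" using \<epsilon> by (auto simp: LA_def power_divide power2_eq_square field_simps)
  note T = block_count[OF nm(3,4), folded T_def]
  have bd: "0 < real b" "0 < real d" using nm by auto
  have Tb: "real T * real b \<le> 3 * real d" using T(2) by (metis of_nat_le_iff of_nat_mult of_nat_numeral)
  have sm: "100000000 \<le> sqrt (real m)"
  proof -
    have "100000000 \<le> 100000000 / \<epsilon>" using \<epsilon> by (simp add: field_simps)
    then show ?thesis using m by linarith
  qed
  have m1: "1 \<le> m" using sm by (cases m) auto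
  \<comment> \<open>The assumption on \<open>d / b\<close> leaves at least one machine per group in each half.\<close>
  have "real T \<le> 3 * (real d / real b)" using Tb bd by (simp add: field_simps)
  also have "\<dots> \<le> 3 * sqrt (real m)" using db by simp
  finally have "4 * real T \<le> 12 * sqrt (real m)" by simp
  also have "\<dots> \<le> sqrt (real m) * sqrt (real m)" using sm by (intro mult_right_mono) auto
  finally have "real (4 * T) \<le> real m" by simp
  then have Tm: "4 * T \<le> m" by (simp only: of_nat_le_iff)
  have q: "1 \<le> q" "real m / (8 * real T) \<le> real q" "2 * j0 \<le> m"
  proof -
    have N: "1 \<le> 4 * T" using T(3) by simp
    show "1 \<le> q" unfolding q_def by (rule quotient_lower_bound(1)[OF N Tm])
    show "real m / (8 * real T) \<le> real q" using quotient_lower_bound(2)[OF N Tm] by (simp add: q_def)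
    have "2 * j0 = 4 * T * q" by (simp add: j0_def)
    then show "2 * j0 \<le> m" using quotient_lower_bound(3)[OF N Tm] by (simp only: q_def)
  qed
  have j0: "j0 < m" "2 * (T * q) \<le> m" using q(3) m1 by (auto simp: j0_def)
  define a where "a = (\<lambda>t k. two_bases d (t * b + k))"
  define s where "s j = (if j < j0 then sin_bits d \<sigma> (a (j mod T)) else arctan_bit d \<sigma>)" for j
  have s: "\<And>j r. (\<lambda>x. s j x r) \<in> borel_measurable (Rn d)" "\<And>j x r. \<bar>s j x r\<bar> \<le> 1"
    by (auto simp: s_def sin_bits_measurable arctan_bit_measurable abs_sin_bits_le abs_arctan_bit_le)
  define rS where "rS y \<longleftrightarrow> L * real q * sqrt (real (T * b)) < two_half_stat T q b y" for y
  define rA where "rA y \<longleftrightarrow> real (m - j0) * arctan_null_mean d + LA * sqrt (real (m - j0)) < (\<Sum>j\<in>{j0..<m}. bit_sign (y j) 0)" for y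
  have sj: "s j = sin_bits d (noise_level n m) (a (j mod T))" if "j < 2 * (T * q)" for j
    using that by (simp add: s_def j0_def \<sigma>_def)
  have sj': "s j = arctan_bit d (noise_level n m)" if "j0 \<le> j" "j < m" for j
    using that by (simp add: s_def \<sigma>_def)
  have F: "gram_bound d T b a \<le> 3 * real (T * b)" unfolding a_def by (rule gram_bound_two_bases[OF nm(2,4)])
  have three: "1 \<le> (3 :: real)" by simp
  note testS = sin_test[where s=s and a=a and T=T and q=q and b=b, OF nm(1) m1 s j0(2) sj q(1) T(3) nm(3) three L(1) F, folded rS_def]
  note testA = arctan_test[where s=s and b=b, OF nm(1) m1 nm(2,3) j0(1) s sj' LA(1), folded rA_def]
  have asmS: "\<And>j. j < 2 * (T * q) \<Longrightarrow> j < 2 * (T * q)" .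
  have asmA: "\<And>j. j0 \<le> j \<Longrightarrow> j < m \<Longrightarrow> j0 \<le> j" "\<And>j. j0 \<le> j \<Longrightarrow> j < m \<Longrightarrow> j < m" .
  let ?Y = "\<Pi>\<^sub>E j\<in>{..<m}. {..<(2::nat) ^ b}"
  let ?f0 = "\<lambda>i\<in>{..<d}. 0 :: real"
  have prob: "prob_space (transcript_law n m d b s f)" for f by (rule prob_space_transcript_law[OF s])
  have sets: "{y \<in> ?Y. P y} \<in> sets (transcript_law n m d b s f)" for P f
    using sets_transcript_law[where s=s and n=n and m=m and d=d and b=b and f=f] by auto
  show ?thesis
    unfolding private_separates_def
  proof (intro exI[of _ b] exI[of _ s] exI[of _ "\<lambda>y. rS y \<or> rA y"] conjI allI impI)
    have "measure (transcript_law n m d b s ?f0) {y \<in> ?Y. rS y \<or> rA y}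
        \<le> measure (transcript_law n m d b s ?f0) {y \<in> ?Y. rS y} + measure (transcript_law n m d b s ?f0) {y \<in> ?Y. rA y}"
    proof -
      have "{y \<in> ?Y. rS y \<or> rA y} = {y \<in> ?Y. rS y} \<union> {y \<in> ?Y. rA y}" by blast
      then show ?thesis using measure_Un_le[OF sets sets] by simp
    qed
    also have "\<dots> \<le> \<epsilon> / 2 + \<epsilon> / 2" using testS(1)[OF asmS] testA(1)[OF asmA] L(2) LA(2) by (intro add_mono) linarith+
    finally show "measure (transcript_law n m d b s ?f0) {y \<in> ?Y. rS y \<or> rA y} \<le> \<epsilon>" by simp
    fix f assume E: "138240 / \<epsilon> * (sqrt (real d) * real d / (real m * real b)) \<le> energy n m d f"
    let ?G = "energy n m d f"
    show "measure (transcript_law n m d b s f) {y \<in> ?Y. \<not> (rS y \<or> rA y)} \<le> \<epsilon>"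
    proof (cases "4 * ?G \<le> sqrt (real d)")
      case True
      have "?G / 16 \<le> signal d T b a (\<lambda>i. f i / noise_level n m)"
        unfolding a_def energy_def by (rule signal_two_bases[OF T(1)]) (use True in \<open>simp add: energy_def\<close>)
      moreover have "real m * real b / (24 * real d) \<le> real q"
      proof -
        have "real m * real b / (24 * real d) \<le> real m / (8 * real T)"
          using Tb bd T(3) mult_left_mono[OF Tb, of "8 * real m"] by (simp add: field_simps)
        then show ?thesis using q(2) by linarith
      qed
      moreover have "0 \<le> ?G" by (simp add: energy_def sum_nonneg)
      ultimately have "real m * real b / (24 * real d) * (?G / 16) \<le> real q * signal d T b a (\<lambda>i. f i / noise_level n m)"
        by (intro mult_mono) auto
      moreover have "2 * L * sqrt (real (T * b)) \<le> real m * real b / (24 * real d) * (?G / 16)"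
      proof -
        have "sqrt (real (T * b)) \<le> sqrt (4 * real d)" using Tb by simp
        also have "\<dots> = 2 * sqrt (real d)" by (simp add: real_sqrt_mult)
        finally have "2 * L * sqrt (real (T * b)) \<le> 2 * L * (2 * sqrt (real d))" using L by (intro mult_left_mono) auto
        also have "\<dots> = real m * real b / (24 * real d) * ((138240 / \<epsilon> * (sqrt (real d) * real d / (real m * real b))) / 16)"
          using bd m1 \<epsilon> by (simp add: L_def field_simps)
        also have "\<dots> \<le> real m * real b / (24 * real d) * (?G / 16)"
          using E by (intro mult_left_mono divide_right_mono) auto
        finally show ?thesis .
      qed
      ultimately have "2 * L * sqrt (real (T * b)) \<le> real q * signal d T b a (\<lambda>i. f i / noise_level n m)" by linarith
      from testS(2)[OF asmS this] have "measure (transcript_law n m d b s f) {y \<in> ?Y. \<not> rS y} \<le> \<epsilon>" using L(2) \<epsilon> by linarith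
      moreover have "measure (transcript_law n m d b s f) {y \<in> ?Y. \<not> (rS y \<or> rA y)} \<le> measure (transcript_law n m d b s f) {y \<in> ?Y. \<not> rS y}"
        by (rule finite_measure.finite_measure_mono[OF prob_space.finite_measure[OF prob] _ sets]) auto
      ultimately show ?thesis by linarith
    next
      case False
      have "1 / 4 \<le> min 1 (?G / sqrt (real d))"
        using False bd by (simp add: field_simps)
      moreover have "sqrt (real m) / 2 \<le> sqrt (real (m - j0))"
      proof (rule real_le_rsqrt)
        have "real m \<le> 2 * real (m - j0)" using q(3) by (simp add: of_nat_diff)
        then show "(sqrt (real m) / 2)\<^sup>2 \<le> real (m - j0)" by (simp add: power_divide)
      qed
      ultimately have "sqrt (real m) / 2 * (1 / 4) \<le> sqrt (real (m - j0)) * min 1 (?G / sqrt (real d))"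
        by (intro mult_mono) auto
      moreover have "2000000 * LA \<le> sqrt (real m) / 2 * (1 / 4)"
      proof -
        have "2000000 * LA \<le> 100000000 / \<epsilon> / 8" using \<epsilon> by (simp add: LA_def field_simps)
        also have "\<dots> \<le> sqrt (real m) / 8" using m by (intro divide_right_mono) auto
        finally show ?thesis by simp
      qed
      ultimately have "2000000 * LA \<le> sqrt (real (m - j0)) * min 1 ((\<Sum>i<d. (f i / noise_level n m)\<^sup>2) / sqrt (real d))"
        unfolding energy_def by linarith
      from testA(2)[OF asmA this] have "measure (transcript_law n m d b s f) {y \<in> ?Y. \<not> rA y} \<le> \<epsilon>" using LA(2) \<epsilon> by linarith
      moreover have "measure (transcript_law n m d b s f) {y \<in> ?Y. \<not> (rS y \<or> rA y)} \<le> measure (transcript_law n m d b s f) {y \<in> ?Y. \<not> rA y}"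
        by (rule finite_measure.finite_measure_mono[OF prob_space.finite_measure[OF prob] _ sets]) auto
      ultimately show ?thesis by linarith
    qed
  qed (use s in auto)
qed

section \<open>Public-coin protocols and the rates\<close>

text \<open>
  The number of independent groups of random directions that makes the relative variance \<open>36 / T\<close> of
  the signal at most \<open>\<epsilon> / 3\<close>.
\<close>

definition random_groups :: "real \<Rightarrow> nat" where
  "random_groups \<epsilon> = nat \<lceil>108 / \<epsilon>\<rceil>"

text \<open>
  Here \<open>270 / \<epsilon>\<^sup>2\<close> is the factor \<open>L\<close> in the threshold of the test, and \<open>288\<close> makes
  the mean of the statistic twice the threshold.
\<close>

definition random_constant :: "real \<Rightarrow> real" where
  "random_constant \<epsilon> = 288 * (270 / \<epsilon>\<^sup>2) * real (random_groups \<epsilon>)"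

lemma random_groups_ge: "0 < \<epsilon> \<Longrightarrow> 108 / \<epsilon> \<le> real (random_groups \<epsilon>)"
  unfolding random_groups_def by (simp add: of_nat_nat)

text \<open>
  All machines of a group report on the same \<open>b\<close> random directions, which captures a fraction \<open>b / d\<close> of
  the energy for every shape of the signal. Conditionally on the coin the test has small error as soon
  as the directions are nearly orthogonal and the captured signal is not far below its mean. The
  exceptional coins are handled by Markov's and Chebyshev's inequalities, inserted pointwise under the
  integral over the coin.
\<close>

lemma random_directions_separate:
  assumes nm: "1 \<le> n" "1 \<le> d" "1 \<le> b" "b \<le> d" and \<epsilon>: "0 < \<epsilon>" "\<epsilon> \<le> 1"
    and m: "random_constant \<epsilon> \<le> real m"
  shows "public_separates n m d b \<epsilon> (\<lambda>f. random_constant \<epsilon> * (real d / (real m * sqrt (real b))) \<le> energy n m d f)"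
proof -
  define T where "T = random_groups \<epsilon>"
  define K where "K = 6 / \<epsilon>"
  define L where "L = 270 / \<epsilon>\<^sup>2"
  define q where "q = m div (2 * T)"
  define D where "D = real (T * b)"
  define \<sigma> where "\<sigma> = noise_level n m"
  let ?U = "gaussian_coin (T * b) d"
  interpret U: prob_space ?U by (rule prob_space_gaussian_coin)
  have T108: "108 / \<epsilon> \<le> real T" unfolding T_def by (rule random_groups_ge[OF \<epsilon>(1)])
  have "108 \<le> 108 / \<epsilon>" using \<epsilon> by (simp add: field_simps)
  then have T1: "108 \<le> real T" using T108 by linarith
  then have T: "1 \<le> T" by (cases T) auto
  have e2: "\<epsilon>\<^sup>2 \<le> 1" using \<epsilon> by (simp add: power_le_one)
  have L: "270 \<le> L" unfolding L_def using \<epsilon> e2 by (simp add: field_simps)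
  have K: "6 \<le> K" "15 * K / L = \<epsilon> / 3" "2 / K = \<epsilon> / 3" unfolding K_def L_def using \<epsilon> by (auto simp: field_simps power2_eq_square)
  have mT: "288 * L * real T \<le> real m" using m by (simp add: random_constant_def L_def T_def)
  have bd: "0 < real b" "0 < real d" "1 \<le> real b" using nm by auto
  have D: "0 < D" "1 \<le> D" using T nm by (auto simp: D_def) (metis One_nat_def Suc_leI mult_le_mono nat_mult_1 of_nat_1 of_nat_le_iff of_nat_mult)
  have Tm: "2 * T \<le> m"
  proof -
    have "2 * real T \<le> 288 * L * real T" using L T1 by (intro mult_right_mono) auto
    then have "real (2 * T) \<le> real m" using mT by simp
    then show ?thesis by (simp only: of_nat_le_iff)
  qed
  have m1: "1 \<le> m" using Tm T by simp
  have T2: "1 \<le> 2 * T" using T by simp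
  have q: "1 \<le> q" "real m / (4 * real T) \<le> real q" "2 * (T * q) \<le> m"
    using quotient_lower_bound[OF T2 Tm] by (simp_all add: q_def mult.assoc)
  define a where "a = coin_direction d T b"
  define s where "s j = (\<lambda>(x, u) k. if j < 2 * (T * q) then sin_bits d \<sigma> (a u (j mod T)) x k else 0)" for j
  have sm: "(\<lambda>xu. s j xu r) \<in> borel_measurable (Rn d \<Otimes>\<^sub>M ?U)" for j r
  proof -
    have "(\<lambda>xu. coin_direction d T b (snd xu) t k i) \<in> borel_measurable (Rn d \<Otimes>\<^sub>M ?U)" for t k i
    proof (rule measurable_compose[OF measurable_snd])
      show "(\<lambda>u. coin_direction d T b u t k i) \<in> borel_measurable ?U"
        unfolding measurable_cong_sets[OF sets_gaussian_coin refl] by (rule coin_direction_measurable)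
    qed
    moreover have "(\<lambda>xu. fst xu i / \<sigma>) \<in> borel_measurable (Rn d \<Otimes>\<^sub>M ?U)" if "i < d" for i
      by (rule measurable_compose[OF measurable_fst scaled_component_measurable[OF that]])
    ultimately have "(\<lambda>xu. sin_bits d \<sigma> (a (snd xu) (j mod T)) (fst xu) r) \<in> borel_measurable (Rn d \<Otimes>\<^sub>M ?U)"
      unfolding sin_bits_def a_def
      by (intro measurable_compose[OF _ borel_measurable_sin] borel_measurable_sum borel_measurable_times) auto
    then show ?thesis by (simp add: s_def case_prod_beta)
  qed
  have sb: "\<bar>s j xu r\<bar> \<le> 1" for j xu r
    by (auto simp: s_def case_prod_beta abs_sin_bits_le)
  have su: "(\<lambda>x. s j (x, u) r) \<in> borel_measurable (Rn d)" for j r u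
    by (cases "j < 2 * (T * q)") (simp_all add: s_def sin_bits_measurable)
  have sj: "(\<lambda>x. s j (x, u)) = sin_bits d (noise_level n m) (a u (j mod T))" if "j < 2 * (T * q)" for j u
    using that by (auto simp: s_def \<sigma>_def)
  have asm: "\<And>j. j < 2 * (T * q) \<Longrightarrow> j < 2 * (T * q)" .
  have K1: "1 \<le> K" "1 \<le> L" using K L by linarith+
  define rej where "rej y \<longleftrightarrow> L * real q * sqrt (real (T * b)) < two_half_stat T q b y" for y
  note test = sin_test[where s="\<lambda>j x. s j (x, u)" and a="a u" and T=T and q=q and b=b for u,
      OF nm(1) m1 su sb q(3) sj q(1) T nm(3) K1, folded rej_def]
  let ?Y = "\<Pi>\<^sub>E j\<in>{..<m}. {..<(2::nat) ^ b}"
  let ?f0 = "\<lambda>i\<in>{..<d}. 0 :: real"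
  let ?P = "\<lambda>u f. transcript_law n m d b (\<lambda>j x. s j (x, u)) f"
  let ?F = "\<lambda>u. gram_bound d T b (a u)"
  have prob: "prob_space (?P u f)" for u f by (rule prob_space_transcript_law) (rule su sb)+
  have KD: "0 < K * D" using K D by simp
  have Fint: "integrable ?U (\<lambda>u. ?F u / (K * D))" "(\<integral>u. ?F u / (K * D) \<partial>?U) \<le> \<epsilon> / 3"
  proof -
    show "integrable ?U (\<lambda>u. ?F u / (K * D))" using gram_bound_coin(1)[OF nm(2,4)] by (simp add: a_def)
    have "(\<integral>u. ?F u / (K * D) \<partial>?U) = (\<integral>u. ?F u \<partial>?U) / (K * D)" by simp
    also have "\<dots> \<le> (2 * D) / (K * D)"
      using gram_bound_coin(2)[OF nm(2,4), of T] KD by (intro divide_right_mono) (auto simp: D_def a_def)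
    also have "\<dots> = 2 / K" using D by simp
    finally show "(\<integral>u. ?F u / (K * D) \<partial>?U) \<le> \<epsilon> / 3" using K by simp
  qed
  \<comment> \<open>On exceptional coins the trivial bound \<open>1\<close> is dominated by a quantity of small mean.\<close>
  have bad: "1 \<le> ?F u / (K * D)" if "\<not> ?F u \<le> K * real (T * b)" for u
    using that KD by (simp add: D_def)
  have F0: "0 \<le> ?F u / (K * D)" for u using gram_bound_nonneg[of d T b "a u"] KD by simp
  have "(\<integral>u. measure (?P u ?f0) {y \<in> ?Y. rej y} \<partial>?U) \<le> (\<integral>u. ?F u / (K * D) + \<epsilon> / 3 \<partial>?U)"
  proof (rule integral_mono')
    show "integrable ?U (\<lambda>u. ?F u / (K * D) + \<epsilon> / 3)" using Fint(1) by simp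
    fix u
    show "0 \<le> ?F u / (K * D) + \<epsilon> / 3" using F0[of u] \<epsilon> by simp
    show "measure (?P u ?f0) {y \<in> ?Y. rej y} \<le> ?F u / (K * D) + \<epsilon> / 3"
    proof (cases "?F u \<le> K * real (T * b)")
      case True
      then show ?thesis using test(1)[OF asm True] F0[of u] K(2) by linarith
    next
      case False
      then show ?thesis using bad[OF False] prob_space.prob_le_1[OF prob, of u ?f0 "{y \<in> ?Y. rej y}"] \<epsilon> by linarith
    qed
  qed
  also have "\<dots> = (\<integral>u. ?F u / (K * D) \<partial>?U) + \<epsilon> / 3"
    by (subst Bochner_Integration.integral_add[OF Fint(1)]) (simp_all add: U.prob_space)
  also have "\<dots> \<le> \<epsilon>" using Fint(2) \<epsilon> by linarith
  finally have null: "(\<integral>u. measure (?P u ?f0) {y \<in> ?Y. rej y} \<partial>?U) \<le> \<epsilon>" .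
  have alt: "(\<integral>u. measure (?P u f) {y \<in> ?Y. \<not> rej y} \<partial>?U) \<le> \<epsilon>"
    if E: "random_constant \<epsilon> * (real d / (real m * sqrt (real b))) \<le> energy n m d f" for f
  proof -
    let ?g = "\<lambda>i. f i / noise_level n m"
    define G where "G = energy n m d f"
    define p where "p = (\<integral>w. direction_signal d ?g w \<partial>std_normal_vector d)"
    let ?S = "\<lambda>u. signal d T b (a u) ?g"
    \<comment> \<open>At least \<open>1\<close> whenever the captured signal falls below half its mean.\<close>
    let ?X = "\<lambda>u. (?S u - D * p)\<^sup>2 / (D * p / 2)\<^sup>2"
    have pG: "min 1 (G / real d) / 18 \<le> p"
      unfolding p_def G_def energy_def by (rule direction_signal_moments(1)[OF nm(2)])
    have C0: "0 < random_constant \<epsilon>" unfolding random_constant_def using \<epsilon> T1 by (simp add: T_def)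
    have G0: "0 < G"
    proof -
      have "0 < random_constant \<epsilon> * (real d / (real m * sqrt (real b)))" using C0 bd m1 by simp
      then show ?thesis using E unfolding G_def by linarith
    qed
    then have p0: "0 < p" using pG bd by (smt (verit) divide_pos_pos min_def)
    have X0: "0 \<le> ?X u" for u by simp
    have Xint: "integrable ?U ?X" "(\<integral>u. ?X u \<partial>?U) \<le> \<epsilon> / 3"
    proof -
      show "integrable ?U ?X" using signal_coin(1)[OF nm(2), of T b ?g] by (simp add: a_def D_def p_def)
      have "(\<integral>u. ?X u \<partial>?U) = (\<integral>u. (?S u - D * p)\<^sup>2 \<partial>?U) / (D * p / 2)\<^sup>2" by simp
      also have "\<dots> \<le> (D * (9 * p\<^sup>2)) / (D * p / 2)\<^sup>2"
        using signal_coin(2)[OF nm(2), of T b ?g] by (intro divide_right_mono) (auto simp: a_def D_def p_def)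
      also have "\<dots> = 36 / D" using D p0 by (simp add: field_simps power2_eq_square)
      also have "\<dots> \<le> 36 / real T"
      proof (intro divide_left_mono)
        have "real T * 1 \<le> real T * real b" using bd by (intro mult_left_mono) auto
        then show "real T \<le> D" by (simp add: D_def)
      qed (use T1 D in auto)
      also have "\<dots> \<le> 36 / (108 / \<epsilon>)" using T108 \<epsilon> T1 by (intro divide_left_mono) auto
      also have "\<dots> = \<epsilon> / 3" by simp
      finally show "(\<integral>u. ?X u \<partial>?U) \<le> \<epsilon> / 3" .
    qed
    have strong: "2 * L * sqrt (real (T * b)) \<le> real q * (D * p / 2)"
    proof -
      have "288 * L * real T / sqrt (real b) \<le> real m * min 1 (G / real d)"
      proof -
        have "288 * L * real T / sqrt (real b) \<le> 288 * L * real T / 1"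
          using bd L by (intro divide_left_mono) auto
        then have "288 * L * real T / sqrt (real b) \<le> real m * 1" using mT by linarith
        moreover have "288 * L * real T / sqrt (real b) \<le> real m * (G / real d)"
        proof -
          have "288 * L * real T / sqrt (real b) = real m * ((random_constant \<epsilon> * (real d / (real m * sqrt (real b)))) / real d)"
            using bd m1 by (simp add: random_constant_def L_def T_def)
          also have "\<dots> \<le> real m * (G / real d)" using E bd by (intro mult_left_mono divide_right_mono) (auto simp: G_def)
          finally show ?thesis .
        qed
        ultimately show ?thesis by (simp add: min_def)
      qed
      then have "288 * L * real T / sqrt (real b) * (real b / 144) \<le> real m * min 1 (G / real d) * (real b / 144)"
        using bd by (intro mult_right_mono) auto
      moreover have "288 * L * real T / sqrt (real b) * (real b / 144) = 2 * L * (real T * sqrt (real b))"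
        using bd by (simp add: field_simps real_sqrt_mult_self)
      moreover have "sqrt (real (T * b)) \<le> real T * sqrt (real b)"
      proof -
        have "sqrt (real T) \<le> real T"
        proof (rule real_le_lsqrt)
          have "real T * 1 \<le> real T * real T" using T1 by (intro mult_left_mono) auto
          then show "real T \<le> (real T)\<^sup>2" by (simp add: power2_eq_square)
        qed simp
        then show ?thesis by (simp add: real_sqrt_mult mult_right_mono)
      qed
      then have "2 * L * sqrt (real (T * b)) \<le> 2 * L * (real T * sqrt (real b))" using L by (intro mult_left_mono) auto
      moreover have "real m * min 1 (G / real d) * (real b / 144) \<le> real q * (D * p / 2)"
      proof -
        have "real m * min 1 (G / real d) * (real b / 144) = (real m / (4 * real T)) * (D * (min 1 (G / real d) / 18) / 2)"
          using T1 by (simp add: D_def field_simps)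
        also have "\<dots> \<le> real q * (D * p / 2)"
          using q(2) pG D G0 bd by (intro mult_mono divide_right_mono mult_left_mono) auto
        finally show ?thesis .
      qed
      ultimately show ?thesis by linarith
    qed
    have "(\<integral>u. measure (?P u f) {y \<in> ?Y. \<not> rej y} \<partial>?U) \<le> (\<integral>u. ?F u / (K * D) + ?X u + \<epsilon> / 3 \<partial>?U)"
    proof (rule integral_mono')
      show "integrable ?U (\<lambda>u. ?F u / (K * D) + ?X u + \<epsilon> / 3)" using Fint(1) Xint(1) by simp
      fix u
      show "0 \<le> ?F u / (K * D) + ?X u + \<epsilon> / 3" using F0[of u] X0[of u] \<epsilon> by simp
      have le1: "measure (?P u f) {y \<in> ?Y. \<not> rej y} \<le> 1" by (rule prob_space.prob_le_1[OF prob])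
      show "measure (?P u f) {y \<in> ?Y. \<not> rej y} \<le> ?F u / (K * D) + ?X u + \<epsilon> / 3"
      proof (cases "?F u \<le> K * real (T * b)")
        case F: True
        show ?thesis
        proof (cases "D * p / 2 \<le> ?S u")
          case True
          then have "real q * (D * p / 2) \<le> real q * ?S u" by (intro mult_left_mono) auto
          then have "2 * L * sqrt (real (T * b)) \<le> real q * ?S u" using strong by linarith
          from test(2)[OF asm F this] show ?thesis using F0[of u] X0[of u] K(2) by linarith
        next
          case False
          then have "(D * p / 2)\<^sup>2 \<le> (D * p - ?S u)\<^sup>2" using D p0 by (intro power_mono) auto
          then have "1 \<le> ?X u" using D p0 by (simp add: power2_commute)
          then show ?thesis using le1 F0[of u] \<epsilon> by linarith
        qed
      next
        case False
        then show ?thesis using bad[OF False] le1 X0[of u] \<epsilon> by linarith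
      qed
    qed
    also have "\<dots> = (\<integral>u. ?F u / (K * D) \<partial>?U) + (\<integral>u. ?X u \<partial>?U) + \<epsilon> / 3"
      by (subst Bochner_Integration.integral_add[OF Bochner_Integration.integrable_add[OF Fint(1) Xint(1)]],
          simp, subst Bochner_Integration.integral_add[OF Fint(1) Xint(1)]) (simp add: U.prob_space)
    also have "\<dots> \<le> \<epsilon>" using Fint(2) Xint(2) by linarith
    finally show ?thesis .
  qed
  show ?thesis
    unfolding public_separates_def
    by (intro exI[of _ b] exI[of _ s] exI[of _ rej] exI[of _ ?U] conjI allI impI order.refl U.prob_space_axioms sm sb null alt)
qed

lemma separation_scale:
  assumes nm: "1 \<le> n" "1 \<le> m" and \<rho>: "0 < \<rho>" and f: "f \<in> alternative d \<rho>"
    and C: "C * (sqrt (real d) / real n) * r \<le> \<rho>\<^sup>2"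
  shows "C * (sqrt (real d) / real m) * r \<le> energy n m d f"
proof -
  have "C * (sqrt (real d) / real m) * r = C * (sqrt (real d) / real n) * r * (real n / real m)"
    using nm by simp
  also have "\<dots> \<le> \<rho>\<^sup>2 * (real n / real m)" using C by (intro mult_right_mono) auto
  also have "\<dots> = \<rho>\<^sup>2 * real n / real m" by simp
  also have "\<dots> \<le> energy n m d f" by (rule energy_alternative[OF nm \<rho> f])
  finally show ?thesis .
qed

lemma public_separates_mono:
  assumes "public_separates n m d b \<epsilon> A" "b \<le> b'" "\<And>f. B f \<Longrightarrow> A f"
  shows "public_separates n m d b' \<epsilon> B"
  using assms unfolding public_separates_def by (meson order.trans)

lemma private_separates_mono:
  assumes "private_separates n m d b \<epsilon> A" "b \<le> b'" "\<And>f. B f \<Longrightarrow> A f"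
  shows "private_separates n m d b' \<epsilon> B"
  using assms unfolding private_separates_def by (meson order.trans)

text \<open>
  Below this number of machines a single machine already achieves the rate up to a constant.
\<close>

definition machine_constant :: "real \<Rightarrow> real" where
  "machine_constant \<epsilon> = (100000000 / \<epsilon>)\<^sup>2 + random_constant \<epsilon>"

definition rate_constant :: "real \<Rightarrow> real" where
  "rate_constant \<epsilon> = machine_constant \<epsilon> * (40 / \<epsilon>) + 4000000 / \<epsilon> + 138240 / \<epsilon> + random_constant \<epsilon>"

lemma rate_constant_bounds:
  assumes \<epsilon>: "0 < \<epsilon>"
  shows "0 < machine_constant \<epsilon>" "(100000000 / \<epsilon>)\<^sup>2 \<le> machine_constant \<epsilon>" "random_constant \<epsilon> \<le> machine_constant \<epsilon>"
    "machine_constant \<epsilon> * (40 / \<epsilon>) \<le> rate_constant \<epsilon>" "4000000 / \<epsilon> \<le> rate_constant \<epsilon>"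
    "138240 / \<epsilon> \<le> rate_constant \<epsilon>" "random_constant \<epsilon> \<le> rate_constant \<epsilon>" "0 < rate_constant \<epsilon>"
proof -
  have r: "0 \<le> random_constant \<epsilon>" by (simp add: random_constant_def)
  have e: "0 < 40 / \<epsilon>" "0 < 4000000 / \<epsilon>" "0 < 138240 / \<epsilon>" "0 < (100000000 / \<epsilon>)\<^sup>2" using \<epsilon> by simp_all
  show m: "0 < machine_constant \<epsilon>" "(100000000 / \<epsilon>)\<^sup>2 \<le> machine_constant \<epsilon>" "random_constant \<epsilon> \<le> machine_constant \<epsilon>"
    unfolding machine_constant_def using r e by linarith+
  have "0 < machine_constant \<epsilon> * (40 / \<epsilon>)" using m(1) e(1) by (rule mult_pos_pos)
  then show "machine_constant \<epsilon> * (40 / \<epsilon>) \<le> rate_constant \<epsilon>" "4000000 / \<epsilon> \<le> rate_constant \<epsilon>"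
    "138240 / \<epsilon> \<le> rate_constant \<epsilon>" "random_constant \<epsilon> \<le> rate_constant \<epsilon>" "0 < rate_constant \<epsilon>"
    unfolding rate_constant_def using r e by linarith+
qed

text \<open>
  When few machines are available, or when the budget is too small for reporting on directions to pay
  off, summaries of the squared norm achieve the rate \<open>sqrt d / sqrt m\<close>.
\<close>

lemma chi_square_regime_separates:
  assumes nm: "1 \<le> n" "1 \<le> m" "1 \<le> d" "1 \<le> b" and \<epsilon>: "0 < \<epsilon>" "\<epsilon> \<le> 1"
    and r: "1 \<le> r" "real m < machine_constant \<epsilon> \<or> sqrt (real m) \<le> r"
  shows "private_separates n m d b \<epsilon> (\<lambda>f. rate_constant \<epsilon> * (sqrt (real d) / real m) * min r (sqrt (real m)) \<le> energy n m d f)"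
proof (cases "real m < machine_constant \<epsilon>")
  case True
  note c = rate_constant_bounds[OF \<epsilon>(1)]
  show ?thesis
  proof (rule private_separates_mono[OF threshold_separates[OF nm \<epsilon>] order.refl])
    fix f assume E: "rate_constant \<epsilon> * (sqrt (real d) / real m) * min r (sqrt (real m)) \<le> energy n m d f"
    have "40 / \<epsilon> * sqrt (real d) \<le> rate_constant \<epsilon> * (sqrt (real d) / real m)"
    proof -
      have "real m * (40 / \<epsilon>) \<le> machine_constant \<epsilon> * (40 / \<epsilon>)" using True \<epsilon> by (intro mult_right_mono) auto
      also note c(4)
      finally have "real m * (40 / \<epsilon>) * (sqrt (real d) / real m) \<le> rate_constant \<epsilon> * (sqrt (real d) / real m)"
        by (intro mult_right_mono) auto
      then show ?thesis using nm by simp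
    qed
    also have "\<dots> * 1 \<le> rate_constant \<epsilon> * (sqrt (real d) / real m) * min r (sqrt (real m))"
      using r(1) nm c(8) by (intro mult_left_mono) auto
    finally show "40 / \<epsilon> * sqrt (real d) \<le> energy n m d f" using E by simp
  qed
next
  case False
  note c = rate_constant_bounds[OF \<epsilon>(1)]
  have r: "sqrt (real m) \<le> r" using r False by simp
  have "(100000000 / \<epsilon>)\<^sup>2 \<le> real m" using False c(2) by linarith
  then have "100000000 / \<epsilon> \<le> sqrt (real m)" by (rule real_le_rsqrt)
  moreover have "4000000 / \<epsilon> \<le> 100000000 / \<epsilon>" using \<epsilon> by (simp add: divide_right_mono)
  ultimately have m: "4000000 / \<epsilon> \<le> sqrt (real m)" by linarith
  show ?thesis
  proof (rule private_separates_mono[OF arctan_separates[OF nm \<epsilon>] order.refl])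
    fix f assume "rate_constant \<epsilon> * (sqrt (real d) / real m) * min r (sqrt (real m)) \<le> energy n m d f"
    then have "rate_constant \<epsilon> * (sqrt (real d) / real m) * sqrt (real m) \<le> energy n m d f" using r by simp
    then have "rate_constant \<epsilon> * (sqrt (real d) / real m) * sqrt (real m) * (sqrt (real m) / sqrt (real d))
      \<le> energy n m d f * (sqrt (real m) / sqrt (real d))" by (intro mult_right_mono) auto
    moreover have "rate_constant \<epsilon> * (sqrt (real d) / real m) * sqrt (real m) * (sqrt (real m) / sqrt (real d)) = rate_constant \<epsilon>"
      using nm by (simp add: field_simps)
    ultimately have "4000000 / \<epsilon> \<le> sqrt (real m) * (energy n m d f / sqrt (real d))"
      using c(5) by (simp add: mult.commute)
    then show "4000000 / \<epsilon> \<le> sqrt (real m) * min 1 (energy n m d f / sqrt (real d))"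
      using m by (simp add: min_def)
  qed
qed

lemma public_rate_separates:
  assumes nm: "1 \<le> n" "1 \<le> m" "1 \<le> d" "1 \<le> b" and \<epsilon>: "0 < \<epsilon>" "\<epsilon> \<le> 1"
  defines "r \<equiv> sqrt (real d / real (min b d))"
  shows "public_separates n m d b \<epsilon> (\<lambda>f. rate_constant \<epsilon> * (sqrt (real d) / real m) * min r (sqrt (real m)) \<le> energy n m d f)"
proof (cases "real m < machine_constant \<epsilon> \<or> sqrt (real m) \<le> r")
  case True
  have "1 \<le> r" unfolding r_def using nm by (simp add: le_divide_eq)
  then show ?thesis
    using True by (intro private_separates_imp_public_separates chi_square_regime_separates nm \<epsilon>)
next
  case False
  note c = rate_constant_bounds[OF \<epsilon>(1)]
  let ?b = "min b d"
  have b: "1 \<le> ?b" "?b \<le> d" using nm by auto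
  have m: "random_constant \<epsilon> \<le> real m" using False c(3) by linarith
  show ?thesis
  proof (rule public_separates_mono[OF random_directions_separate[OF nm(1,3) b \<epsilon> m]])
    fix f assume E: "rate_constant \<epsilon> * (sqrt (real d) / real m) * min r (sqrt (real m)) \<le> energy n m d f"
    have "random_constant \<epsilon> * (real d / (real m * sqrt (real ?b))) \<le> rate_constant \<epsilon> * (real d / (real m * sqrt (real ?b)))"
      using c(7) by (intro mult_right_mono) auto
    also have "\<dots> = rate_constant \<epsilon> * (sqrt (real d) / real m) * r"
    proof -
      have "real d / (real m * sqrt (real ?b)) = (sqrt (real d) * sqrt (real d)) / (real m * sqrt (real ?b))" by simp
      also have "\<dots> = (sqrt (real d) / real m) * r" unfolding r_def real_sqrt_divide by simp
      finally show ?thesis by simp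
    qed
    also have "\<dots> = rate_constant \<epsilon> * (sqrt (real d) / real m) * min r (sqrt (real m))"
      using False by (simp add: min_def)
    finally show "random_constant \<epsilon> * (real d / (real m * sqrt (real ?b))) \<le> energy n m d f" using E by linarith
  qed simp
qed

lemma private_rate_separates:
  assumes nm: "1 \<le> n" "1 \<le> m" "1 \<le> d" "1 \<le> b" and \<epsilon>: "0 < \<epsilon>" "\<epsilon> \<le> 1"
  defines "r \<equiv> real d / real (min b d)"
  shows "private_separates n m d b \<epsilon> (\<lambda>f. rate_constant \<epsilon> * (sqrt (real d) / real m) * min r (sqrt (real m)) \<le> energy n m d f)"
proof (cases "real m < machine_constant \<epsilon> \<or> sqrt (real m) \<le> r")
  case True
  have "1 \<le> r" unfolding r_def using nm by (simp add: le_divide_eq)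
  then show ?thesis
    using True by (intro chi_square_regime_separates nm \<epsilon>)
next
  case False
  note c = rate_constant_bounds[OF \<epsilon>(1)]
  let ?b = "min b d"
  have b: "1 \<le> ?b" "?b \<le> d" using nm by auto
  have "(100000000 / \<epsilon>)\<^sup>2 \<le> real m" using False c(2) by linarith
  then have m: "100000000 / \<epsilon> \<le> sqrt (real m)" by (rule real_le_rsqrt)
  have db: "real d / real ?b \<le> sqrt (real m)" using False by (simp add: r_def)
  show ?thesis
  proof (rule private_separates_mono[OF fixed_directions_separate[OF nm(1,3) b \<epsilon> m db]])
    fix f assume E: "rate_constant \<epsilon> * (sqrt (real d) / real m) * min r (sqrt (real m)) \<le> energy n m d f"
    have "138240 / \<epsilon> * (sqrt (real d) * real d / (real m * real ?b)) \<le> rate_constant \<epsilon> * (sqrt (real d) * real d / (real m * real ?b))"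
      using c(6) by (intro mult_right_mono) auto
    also have "\<dots> = rate_constant \<epsilon> * (sqrt (real d) / real m) * min r (sqrt (real m))"
      using False by (simp add: min_def r_def)
    finally show "138240 / \<epsilon> * (sqrt (real d) * real d / (real m * real ?b)) \<le> energy n m d f" using E by linarith
  qed simp
qed

theorem theorem3p2:
  fixes \<alpha> :: real
  assumes "0 < \<alpha>" and "\<alpha> < 1"
  shows "\<exists>C::real. C > 0 \<and>
    (\<forall>n m d b :: nat. n \<ge> 1 \<longrightarrow> m \<ge> 1 \<longrightarrow> d \<ge> 1 \<longrightarrow> b \<ge> 1 \<longrightarrow>
       (\<exists>T \<in> (public_protocols m d b :: public_test set).
          \<forall>\<rho>::real. \<rho> > 0 \<longrightarrow>
            \<rho>\<^sup>2 \<ge> C * (sqrt (real d) / real n) * min (sqrt (real d / real (min b d))) (sqrt (real m)) \<longrightarrow>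
            public_risk n m d (alternative d \<rho>) T \<le> \<alpha>)) \<and>
    (\<forall>n m d b :: nat. n \<ge> 1 \<longrightarrow> m \<ge> 1 \<longrightarrow> d \<ge> 1 \<longrightarrow> b \<ge> 1 \<longrightarrow>
       (\<exists>T \<in> (private_protocols m d b :: private_test set).
          \<forall>\<rho>::real. \<rho> > 0 \<longrightarrow>
            \<rho>\<^sup>2 \<ge> C * (sqrt (real d) / real n) * min (real d / real (min b d)) (sqrt (real m)) \<longrightarrow>
            private_risk n m d (alternative d \<rho>) T \<le> \<alpha>))"
proof -
  define \<epsilon> where "\<epsilon> = \<alpha> / 2"
  have \<epsilon>: "0 < \<epsilon>" "\<epsilon> \<le> 1" "2 * \<epsilon> = \<alpha>" using assms by (auto simp: \<epsilon>_def)
  show ?thesis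
  proof (intro exI[of _ "rate_constant \<epsilon>"] conjI allI impI)
    show "0 < rate_constant \<epsilon>" by (rule rate_constant_bounds(8)[OF \<epsilon>(1)])
    fix n m d b :: nat assume nm: "1 \<le> n" "1 \<le> m" "1 \<le> d" "1 \<le> b"
    show "\<exists>T \<in> (public_protocols m d b :: public_test set). \<forall>\<rho>::real. \<rho> > 0 \<longrightarrow>
            \<rho>\<^sup>2 \<ge> rate_constant \<epsilon> * (sqrt (real d) / real n) * min (sqrt (real d / real (min b d))) (sqrt (real m)) \<longrightarrow>
            public_risk n m d (alternative d \<rho>) T \<le> \<alpha>"
      using public_protocol_exists[OF nm(3) public_rate_separates[OF nm \<epsilon>(1,2)]] separation_scale[OF nm(1,2)]
      unfolding \<epsilon>(3) by meson
    show "\<exists>T \<in> (private_protocols m d b :: private_test set). \<forall>\<rho>::real. \<rho> > 0 \<longrightarrow>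
            \<rho>\<^sup>2 \<ge> rate_constant \<epsilon> * (sqrt (real d) / real n) * min (real d / real (min b d)) (sqrt (real m)) \<longrightarrow>
            private_risk n m d (alternative d \<rho>) T \<le> \<alpha>"
      using private_protocol_exists[OF nm(3) private_rate_separates[OF nm \<epsilon>(1,2)]] separation_scale[OF nm(1,2)]
      unfolding \<epsilon>(3) by meson
  qed
qed

end
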